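(* Let $\mathbb{K}\in\{\mathbb{R},\mathbb{C}\}$, $d,m,n\ge1$ with $(m,n)\ne(1,1)$ and $d(\mathbb{K})mn\ge3$. Then the stabilization map $s^{d,m}_{n,\mathbb{K}}:\mathrm{Q}^{d,m}_n(\mathbb{K})\to\mathrm{Q}^{d+1,m}_n(\mathbb{K})$ is a homology equivalence if $\lfloor d/n\rfloor=\lfloor (d+1)/n\rfloor$, and it is a homology equivalence through dimension $D(d;m,n,\mathbb{K})=(d(\mathbb{K})mn-2)(\lfloor d/n\rfloor+1)-1$ if $\lfloor d/n\rfloor<\lfloor(d+1)/n\rfloor$.
   Context: $d(\mathbb{K})=\dim_\mathbb{R}\mathbb{K}$. $\mathrm{Q}^{d,m}_n(\mathbb{K})$ is the space of $m$-tuples of monic degree-$d$ polynomials over $\mathbb{K}$ with no common real root of multiplicity $\ge n$. The stabilization map $s^{d,m}_{n,\mathbb{K}}$ (well defined up to homotopy) adds one root "from infinity" to each polynomial: it multiplies each $f_i$ by a linear factor $(z-x_i)$, where $x_1,\dots,x_m$ are distinct real numbers larger than the moduli of all roots of all $f_j$; it extends to an open embedding of discriminants $\Sigma^{d,m}_{n,\mathbb{K}}\times\mathbb{K}^m\to\Sigma^{d+1,m}_{n,\mathbb{K}}$. A map is a homology equivalence (through dimension $N$) if it induces isomorphisms on $H_k(-;\mathbb{Z})$ for all $k$ (for all $k\le N$). *)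

theory Defs
  imports "HOL-Analysis.Analysis" "HOL-Algebra.Free_Abelian_Groups"
    "HOL-Computational_Algebra.Polynomial"
begin

type_synonym 'a chain = "((nat \<Rightarrow> real) \<Rightarrow> 'a) \<Rightarrow>\<^sub>0 int"

definition standard_simplex :: "nat \<Rightarrow> (nat \<Rightarrow> real) set" where
  "standard_simplex p \<equiv>
    {x. (\<forall>i. 0 \<le> x i \<and> x i \<le> 1) \<and> (\<forall>i>p. x i = 0) \<and> (\<Sum>i\<le>p. x i) = 1}"

definition simplical_face :: "nat \<Rightarrow> (nat \<Rightarrow> 'a) \<Rightarrow> nat \<Rightarrow> 'a::comm_monoid_add" where
  "simplical_face k x \<equiv> \<lambda>i. if i < k then x i else if i = k then 0 else x(i -1)"

definition singular_simplex :: "nat \<Rightarrow> 'a topology \<Rightarrow> ((nat \<Rightarrow> real) \<Rightarrow> 'a) \<Rightarrow> bool" where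
  "singular_simplex p X f \<equiv>
      continuous_map (subtopology (powertop_real UNIV) (standard_simplex p)) X f
    \<and> f \<in> extensional (standard_simplex p)"

definition singular_face :: "nat \<Rightarrow> nat \<Rightarrow> ((nat \<Rightarrow> real) \<Rightarrow> 'a) \<Rightarrow> (nat \<Rightarrow> real) \<Rightarrow> 'a"
  where "singular_face p k f \<equiv> restrict (f \<circ> simplical_face k) (standard_simplex (p - Suc 0))"

definition singular_chain :: "nat \<Rightarrow> 'a topology \<Rightarrow> 'a chain \<Rightarrow> bool"
  where "singular_chain p X c \<equiv> Poly_Mapping.keys c \<subseteq> Collect (singular_simplex p X)"

definition chain_boundary :: "nat \<Rightarrow> 'a chain \<Rightarrow> 'a chain"
  where "chain_boundary p c \<equiv>
          (if p = 0 then 0 else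
           frag_extend (\<lambda>f. (\<Sum>k\<le>p. frag_cmul ((-1) ^ k) (frag_of (singular_face p k f)))) c)"

definition singular_cycle :: "nat \<Rightarrow> 'a topology \<Rightarrow> 'a chain \<Rightarrow> bool"
  where "singular_cycle p X c \<equiv> singular_chain p X c \<and> chain_boundary p c = 0"

definition singular_boundary :: "nat \<Rightarrow> 'a topology \<Rightarrow> 'a chain \<Rightarrow> bool"
  where "singular_boundary p X c \<equiv>
           \<exists>d. singular_chain (Suc p) X d \<and> chain_boundary (Suc p) d = c"

definition chain_group :: "nat \<Rightarrow> 'a topology \<Rightarrow> 'a chain monoid"
  where "chain_group p X \<equiv> free_Abelian_group (Collect (singular_simplex p X))"

definition cycle_group :: "nat \<Rightarrow> 'a topology \<Rightarrow> 'a chain monoid"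
  where "cycle_group p X \<equiv> subgroup_generated (chain_group p X) (Collect (singular_cycle p X))"

definition homology_group :: "nat \<Rightarrow> 'a topology \<Rightarrow> 'a chain set monoid"
  where "homology_group p X \<equiv> cycle_group p X Mod Collect (singular_boundary p X)"

definition simplex_map :: "nat \<Rightarrow> ('b \<Rightarrow> 'a) \<Rightarrow> ((nat \<Rightarrow> real) \<Rightarrow> 'b) \<Rightarrow> (nat \<Rightarrow> real) \<Rightarrow> 'a"
  where "simplex_map p g c \<equiv> restrict (g \<circ> c) (standard_simplex p)"

definition chain_map :: "nat \<Rightarrow> ('b \<Rightarrow> 'a) \<Rightarrow> 'b chain \<Rightarrow> 'a chain"
  where "chain_map p g c \<equiv> frag_extend (frag_of \<circ> simplex_map p g) c"

definition hom_induced :: "nat \<Rightarrow> 'a topology \<Rightarrow> 'b topology \<Rightarrow> ('a \<Rightarrow> 'b)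
                           \<Rightarrow> 'a chain set \<Rightarrow> 'b chain set"
  where "hom_induced p X Y f \<equiv>
     \<lambda>A. Collect (singular_boundary p Y) #>\<^bsub>cycle_group p Y\<^esub> chain_map p f (SOME c. c \<in> A)"

definition homology_equivalence :: "'a topology \<Rightarrow> 'b topology \<Rightarrow> ('a \<Rightarrow> 'b) \<Rightarrow> bool"
  where "homology_equivalence X Y f \<equiv>
     continuous_map X Y f \<and>
     (\<forall>k. hom_induced k X Y f \<in> iso (homology_group k X) (homology_group k Y))"

definition homology_equivalence_through :: "int \<Rightarrow> 'a topology \<Rightarrow> 'b topology \<Rightarrow> ('a \<Rightarrow> 'b) \<Rightarrow> bool"
  where "homology_equivalence_through N X Y f \<equiv>
     continuous_map X Y f \<and>
     (\<forall>k. int k \<le> N \<longrightarrow> hom_induced k X Y f \<in> iso (homology_group k X) (homology_group k Y))"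

text \<open>The field K is encoded as a subset of the complex numbers: \<real> (the reals) or UNIV (all of C).
A point of the coefficient space is a function a with a i k the coefficient of z^k in f_i
(for i < m, k < d); all other entries are zero.  The leading coefficient 1 is implicit.\<close>

definition dimK :: "complex set \<Rightarrow> nat" where
  "dimK K = (if K = \<real> then 1 else 2)"

definition monic_poly :: "nat \<Rightarrow> (nat \<Rightarrow> complex) \<Rightarrow> complex poly" where
  "monic_poly d c = monom 1 d + (\<Sum>k<d. monom (c k) k)"

definition Qspace :: "complex set \<Rightarrow> nat \<Rightarrow> nat \<Rightarrow> nat \<Rightarrow> (nat \<Rightarrow> nat \<Rightarrow> complex) set" where
  "Qspace K d m n =
     {a. (\<forall>i k. (m \<le> i \<or> d \<le> k) \<longrightarrow> a i k = 0) \<and>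
         (\<forall>i<m. \<forall>k<d. a i k \<in> K) \<and>
         \<not> (\<exists>x::real. \<forall>i<m. n \<le> Polynomial.order (complex_of_real x) (monic_poly d (a i)))}"

definition Qtop :: "complex set \<Rightarrow> nat \<Rightarrow> nat \<Rightarrow> nat \<Rightarrow> (nat \<Rightarrow> nat \<Rightarrow> complex) topology" where
  "Qtop K d m n = subtopology euclidean (Qspace K d m n)"

text \<open>A continuous bound strictly exceeding the moduli of all roots of all f_i (Cauchy bound).\<close>
definition root_bound :: "nat \<Rightarrow> nat \<Rightarrow> (nat \<Rightarrow> nat \<Rightarrow> complex) \<Rightarrow> real" where
  "root_bound d m a = 1 + (\<Sum>i<m. \<Sum>k<d. norm (a i k))"

text \<open>Representative of the stabilization map: multiply f_i by (z - x_i) with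
x_i = root_bound + i, distinct reals larger than the moduli of all roots.\<close>
definition stab :: "nat \<Rightarrow> nat \<Rightarrow> (nat \<Rightarrow> nat \<Rightarrow> complex) \<Rightarrow> (nat \<Rightarrow> nat \<Rightarrow> complex)" where
  "stab d m a = (\<lambda>i k. if i < m \<and> k \<le> d then
       coeff (monic_poly d (a i) * [:- complex_of_real (root_bound d m a + real i), 1:]) k
     else 0)"

end

theory Submission
  imports Defs "HOL-Homology.Homology_Groups"
begin

text \<open>
  Filter the affine space \<open>P\<close> of all \<open>m\<close>-tuples of monic polynomials of degree \<open>d\<close> by the number \<open>j\<close> of
  common real roots of multiplicity at least \<open>n\<close>, counted as the degree of the largest real-rooted \<open>h\<close>
  with \<open>h\<^sup>n\<close> dividing every \<open>f\<^sub>i\<close>. The tuples with exactly \<open>j\<close> such roots form a set \<open>S\<^sub>j\<close>, closed in the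
  open set \<open>U\<^sub>j\<close> of tuples with at most \<open>j\<close>, and homeomorphic to the product of the chamber
  \<open>x\<^sub>0 \<le> \<dots> \<le> x\<^bsub>j-1\<^esub>\<close> and the space \<open>Q\<close> of degree \<open>d - j n\<close>. The set \<open>S\<^sub>j\<close> need not be smooth (there are
  cusps), but up to \<open>j\<close> suspensions the relative homology of \<open>(U\<^sub>j, U\<^sub>j - S\<^sub>j)\<close> is that of
  \<open>(U\<^sub>j \<times> \<real>\<^sup>j, U\<^sub>j \<times> \<real>\<^sup>j - S\<^sub>j \<times> 0)\<close>, and a continuous extension of the root vector from \<open>S\<^sub>j\<close> to \<open>U\<^sub>j\<close>
  shears \<open>S\<^sub>j \<times> 0\<close> onto the set of all \<open>(f, x)\<close> with \<open>x\<close> the root vector of \<open>f \<in> S\<^sub>j\<close>. Near this set, division with remainder by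
  \<open>h\<^sub>x\<^sup>n\<close>, \<open>h\<^sub>x = \<Prod>(z - x\<^sub>l)\<close>, gives coordinates \<open>(x, q, r)\<close> in which it is described by \<open>r = 0\<close> and \<open>x\<close> sorted.

  For \<open>j \<ge> 2\<close> the chamber can be pushed off itself, so the relative homology vanishes and
  \<open>H\<^sub>k(P, Q) = H\<^sub>k(U\<^sub>1, U\<^sub>0)\<close>. For \<open>j = 1\<close> the coordinates identify this with the homology of the space \<open>Q\<close> of degree
  \<open>d - n\<close> shifted by \<open>d(K) m n - 1\<close>, the number of real coordinates of \<open>r\<close> minus one. Stabilization preserves the
  common roots and is compatible with all these identifications up to homotopy. As \<open>P\<close> is contractible,
  the theorem follows by induction from \<open>d - n\<close> to \<open>d\<close>.
\<close>

section \<open>Agreement of the given homology groups and induced maps with singular homology in the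
  library\<close>

hide_const (open) Defs.standard_simplex Defs.simplical_face Defs.singular_simplex Defs.singular_face
  Defs.singular_chain Defs.chain_boundary Defs.chain_group Defs.homology_group
  Defs.simplex_map Defs.chain_map Defs.hom_induced
hide_fact (open) Defs.standard_simplex_def Defs.simplical_face_def Defs.singular_simplex_def
  Defs.singular_face_def Defs.singular_chain_def Defs.chain_boundary_def Defs.chain_group_def
  Defs.homology_group_def Defs.simplex_map_def Defs.chain_map_def Defs.hom_induced_def

lemma Defs_singular:
  shows "Defs.standard_simplex = standard_simplex"
    and "Defs.simplical_face = simplical_face"
    and "Defs.singular_simplex = singular_simplex"
    and "Defs.singular_face = singular_face"
    and "Defs.singular_chain = singular_chain"
    and "Defs.chain_boundary = chain_boundary"
    and "Defs.chain_group = chain_group"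
    and "Defs.simplex_map = simplex_map"
    and "Defs.chain_map = chain_map"
proof -
  show 1: "Defs.standard_simplex = standard_simplex"
    by (simp add: fun_eq_iff Defs.standard_simplex_def standard_simplex_def)
  show 2: "Defs.simplical_face = simplical_face"
    by (simp add: fun_eq_iff Defs.simplical_face_def simplical_face_def)
  show 3: "Defs.singular_simplex = singular_simplex"
    by (simp add: fun_eq_iff Defs.singular_simplex_def singular_simplex_def 1)
  show 4: "Defs.singular_face = singular_face"
    by (simp add: fun_eq_iff Defs.singular_face_def singular_face_def 1 2)
  show 5: "Defs.singular_chain = singular_chain"
    by (simp add: fun_eq_iff Defs.singular_chain_def singular_chain_def 3)
  show 6: "Defs.chain_boundary = chain_boundary"
    by (simp add: fun_eq_iff Defs.chain_boundary_def chain_boundary_def 4)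
  show 7: "Defs.chain_group = chain_group"
    by (simp add: fun_eq_iff Defs.chain_group_def chain_group_def 3)
  show 8: "Defs.simplex_map = simplex_map"
    by (simp add: fun_eq_iff Defs.simplex_map_def simplex_map_def 1)
  show 9: "Defs.chain_map = chain_map"
    by (simp add: fun_eq_iff Defs.chain_map_def chain_map_def 8)
qed

lemma singular_cycle_eq: "singular_cycle p X = singular_relcycle p X {}"
  by (simp add: fun_eq_iff Defs.singular_cycle_def Simplices.singular_cycle Defs_singular)

lemma singular_boundary_eq: "singular_boundary p X = singular_relboundary p X {}"
  by (simp add: fun_eq_iff Defs.singular_boundary_def Simplices.singular_boundary Defs_singular)

lemma cycle_group_eq: "cycle_group p X = relcycle_group p X {}"
  by (simp add: cycle_group_def relcycle_group_def Defs_singular singular_cycle_eq)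

lemma Defs_homology_group_eq:
  "Defs.homology_group p X = homology_group (int p) X"
  by (simp add: Defs.homology_group_def relative_homology_group_def cycle_group_eq singular_boundary_eq)

text \<open>The given map picks some chain of the class and takes the coset of its image. Two chains
  of one class differ by a boundary, so every choice yields the same coset; outside the carrier
  nothing is claimed.\<close>

lemma Defs_hom_induced_eq:
  assumes f: "continuous_map X Y f" and c: "c \<in> carrier (homology_group (int p) X)"
  shows "Defs.hom_induced p X Y f c = hom_induced (int p) X {} Y {} f c"
proof -
  obtain z where z: "singular_relcycle p X {} z" "c = homologous_rel_set p X {} z"
    using c by (auto simp: carrier_relative_homology_group)
  define w where "w = (SOME c'. c' \<in> c)"
  have "z \<in> c" using z by simp
  then have "w \<in> c" unfolding w_def by (rule someI)
  then have zw: "homologous_rel p X {} z w" using z by simp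
  then have c': "c = homologous_rel_set p X {} w"
    using z(2) homologous_rel_set_eq by metis
  have w: "singular_relcycle p X {} w"
    using homologous_rel_singular_relcycle z(1) zw by blast
  have "hom_induced (int p) X {} Y {} f c = homologous_rel_set p Y {} (chain_map p f w)"
    unfolding c' using f w by (simp add: hom_induced_chain_map)
  also have "\<dots> = Defs.hom_induced p X Y f c"
    unfolding Defs.hom_induced_def w_def[symmetric] cycle_group_eq singular_boundary_eq
      right_coset_singular_relboundary Defs_singular ..
  finally show ?thesis ..
qed

text \<open>Being an isomorphism depends only on the values on the carrier, and there the two
  induced maps agree.\<close>

lemma Defs_hom_induced_iso_iff:
  assumes f: "continuous_map X Y f"
  shows "Defs.hom_induced p X Y f \<in> iso (Defs.homology_group p X) (Defs.homology_group p Y)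
    \<longleftrightarrow> hom_induced (int p) X {} Y {} f \<in> iso (homology_group (int p) X) (homology_group (int p) Y)"
  unfolding Defs_homology_group_eq
proof 
  have *: "Defs.hom_induced p X Y f c = hom_induced (int p) X {} Y {} f c"
    if "c \<in> carrier (homology_group (int p) X)" for c
    using Defs_hom_induced_eq[OF f that] .
  have grp: "group (homology_group (int p) X)" by simp
  {
    assume "Defs.hom_induced p X Y f \<in> iso (homology_group (int p) X) (homology_group (int p) Y)"
    from group.iso_eq[OF grp this] show
      "hom_induced (int p) X {} Y {} f \<in> iso (homology_group (int p) X) (homology_group (int p) Y)"
      by (simp add: *)
  next
    assume "hom_induced (int p) X {} Y {} f \<in> iso (homology_group (int p) X) (homology_group (int p) Y)"
    from group.iso_eq[OF grp this] show
      "Defs.hom_induced p X Y f \<in> iso (homology_group (int p) X) (homology_group (int p) Y)"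
      by (simp add: *)
  }
qed

section \<open>Homology of pairs of subspaces\<close>

definition pair_map :: "'a::topological_space set \<Rightarrow> 'a set \<Rightarrow> 'b::topological_space set \<Rightarrow> 'b set \<Rightarrow> ('a \<Rightarrow> 'b) \<Rightarrow> bool" where
  "pair_map X S Y T f \<longleftrightarrow> S \<subseteq> X \<and> T \<subseteq> Y \<and> continuous_on X f \<and> f ` X \<subseteq> Y \<and> f ` S \<subseteq> T"

abbreviation rel_hom :: "int \<Rightarrow> 'a::topological_space set \<Rightarrow> 'a set \<Rightarrow> 'a chain set monoid" where
  "rel_hom k X S \<equiv> relative_homology_group k (top_of_set X) S"

abbreviation hind :: "int \<Rightarrow> 'a::topological_space set \<Rightarrow> 'a set \<Rightarrow> 'b::topological_space set \<Rightarrow> 'b set \<Rightarrow> ('a \<Rightarrow> 'b) \<Rightarrow> 'a chain set \<Rightarrow> 'b chain set" where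
  "hind k X S Y T f \<equiv> hom_induced k (top_of_set X) S (top_of_set Y) T f"

text \<open>Stated for arbitrary functions, because \<open>hom_induced\<close> is a homomorphism for
  every function. The condition \<open>pair_map\<close> is supplied separately wherever
  functoriality is used.\<close>

definition hiso :: "int \<Rightarrow> 'a::topological_space set \<Rightarrow> 'a set \<Rightarrow> 'b::topological_space set \<Rightarrow> 'b set \<Rightarrow> ('a \<Rightarrow> 'b) \<Rightarrow> bool" where
  "hiso k X S Y T f \<longleftrightarrow> hind k X S Y T f \<in> iso (rel_hom k X S) (rel_hom k Y T)"

definition hzero :: "int \<Rightarrow> 'a::topological_space set \<Rightarrow> 'a set \<Rightarrow> bool" where
  "hzero k X S \<longleftrightarrow> trivial_group (rel_hom k X S)"

lemma pair_map_compose: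
  "pair_map X S Y T f \<Longrightarrow> pair_map Y T Z U g \<Longrightarrow> pair_map X S Z U (g \<circ> f)"
  unfolding pair_map_def
  by (auto simp: image_subset_iff intro: continuous_on_compose2[of Y g X f])

lemma hind_compose:
  assumes "pair_map X S Y T f" "pair_map Y T Z U g"
  shows "hind k X S Z U (g \<circ> f) = hind k Y T Z U g \<circ> hind k X S Y T f"
  by (rule hom_induced_compose) (use assms in \<open>auto simp: pair_map_def\<close>)

lemma hind_cong:
  assumes "\<And>x. x \<in> X \<Longrightarrow> f x = g x"
  shows "hind k X S Y T f = hind k X S Y T g"
  by (rule hom_induced_eq) (use assms in auto)

text \<open>Compose with an inverse of \<open>f\<close>. The result agrees with \<open>g\<close>
  only on the carrier of \<open>H\<close>, hence the appeal to \<open>iso_eq\<close>.\<close>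

lemma iso_two_of_three_right:
  assumes G: "group G" and H: "group H" and f: "f \<in> iso G H" and g: "g \<in> hom H I"
  shows "g \<circ> f \<in> iso G I \<longleftrightarrow> g \<in> iso H I"
proof
  assume "g \<in> iso H I" with f show "g \<circ> f \<in> iso G I" by (rule iso_set_trans)
next
  assume gf: "g \<circ> f \<in> iso G I"
  obtain f' where f': "group_isomorphisms G H f f'"
    using f group.iso_iff_group_isomorphisms[OF G] by blast
  then have "f' \<in> iso H G"
    by (metis group_isomorphisms_sym group_isomorphisms_imp_iso)
  then have "(g \<circ> f) \<circ> f' \<in> iso H I" using gf by (rule iso_set_trans)
  then show "g \<in> iso H I"
    by (rule group.iso_eq[OF H]) (use f' in \<open>auto simp: group_isomorphisms_def\<close>)
qed

lemma iso_two_of_three_left: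
  assumes G: "group G" and H: "group H" and f: "f \<in> hom G H" and g: "g \<in> iso H I"
  shows "g \<circ> f \<in> iso G I \<longleftrightarrow> f \<in> iso G H"
proof
  assume "f \<in> iso G H" then show "g \<circ> f \<in> iso G I" using g by (rule iso_set_trans)
next
  assume gf: "g \<circ> f \<in> iso G I"
  obtain g' where g': "group_isomorphisms H I g g'"
    using g group.iso_iff_group_isomorphisms[OF H] by blast
  then have "g' \<in> iso I H"
    by (metis group_isomorphisms_sym group_isomorphisms_imp_iso)
  with gf have "g' \<circ> (g \<circ> f) \<in> iso G H" by (rule iso_set_trans)
  then show "f \<in> iso G H"
    by (rule group.iso_eq[OF G])
      (use f g' in \<open>auto simp: group_isomorphisms_def hom_def Pi_iff\<close>)
qed

lemma hiso_comp_right: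
  assumes "pair_map X S Y T f" "pair_map Y T Z U g" "hiso k X S Y T f"
  shows "hiso k X S Z U (g \<circ> f) \<longleftrightarrow> hiso k Y T Z U g"
  unfolding hiso_def hind_compose[OF assms(1,2)]
  by (rule iso_two_of_three_right) (use assms(3) in \<open>auto simp: hiso_def hom_induced_hom\<close>)

lemma hiso_comp_left:
  assumes "pair_map X S Y T f" "pair_map Y T Z U g" "hiso k Y T Z U g"
  shows "hiso k X S Z U (g \<circ> f) \<longleftrightarrow> hiso k X S Y T f"
  unfolding hiso_def hind_compose[OF assms(1,2)]
  by (rule iso_two_of_three_left) (use assms(3) in \<open>auto simp: hiso_def hom_induced_hom\<close>)

lemma hind_homotopic:
  assumes cont: "continuous_on ({0..1::real} \<times> X) (\<lambda>(t,x). h t x)"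
    and X: "\<And>t x. t \<in> {0..1} \<Longrightarrow> x \<in> X \<Longrightarrow> h t x \<in> Y"
    and S: "\<And>t x. t \<in> {0..1} \<Longrightarrow> x \<in> S \<Longrightarrow> h t x \<in> T"
  shows "hind k X S Y T (h 0) = hind k X S Y T (h 1)"
proof (rule homology_homotopy_axiom)
  have "prod_topology (top_of_set {0..1::real}) (top_of_set X) = top_of_set ({0..1} \<times> X)"
    by (simp add: subtopology_Times euclidean_product_topology flip: euclidean_product_topology)
  then show "homotopic_with (\<lambda>h. h \<in> S \<rightarrow> T) (top_of_set X) (top_of_set Y) (h 0) (h 1)"
    unfolding homotopic_with_def using cont X S
    by (intro exI[of _ "\<lambda>(t,x). h t x"]) auto
qed

lemma hiso_homotopic:
  assumes "continuous_on ({0..1::real} \<times> X) (\<lambda>(t,x). h t x)"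
    and "\<And>t x. t \<in> {0..1} \<Longrightarrow> x \<in> X \<Longrightarrow> h t x \<in> Y"
    and "\<And>t x. t \<in> {0..1} \<Longrightarrow> x \<in> S \<Longrightarrow> h t x \<in> T"
  shows "hiso k X S Y T (h 0) \<longleftrightarrow> hiso k X S Y T (h 1)"
  using hind_homotopic[OF assms] by (simp add: hiso_def)

lemma hind_ident: "c \<in> carrier (rel_hom k X S) \<Longrightarrow> hind k X S X S (\<lambda>x. x) c = c"
  by (rule hom_induced_id_gen) simp_all

lemma hiso_inverse:
  assumes f: "pair_map X S Y T f" and g: "pair_map Y T X S g"
    and 1: "hind k X S X S (g \<circ> f) = hind k X S X S (\<lambda>x. x)"
    and 2: "hind k Y T Y T (f \<circ> g) = hind k Y T Y T (\<lambda>x. x)"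
  shows "hiso k X S Y T f"
proof -
  have "hind k Y T X S g (hind k X S Y T f c) = c" if "c \<in> carrier (rel_hom k X S)" for c
    using that 1 hind_ident unfolding hind_compose[OF f g] by (metis comp_apply)
  moreover have "hind k X S Y T f (hind k Y T X S g c) = c" if "c \<in> carrier (rel_hom k Y T)" for c
    using that 2 hind_ident unfolding hind_compose[OF g f] by (metis comp_apply)
  ultimately have "group_isomorphisms (rel_hom k X S) (rel_hom k Y T) (hind k X S Y T f) (hind k Y T X S g)"
    unfolding group_isomorphisms_def by (simp add: hom_induced_hom)
  then show ?thesis unfolding hiso_def by (rule group_isomorphisms_imp_iso)
qed

lemma hiso_homeo:
  assumes f: "pair_map X S Y T f" and g: "pair_map Y T X S g"
    and "\<And>x. x \<in> X \<Longrightarrow> g (f x) = x" "\<And>y. y \<in> Y \<Longrightarrow> f (g y) = y"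
  shows "hiso k X S Y T f"
  by (rule hiso_inverse[OF f g]) (rule hind_cong; use assms in auto)+

text \<open>The homology of \<open>X\<close> relative to the complement of a closed set
  \<open>A\<close> depends only on a neighbourhood of \<open>A\<close>. The excised set
  \<open>X - U\<close> is closed and lies in the open set \<open>X - A\<close>.\<close>

lemma hiso_excision:
  assumes A: "closedin (top_of_set X) A" and U: "openin (top_of_set X) U" and AU: "A \<subseteq> U"
  shows "hiso k U (U - A) X (X - A) (\<lambda>x. x)"
proof -
  have UX: "U \<subseteq> X" using U openin_imp_subset by auto
  have 1: "(top_of_set X) closure_of (X - U) \<subseteq> (top_of_set X) interior_of (X - A)"
  proof -
    have "closedin (top_of_set X) (X - U)" using U by (simp add: openin_closedin_eq)
    then have "(top_of_set X) closure_of (X - U) = X - U" by (simp add: closure_of_closedin)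
    moreover have "openin (top_of_set X) (X - A)" using A by (simp add: closedin_def)
    then have "(top_of_set X) interior_of (X - A) = X - A" by (simp add: interior_of_openin)
    ultimately show ?thesis using AU by auto
  qed
  have "X - (X - U) = U" "X - A - (X - U) = U - A" using UX by auto
  then show ?thesis
    using homology_excision_axiom[OF 1, of X k] UX
    by (simp add: hiso_def subtopology_subtopology Int_absorb1 Int_absorb2 id_def)
qed

lemma hiso_hzero:
  assumes "hiso k X S Y T f"
  shows "hzero k X S \<longleftrightarrow> hzero k Y T"
  using assms unfolding hiso_def hzero_def
  by (metis group_relative_homology_group is_isoI isomorphic_group_triviality)

lemma hiso_of_hzero:
  assumes "hzero k X S" "hzero k Y T"
  shows "hiso k X S Y T f"
proof -
  have "trivial_group (rel_hom k X S)" "trivial_group (rel_hom k Y T)"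
    using assms by (auto simp: hzero_def)
  moreover have "hind k X S Y T f \<in> hom (rel_hom k X S) (rel_hom k Y T)" by (rule hom_induced_hom)
  ultimately show ?thesis unfolding hiso_def 
    by (auto simp: trivial_group_def iso_def bij_betw_def hom_one dest: hom_carrier)
qed

lemma hzero_negative: "k < 0 \<Longrightarrow> hzero k X S"
  by (simp add: hzero_def)

lemma hzero_same: "hzero k X X"
  unfolding hzero_def using trivial_relative_homology_group_topspace[of k "top_of_set X"] by simp

lemma hzero_empty: "hzero k {} S"
  unfolding hzero_def by (simp add: trivial_relative_homology_group_empty)

text \<open>Statements about isomorphisms, such as the suspension theorem below, thereby also apply to vanishing groups.\<close>

lemma hzero_iff_hiso: "hzero k X S \<longleftrightarrow> hiso k {} {} X S f"
proof
  assume "hzero k X S" then show "hiso k {} {} X S f" by (rule hiso_of_hzero[OF hzero_empty])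
next
  assume "hiso k {} {} X S f" from hiso_hzero[OF this] show "hzero k X S" by (simp add: hzero_empty)
qed

text \<open>The end map \<open>h 1\<close> goes from \<open>(X, S)\<close> to \<open>(S, S)\<close>.
  It is inverse to the inclusion up to the homotopy \<open>h\<close>, which respects
  \<open>S\<close>, and \<open>(S, S)\<close> has no homology.\<close>

lemma hzero_push_off:
  assumes cont: "continuous_on ({0..1::real} \<times> X) (\<lambda>(t,x). h t x)"
    and X: "\<And>t x. t \<in> {0..1} \<Longrightarrow> x \<in> X \<Longrightarrow> h t x \<in> X"
    and S: "\<And>t x. t \<in> {0..1} \<Longrightarrow> x \<in> S \<Longrightarrow> h t x \<in> S"
    and h0: "\<And>x. x \<in> X \<Longrightarrow> h 0 x = x"
    and h1: "\<And>x. x \<in> X \<Longrightarrow> h 1 x \<in> S" and SX: "S \<subseteq> X"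
  shows "hzero k X S"
proof -
  have c1: "continuous_on X (h 1)"
  proof -
    have "continuous_on X ((\<lambda>(t,x). h t x) \<circ> (\<lambda>x. (1,x)))"
      by (intro continuous_on_compose continuous_on_subset[OF cont] continuous_intros) auto
    then show ?thesis by (simp add: o_def)
  qed
  have f: "pair_map X S S S (h 1)" using c1 h1 SX by (auto simp: pair_map_def)
  have g: "pair_map S S X S (\<lambda>x. x)" using SX by (auto simp: pair_map_def)
  have "hiso k X S S S (h 1)"
  proof (rule hiso_inverse[OF f g])
    have "hind k X S X S (h 1) = hind k X S X S (h 0)" 
      by (rule hind_homotopic[where h=h, OF cont, symmetric]) (use X S SX h1 in auto)
    also have "\<dots> = hind k X S X S (\<lambda>x. x)" by (rule hind_cong) (rule h0)
    finally show "hind k X S X S ((\<lambda>x. x) \<circ> h 1) = hind k X S X S (\<lambda>x. x)" by (simp add: o_def)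
    have "hind k S S S S (h 1) = hind k S S S S (h 0)" 
      by (rule hind_homotopic[where h=h, symmetric]) (use S SX in \<open>auto intro: continuous_on_subset[OF cont]\<close>)
    also have "\<dots> = hind k S S S S (\<lambda>x. x)" by (rule hind_cong) (use SX h0 in auto)
    finally show "hind k S S S S (h 1 \<circ> (\<lambda>x. x)) = hind k S S S S (\<lambda>x. x)" by (simp add: o_def)
  qed
  from hiso_hzero[OF this] show ?thesis by (simp add: hzero_same)
qed

lemma subset_top: "S \<subseteq> X \<Longrightarrow> subtopology (top_of_set X) S = top_of_set S"
  by (simp add: subtopology_subtopology Int_absorb1)

text \<open>In the exact sequence of the triple \<open>S \<subseteq> U \<subseteq> X\<close> the map
  in question stands between the groups of \<open>(X, U)\<close> in degrees \<open>k + 1\<close> and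
  \<open>k\<close>.\<close>

lemma hiso_inclusion_of_hzero:
  assumes S: "S \<subseteq> U" "U \<subseteq> X" and z: "hzero k X U" "hzero (k+1) X U"
  shows "hiso k U S X S (\<lambda>x. x)"
proof -
  let ?T = "top_of_set X"
  have 2: "exact_seq ([rel_hom k X S, relative_homology_group k (subtopology ?T U) S, rel_hom (k+1) X U],
    [hom_induced k (subtopology ?T U) S ?T S id, hom_relboundary (k+1) ?T U S])"
    using homology_exactness_triple_2[OF S(1), of "k+1" ?T] by simp
  have 3: "exact_seq ([rel_hom k X U, rel_hom k X S, relative_homology_group k (subtopology ?T U) S],
    [hom_induced k ?T S ?T U id, hom_induced k (subtopology ?T U) S ?T S id])"
    using homology_exactness_triple_3[OF S(1), of k ?T] by simp
  have "hom_induced k (subtopology ?T U) S ?T S id \<in> iso (relative_homology_group k (subtopology ?T U) S) (rel_hom k X S)"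
  proof (rule very_short_exact_sequence)
    show "exact_seq ([rel_hom k X U, rel_hom k X S, relative_homology_group k (subtopology ?T U) S, rel_hom (k+1) X U],
      [hom_induced k ?T S ?T U id, hom_induced k (subtopology ?T U) S ?T S id, hom_relboundary (k+1) ?T U S])"
      using 2 3 by (simp only: exact_seq_cons_iff exact_seq_end_iff)
  qed (use z in \<open>simp_all only: hzero_def\<close>)
  then show ?thesis using subset_top[OF S(2)] by (simp add: hiso_def id_def)
qed

text \<open>Exactness at the group of \<open>(X, S)\<close>: since its target is trivial, the kernel
  is everything, and it is the image of a trivial group.\<close>

lemma hzero_triple:
  assumes S: "S \<subseteq> U" "U \<subseteq> X" and z: "hzero k X U" "hzero k U S"
  shows "hzero k X S"
proof -
  let ?T = "top_of_set X"
  have 3: "exact_seq ([rel_hom k X U, rel_hom k X S, relative_homology_group k (subtopology ?T U) S],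
    [hom_induced k ?T S ?T U id, hom_induced k (subtopology ?T U) S ?T S id])"
    using homology_exactness_triple_3[OF S(1), of k ?T] by simp
  have z2: "trivial_group (relative_homology_group k (subtopology ?T U) S)"
    using z(2) subset_top[OF S(2)] by (simp add: hzero_def)
  have z1: "trivial_group (rel_hom k X U)" using z by (simp add: hzero_def)
  have h: "hom_induced k ?T S ?T U id \<in> hom (rel_hom k X S) (rel_hom k X U)" by (rule hom_induced_hom)
  have h2: "hom_induced k (subtopology ?T U) S ?T S id \<in> hom (relative_homology_group k (subtopology ?T U) S) (rel_hom k X S)"
    by (rule hom_induced_hom)
  have ex: "kernel (rel_hom k X S) (rel_hom k X U) (hom_induced k ?T S ?T U id)
    = hom_induced k (subtopology ?T U) S ?T S id ` carrier (relative_homology_group k (subtopology ?T U) S)"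
    using 3 by simp
  have "carrier (rel_hom k X S) \<subseteq> kernel (rel_hom k X S) (rel_hom k X U) (hom_induced k ?T S ?T U id)"
    using z1 h by (auto simp: kernel_def trivial_group_def hom_def)
  also have "\<dots> = {\<one>\<^bsub>rel_hom k X S\<^esub>}"
    unfolding ex using z2 hom_one[OF h2] by (simp add: trivial_group_def)
  finally have "carrier (rel_hom k X S) \<subseteq> {\<one>\<^bsub>rel_hom k X S\<^esub>}" .
  moreover have "\<one>\<^bsub>rel_hom k X S\<^esub> \<in> carrier (rel_hom k X S)"
    by (simp add: group.is_monoid monoid.one_closed)
  ultimately have "carrier (rel_hom k X S) = {\<one>\<^bsub>rel_hom k X S\<^esub>}" by blast
  then show ?thesis unfolding hzero_def trivial_group_def by simp
qed

section \<open>The five lemma and maps between long exact sequences\<close>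

text \<open>The usual diagram chase, written multiplicatively, with \<open>a\<close> only onto and
  \<open>e\<close> only one-to-one.\<close>

lemma five_lemma:
  assumes ex: "exact_seq ([E,D,C,B,A], [k,h,g,f])" and ex': "exact_seq ([E',D',C',B',A'], [k',h',g',f'])"
    and a: "a ` carrier A = carrier A'"
    and b: "b \<in> iso B B'"
    and c: "c \<in> hom C C'"
    and d: "d \<in> iso D D'"
    and e: "e \<in> hom E E'" "inj_on e (carrier E)"
    and fa: "\<And>x. x \<in> carrier A \<Longrightarrow> f' (a x) = b (f x)"
    and gb: "\<And>x. x \<in> carrier B \<Longrightarrow> g' (b x) = c (g x)"
    and hc: "\<And>x. x \<in> carrier C \<Longrightarrow> h' (c x) = d (h x)"
    and kd: "\<And>x. x \<in> carrier D \<Longrightarrow> k' (d x) = e (k x)"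
  shows "c \<in> iso C C'"
proof -
  have gr: "group A" "group B" "group C" "group D" "group E" "group A'" "group B'" "group C'" "group D'" "group E'"
    and f: "f \<in> hom A B" and g: "g \<in> hom B C" and h: "h \<in> hom C D" and k: "k \<in> hom D E"
    and f': "f' \<in> hom A' B'" and g': "g' \<in> hom B' C'" and h': "h' \<in> hom C' D'" and k': "k' \<in> hom D' E'"
    and exB: "kernel B C g = f ` carrier A" and exC: "kernel C D h = g ` carrier B"
    and exD: "kernel D E k = h ` carrier C"
    and exB': "kernel B' C' g' = f' ` carrier A'" and exC': "kernel C' D' h' = g' ` carrier B'"
    and exD': "kernel D' E' k' = h' ` carrier C'"
    using ex ex' by (auto simp: group_hom_def group_hom_axioms_def)
  have b': "b \<in> hom B B'" "inj_on b (carrier B)" "b ` carrier B = carrier B'"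
    using b by (auto simp: iso_def bij_betw_def)
  have d': "d \<in> hom D D'" "inj_on d (carrier D)" "d ` carrier D = carrier D'"
    using d by (auto simp: iso_def bij_betw_def)
  interpret C': group C' using gr by simp
  interpret c: group_hom C C' c using gr c by (simp add: group_hom_def group_hom_axioms_def)
  interpret g: group_hom B C g using gr g by (simp add: group_hom_def group_hom_axioms_def)
  interpret h: group_hom C D h using gr h by (simp add: group_hom_def group_hom_axioms_def)
  interpret k: group_hom D E k using gr k by (simp add: group_hom_def group_hom_axioms_def)
  interpret g': group_hom B' C' g' using gr g' by (simp add: group_hom_def group_hom_axioms_def)
  interpret h': group_hom C' D' h' using gr h' by (simp add: group_hom_def group_hom_axioms_def)
  interpret k': group_hom D' E' k' using gr k' by (simp add: group_hom_def group_hom_axioms_def)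
  interpret b: group_hom B B' b using gr b' by (simp add: group_hom_def group_hom_axioms_def)
  interpret d: group_hom D D' d using gr d' by (simp add: group_hom_def group_hom_axioms_def)
  interpret e: group_hom E E' e using gr e by (simp add: group_hom_def group_hom_axioms_def)
  have one: "\<one>\<^bsub>D\<^esub> \<in> carrier D" "\<one>\<^bsub>E\<^esub> \<in> carrier E"
    using gr by (simp_all add: group.is_monoid monoid.one_closed)
  have inj: "inj_on c (carrier C)"
  proof (rule c.trivial_ker_imp_inj)
    have "x = \<one>\<^bsub>C\<^esub>" if x: "x \<in> carrier C" "c x = \<one>\<^bsub>C'\<^esub>" for x
    proof -
      have "d (h x) = d \<one>\<^bsub>D\<^esub>" using hc[OF x(1)] x(2) by simp
      then have "h x = \<one>\<^bsub>D\<^esub>" using d'(2) x(1) h.hom_closed one(1) by (meson inj_onD)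
      then have "x \<in> kernel C D h" using x by (simp add: kernel_def)
      then obtain y where y: "y \<in> carrier B" "x = g y" using exC by auto
      then have "b y \<in> kernel B' C' g'" using gb x by (simp add: kernel_def)
      then have "b y \<in> f' ` a ` carrier A" using exB' a by simp
      then obtain z where z: "z \<in> carrier A" "b y = f' (a z)" by blast
      then have "b y = b (f z)" using fa by simp
      moreover have fz: "f z \<in> carrier B" using z f by (auto simp: hom_def)
      ultimately have "y = f z" using b'(2) y by (auto dest: inj_onD)
      then have "y \<in> kernel B C g" using exB z by auto
      then show "x = \<one>\<^bsub>C\<^esub>" using y by (simp add: kernel_def)
    qed
    then show "kernel C C' c = {\<one>\<^bsub>C\<^esub>}" by (auto simp: kernel_def)
  qed
  have surj: "y' \<in> c ` carrier C" if y': "y' \<in> carrier C'" for y'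
  proof -
    obtain w where w: "w \<in> carrier D" "h' y' = d w" using d' y' h'.hom_closed by (metis imageE)
    have "h' y' \<in> kernel D' E' k'" using exD' y' by auto
    then have "e (k w) = e \<one>\<^bsub>E\<^esub>" using kd[OF w(1)] w by (simp add: kernel_def)
    then have "k w = \<one>\<^bsub>E\<^esub>" using e(2) w(1) k.hom_closed one(2) by (meson inj_onD)
    then have "w \<in> kernel D E k" using w by (simp add: kernel_def)
    then obtain x where x: "x \<in> carrier C" "w = h x" using exD by auto
    \<comment> \<open>The image of \<open>x\<close> equals \<open>y'\<close> up to an element killed
      by \<open>h'\<close>, and by exactness this error comes from \<open>B'\<close>.\<close>
    let ?u = "y' \<otimes>\<^bsub>C'\<^esub> inv\<^bsub>C'\<^esub> (c x)"
    have "h' ?u = \<one>\<^bsub>D'\<^esub>" using x y' w hc by (simp add: h'.hom_inv)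
    then have "?u \<in> kernel C' D' h'" using x y' by (simp add: kernel_def)
    then have "?u \<in> g' ` b ` carrier B" using exC' b' by simp
    then obtain v where v: "v \<in> carrier B" "?u = g' (b v)" by blast
    then have "?u = c (g v)" using gb by simp
    moreover have "y' = ?u \<otimes>\<^bsub>C'\<^esub> c x" using y' x by (simp add: C'.m_assoc)
    ultimately have "y' = c (g v) \<otimes>\<^bsub>C'\<^esub> c x" by simp
    then have "y' = c (g v \<otimes>\<^bsub>C\<^esub> x)" using x v by simp
    moreover have "g v \<otimes>\<^bsub>C\<^esub> x \<in> carrier C" using x(1) v(1) by simp
    ultimately show ?thesis by (rule image_eqI)
  qed
  show ?thesis using inj surj c by (auto simp: iso_def bij_betw_def hom_def)
qed

text \<open>The five lemma for the long exact sequences of \<open>(P, Q)\<close> and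
  \<open>(P', Q')\<close>, with the group of \<open>Q\<close> in the middle.\<close>

lemma hiso_five:
  assumes f: "pair_map P Q P' Q' f"
    and 1: "hiso (k+1) P Q P' Q' f" "hiso k P Q P' Q' f" "hiso (k+1) P {} P' {} f" "hiso k P {} P' {} f"
  shows "hiso k Q {} Q' {} f"
proof -
  have seq: "exact_seq ([rel_hom k P Q, rel_hom k P {}, rel_hom k Q {}, rel_hom (k+1) P Q, rel_hom (k+1) P {}],
    [hind k P {} P Q id, hind k Q {} P {} id, hom_boundary (k+1) (top_of_set P) Q, hind (k+1) P {} P Q id])"
    if "Q \<subseteq> P" for P Q :: "'c::topological_space set"
    using homology_exactness_axiom_1[of "k+1" "top_of_set P" Q] homology_exactness_axiom_2[of "k+1" "top_of_set P" Q]
      homology_exactness_axiom_3[of k "top_of_set P" Q] subset_top[OF that]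
    by (simp add: exact_seq_cons_iff exact_seq_end_iff)
  have QP: "Q \<subseteq> P" "Q' \<subseteq> P'" and cf: "continuous_on P f" "f ` P \<subseteq> P'" "f ` Q \<subseteq> Q'"
    using f by (auto simp: pair_map_def)
  have nat: "(hind k P' T P' T' id (hind k P S P' T f x)) = hind k P S' P' T' f (hind k P S P S' id x)"
    if "S \<subseteq> S'" "T \<subseteq> T'" "f ` S \<subseteq> T" "f ` S' \<subseteq> T'" for S S' T T' x k
  proof -
    have "hind k P' T P' T' id \<circ> hind k P S P' T f = hind k P S P' T' (id \<circ> f)"
      by (rule hom_induced_compose[symmetric]) (use that cf in auto)
    moreover have "hind k P S' P' T' f \<circ> hind k P S P S' id = hind k P S P' T' (f \<circ> id)"
      by (rule hom_induced_compose[symmetric]) (use that cf in auto)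
    ultimately show ?thesis by (metis comp_apply comp_id id_comp)
  qed
  show ?thesis unfolding hiso_def
  proof (rule five_lemma[OF seq[OF QP(1)] seq[OF QP(2)]])
    show "hind (k+1) P {} P' {} f ` carrier (rel_hom (k+1) P {}) = carrier (rel_hom (k+1) P' {})"
      using 1 by (auto simp: hiso_def iso_def bij_betw_def)
    show "hind (k+1) P Q P' Q' f \<in> iso (rel_hom (k+1) P Q) (rel_hom (k+1) P' Q')"
      "hind k P {} P' {} f \<in> iso (rel_hom k P {}) (rel_hom k P' {})"
      using 1 by (auto simp: hiso_def)
    show "inj_on (hind k P Q P' Q' f) (carrier (rel_hom k P Q))"
      using 1 by (auto simp: hiso_def iso_def bij_betw_def)
    show "hind (k+1) P' {} P' Q' id (hind (k+1) P {} P' {} f x) = hind (k+1) P Q P' Q' f (hind (k+1) P {} P Q id x)" for x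
      by (rule nat) (use cf in auto)
    show "hind k P' {} P' Q' id (hind k P {} P' {} f x) = hind k P Q P' Q' f (hind k P {} P Q id x)" for x
      by (rule nat) (use cf in auto)
    have "hind k Q' {} P' {} id \<circ> hind k Q {} Q' {} f = hind k Q {} P' {} (id \<circ> f)"
      by (rule hom_induced_compose[symmetric]) (use QP cf in \<open>auto intro: continuous_on_subset\<close>)
    moreover have "hind k P {} P' {} f \<circ> hind k Q {} P {} id = hind k Q {} P' {} (f \<circ> id)"
      by (rule hom_induced_compose[symmetric]) (use QP cf in \<open>auto intro: continuous_on_subset\<close>)
    ultimately show "hind k Q' {} P' {} id (hind k Q {} Q' {} f x) = hind k P {} P' {} f (hind k Q {} P {} id x)" for x
      by (metis comp_apply comp_id id_comp)
    have "hom_boundary (k+1) (top_of_set P') Q' \<circ> hind (k+1) P Q P' Q' f =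
      hom_induced (k+1 - 1) (subtopology (top_of_set P) Q) {} (subtopology (top_of_set P') Q') {} f \<circ> hom_boundary (k+1) (top_of_set P) Q"
      by (rule naturality_hom_induced) (use cf in auto)
    then show "hom_boundary (k+1) (top_of_set P') Q' (hind (k+1) P Q P' Q' f x) =
      hind k Q {} Q' {} f (hom_boundary (k+1) (top_of_set P) Q x)" for x
      using subset_top[OF QP(1)] subset_top[OF QP(2)] by (simp add: fun_eq_iff)
  qed (simp_all add: hom_induced_hom)
qed

text \<open>The square has to commute on homology only, so that squares commuting up to homotopy are
  covered.\<close>

lemma hiso_square_hind:
  assumes f: "pair_map X S Y T f" and g: "pair_map X0 S0 Y0 T0 g"
    and e: "pair_map X0 S0 X S e" "hiso k X0 S0 X S e"
    and e': "pair_map Y0 T0 Y T e'" "hiso k Y0 T0 Y T e'"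
    and comm: "hind k X0 S0 Y T (f \<circ> e) = hind k X0 S0 Y T (e' \<circ> g)"
  shows "hiso k X S Y T f \<longleftrightarrow> hiso k X0 S0 Y0 T0 g"
proof -
  have "hiso k X S Y T f \<longleftrightarrow> hiso k X0 S0 Y T (f \<circ> e)"
    by (rule hiso_comp_right[OF e(1) f e(2), symmetric])
  also have "\<dots> \<longleftrightarrow> hiso k X0 S0 Y T (e' \<circ> g)" using comm by (simp add: hiso_def)
  also have "\<dots> \<longleftrightarrow> hiso k X0 S0 Y0 T0 g" by (rule hiso_comp_left[OF g e'])
  finally show ?thesis .
qed

lemma hiso_square:
  assumes "pair_map X S Y T f" "pair_map X0 S0 Y0 T0 g"
    and "pair_map X0 S0 X S e" "hiso k X0 S0 X S e"
    and "pair_map Y0 T0 Y T e'" "hiso k Y0 T0 Y T e'"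
    and "\<And>x. x \<in> X0 \<Longrightarrow> f (e x) = e' (g x)"
  shows "hiso k X S Y T f \<longleftrightarrow> hiso k X0 S0 Y0 T0 g"
  by (rule hiso_square_hind[OF assms(1-6)]) (rule hind_cong, simp add: assms(7))

section \<open>The suspension isomorphism\<close>

text \<open>For \<open>A = Y - B\<close> this is the complement of \<open>A \<times> {0}\<close> in \<open>Y \<times> \<real>\<close>.\<close>

definition susp :: "'a set \<Rightarrow> 'a set \<Rightarrow> ('a \<times> real) set" where
  "susp Y B = {(y,t). y \<in> Y \<and> (y \<in> B \<or> t \<noteq> 0)}"

text \<open>The smallest member of a triple: relative to it \<open>Y \<times> UNIV\<close> has no
  homology, while \<open>susp Y B\<close> relative to it reduces by excision to
  \<open>(Y, B)\<close> times the positive half line.\<close>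

definition susp_lower :: "'a set \<Rightarrow> 'a set \<Rightarrow> ('a \<times> real) set" where
  "susp_lower Y B = {(y,t). y \<in> Y \<and> (y \<in> B \<or> t < 0)}"

text \<open>The height \<open>t\<close> moves along a segment to
  \<open>- (\<bar>t\<bar> + 1)\<close>. It ends negative and stays negative if it starts so, while
  \<open>y\<close> does not move.\<close>

lemma hzero_susp_lower: "hzero k (Y \<times> UNIV) (susp_lower Y B)" for Y :: "'a::topological_space set"
proof (rule hzero_push_off[where h = "\<lambda>s (y,t). (y, (1-s)*t - s*(\<bar>t\<bar>+1))"])
  show "continuous_on ({0..1::real} \<times> (Y \<times> (UNIV::real set))) (\<lambda>(s,x). case x of (y,t) \<Rightarrow> (y, (1-s)*t - s*(\<bar>t\<bar>+1)))"
    unfolding case_prod_beta by (intro continuous_intros)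
  have *: "(1-s)*t - s*(\<bar>t\<bar>+1) < 0" if "s \<in> {0..1}" "t < 0" for s t :: real
  proof (cases "s = 1")
    case False
    then have "(1-s)*t < 0" using that by (intro mult_pos_neg) auto
    moreover have "0 \<le> s*(\<bar>t\<bar>+1)" using that by (intro mult_nonneg_nonneg) auto
    ultimately show ?thesis by linarith
  qed simp
  show "(case x of (y,t) \<Rightarrow> (y, (1-s)*t - s*(\<bar>t\<bar>+1))) \<in> susp_lower Y B"
    if "s \<in> {0..1}" "x \<in> susp_lower Y B" for s x
    using that * by (auto simp: susp_lower_def)
qed (auto simp: susp_lower_def)

text \<open>The terms of \<open>(Y \<times> UNIV, susp_lower Y B)\<close> in the exact sequence of
  the triple vanish, so the connecting map is an isomorphism that lowers the degree by one. It is
  natural with respect to \<open>F\<close>.\<close>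

lemma hiso_susp_boundary:
  assumes f: "pair_map Y B Y' B' f"
  defines "F \<equiv> (\<lambda>(y,t::real). (f y, t))"
  shows "hiso (k+1) (Y \<times> UNIV) (susp Y B) (Y' \<times> UNIV) (susp Y' B') F
    \<longleftrightarrow> hiso k (susp Y B) (susp_lower Y B) (susp Y' B') (susp_lower Y' B') F"
proof -
  have sub: "susp_lower Y B \<subseteq> susp Y B" "susp Y B \<subseteq> Y \<times> UNIV" for Y B :: "'c set"
    by (auto simp: susp_def susp_lower_def)
  have R: "hom_relboundary (k+1) (top_of_set (Y \<times> UNIV)) (susp Y B) (susp_lower Y B)
    \<in> iso (rel_hom (k+1) (Y \<times> UNIV) (susp Y B)) (rel_hom k (susp Y B) (susp_lower Y B))"
    for Y B :: "'c::topological_space set"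
  proof (rule very_short_exact_sequence)
    let ?X = "top_of_set (Y \<times> (UNIV::real set))" and ?S = "susp Y B" and ?T = "susp_lower Y B"
    show "exact_seq ([rel_hom k (Y \<times> UNIV) ?T, rel_hom k ?S ?T, rel_hom (k+1) (Y \<times> UNIV) ?S, rel_hom (k+1) (Y \<times> UNIV) ?T],
       [hom_induced k (subtopology ?X ?S) ?T ?X ?T id, hom_relboundary (k+1) ?X ?S ?T, hom_induced (k+1) ?X ?T ?X ?S id])"
      using homology_exactness_triple_1[OF sub(1), of "k+1" ?X Y B] homology_exactness_triple_2[OF sub(1), of "k+1" ?X Y B]
      by (simp add: exact_seq_cons_iff exact_seq_end_iff subset_top[OF sub(2)])
  qed (use hzero_susp_lower[unfolded hzero_def] in auto)
  have cF: "continuous_on (Y \<times> UNIV) F"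
    unfolding F_def case_prod_beta using f
    by (intro continuous_intros continuous_on_compose2[where f=fst and g=f and t=Y]) (auto simp: pair_map_def)
  have im: "F ` (Y \<times> UNIV) \<subseteq> Y' \<times> UNIV" "F ` susp Y B \<subseteq> susp Y' B'" "F ` susp_lower Y B \<subseteq> susp_lower Y' B'"
    using f by (auto simp: F_def susp_def susp_lower_def pair_map_def image_subset_iff)
  have nat: "hom_relboundary (k+1) (top_of_set (Y' \<times> UNIV)) (susp Y' B') (susp_lower Y' B') \<circ>
     hind (k+1) (Y \<times> UNIV) (susp Y B) (Y' \<times> UNIV) (susp Y' B') F =
     hind k (susp Y B) (susp_lower Y B) (susp Y' B') (susp_lower Y' B') F \<circ>
     hom_relboundary (k+1) (top_of_set (Y \<times> UNIV)) (susp Y B) (susp_lower Y B)"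
    using naturality_hom_induced_relboundary[of "top_of_set (Y \<times> UNIV)" "top_of_set (Y' \<times> UNIV)" F
       "susp Y B" "susp Y' B'" "susp_lower Y B" "susp_lower Y' B'" "k+1"] cF im
    by (simp add: image_subset_iff_funcset subset_top[OF sub(2)])
  have "hiso (k+1) (Y \<times> UNIV) (susp Y B) (Y' \<times> UNIV) (susp Y' B') F \<longleftrightarrow>
    hom_relboundary (k+1) (top_of_set (Y' \<times> UNIV)) (susp Y' B') (susp_lower Y' B') \<circ>
     hind (k+1) (Y \<times> UNIV) (susp Y B) (Y' \<times> UNIV) (susp Y' B') F
     \<in> iso (rel_hom (k+1) (Y \<times> UNIV) (susp Y B)) (rel_hom k (susp Y' B') (susp_lower Y' B'))"
    unfolding hiso_def by (rule iso_two_of_three_left[symmetric]) (auto simp: hom_induced_hom R)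
  also have "\<dots> \<longleftrightarrow> hiso k (susp Y B) (susp_lower Y B) (susp Y' B') (susp_lower Y' B') F"
    unfolding nat hiso_def by (rule iso_two_of_three_right) (auto simp: hom_induced_hom R)
  finally show ?thesis .
qed

lemma openin_susp_lower:
  assumes "openin (top_of_set Y) B"
  shows "openin (top_of_set (susp Y B)) (susp_lower Y B)"
proof -
  have BY: "B \<subseteq> Y" using assms openin_imp_subset by auto
  have "openin (top_of_set (Y \<times> UNIV)) (B \<times> UNIV \<union> Y \<times> {..<0::real})"
    using assms by (intro openin_Un openin_Times) auto
  also have "B \<times> UNIV \<union> Y \<times> {..<0::real} = susp_lower Y B" using BY by (auto simp: susp_lower_def)
  finally show ?thesis
    by (rule openin_subset_trans) (auto simp: susp_def susp_lower_def)
qed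

text \<open>The points of \<open>susp Y B\<close> outside \<open>susp_lower Y B\<close> form a set
  that is closed because \<open>B\<close> is open, and they all have \<open>t > 0\<close>. So only
  the open upper half matters.\<close>

lemma hiso_susp_excision:
  assumes B: "openin (top_of_set Y) B"
  shows "hiso k (Y \<times> {0<..}) (B \<times> {0<..}) (susp Y B) (susp_lower Y B) (\<lambda>x. x)"
proof -
  have BY: "B \<subseteq> Y" using assms openin_imp_subset by auto
  have "openin (top_of_set (Y \<times> UNIV)) (Y \<times> {0::real<..})" by (intro openin_Times) auto
  then have U: "openin (top_of_set (susp Y B)) (Y \<times> {0::real<..})" 
    by (rule openin_subset_trans) (auto simp: susp_def)
  have A: "closedin (top_of_set (susp Y B)) (susp Y B - susp_lower Y B)"
    using openin_susp_lower[OF B] by (simp add: closedin_diff)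
  have 1: "susp Y B - susp_lower Y B \<subseteq> Y \<times> {0<..}" by (auto simp: susp_def susp_lower_def)
  have 2: "Y \<times> {0<..} - (susp Y B - susp_lower Y B) = B \<times> {0<..}"
    "susp Y B - (susp Y B - susp_lower Y B) = susp_lower Y B" using BY by (auto simp: susp_def susp_lower_def)
  show ?thesis using hiso_excision[OF A U 1, of k] unfolding 2 .
qed

text \<open>The half line contracts linearly to \<open>1\<close>, the height of the section
  \<open>?g\<close>, and the factor \<open>Y\<close> is left alone.\<close>

lemma hiso_times_positive:
  assumes "B \<subseteq> Y"
  shows "hiso k (Y \<times> {0::real<..}) (B \<times> {0<..}) Y B fst"
proof -
  let ?g = "\<lambda>y. (y, 1::real)"
  have f: "pair_map (Y \<times> {0::real<..}) (B \<times> {0<..}) Y B fst"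
    using assms by (auto simp: pair_map_def continuous_on_fst)
  have g: "pair_map Y B (Y \<times> {0::real<..}) (B \<times> {0<..}) ?g"
    using assms by (auto simp: pair_map_def intro!: continuous_intros)
  show ?thesis
  proof (rule hiso_inverse[OF f g])
    let ?h = "\<lambda>s (y,t). (y, (1-s)*t + s::real)"
    have "hind k (Y \<times> {0<..}) (B \<times> {0<..}) (Y \<times> {0<..}) (B \<times> {0<..}) (?g \<circ> fst)
      = hind k (Y \<times> {0<..}) (B \<times> {0<..}) (Y \<times> {0<..}) (B \<times> {0<..}) (?h 1)"
      by (rule hind_cong) auto
    also have "\<dots> = hind k (Y \<times> {0<..}) (B \<times> {0<..}) (Y \<times> {0<..}) (B \<times> {0<..}) (?h 0)"
    proof (rule hind_homotopic[symmetric, where h="?h"])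
      show "continuous_on ({0..1::real} \<times> Y \<times> {0<..}) (\<lambda>(s,x). ?h s x)"
        unfolding case_prod_beta by (intro continuous_intros)
      have *: "0 < (1-s)*t + s" if "s \<in> {0..1}" "t > 0" for s t :: real
        using that by (cases "s = 0") (auto intro: add_nonneg_pos)
      show "?h s x \<in> Y \<times> {0<..}" if "s \<in> {0..1}" "x \<in> Y \<times> {0<..}" for s x
        using that * by auto
      show "?h s x \<in> B \<times> {0<..}" if "s \<in> {0..1}" "x \<in> B \<times> {0<..}" for s x
        using that * by auto
    qed
    also have "\<dots> = hind k (Y \<times> {0<..}) (B \<times> {0<..}) (Y \<times> {0<..}) (B \<times> {0<..}) (\<lambda>x. x)"
      by (rule hind_cong) auto
    finally show "hind k (Y \<times> {0<..}) (B \<times> {0<..}) (Y \<times> {0<..}) (B \<times> {0<..}) (?g \<circ> fst)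
      = hind k (Y \<times> {0<..}) (B \<times> {0<..}) (Y \<times> {0<..}) (B \<times> {0<..}) (\<lambda>x. x)" .
    show "hind k Y B Y B (fst \<circ> ?g) = hind k Y B Y B (\<lambda>x. x)" by (rule hind_cong) auto
  qed
qed

text \<open>The connecting map, excision and the projection lead from the suspended pair to
  \<open>(Y, B)\<close>. All three commute with the maps induced by \<open>f\<close>, so two out of
  three applies at each stage.\<close>

theorem hiso_susp:
  assumes f: "pair_map Y B Y' B' f" and B: "openin (top_of_set Y) B" and B': "openin (top_of_set Y') B'"
  shows "hiso (k+1) (Y \<times> UNIV) (susp Y B) (Y' \<times> UNIV) (susp Y' B') (\<lambda>(y,t). (f y, t))
    \<longleftrightarrow> hiso k Y B Y' B' f"
proof -
  define F where "F = (\<lambda>(y,t::real). (f y, t))"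
  have sub: "B \<subseteq> Y" "B' \<subseteq> Y'" "continuous_on Y f" "f ` Y \<subseteq> Y'" "f ` B \<subseteq> B'" using f by (auto simp: pair_map_def)
  have cF: "continuous_on (Y \<times> UNIV) F"
    unfolding F_def case_prod_beta using sub
    by (intro continuous_intros continuous_on_compose2[where f=fst and g=f and t=Y]) auto
  have cF2: "continuous_on Z F" if "Z \<subseteq> Y \<times> UNIV" for Z using cF continuous_on_subset that by blast
  have pF: "pair_map (Y \<times> {0<..}) (B \<times> {0<..}) (Y' \<times> {0<..}) (B' \<times> {0<..}) F"
    using sub by (auto simp: pair_map_def F_def[symmetric] intro!: cF2) (auto simp: F_def)
  have pF2: "pair_map (susp Y B) (susp_lower Y B) (susp Y' B') (susp_lower Y' B') F"
    using sub by (auto simp: pair_map_def susp_def susp_lower_def F_def[symmetric] intro!: cF2) 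
       (auto simp: F_def)
  have pi: "pair_map (Y \<times> {0<..}) (B \<times> {0<..}) (susp Y B) (susp_lower Y B) (\<lambda>x. x)" if "B \<subseteq> Y" for Y B :: "'c::topological_space set"
    using that by (auto simp: pair_map_def susp_def susp_lower_def)
  have pf: "pair_map (Y \<times> {0::real<..}) (B \<times> {0<..}) Y B fst" if "B \<subseteq> Y" for Y B :: "'c::topological_space set"
    using that by (auto simp: pair_map_def continuous_on_fst)
  have "hiso (k+1) (Y \<times> UNIV) (susp Y B) (Y' \<times> UNIV) (susp Y' B') F
    \<longleftrightarrow> hiso k (susp Y B) (susp_lower Y B) (susp Y' B') (susp_lower Y' B') F"
    unfolding F_def by (rule hiso_susp_boundary[OF f])
  also have "\<dots> \<longleftrightarrow> hiso k (Y \<times> {0<..}) (B \<times> {0<..}) (susp Y' B') (susp_lower Y' B') (F \<circ> (\<lambda>x. x))"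
    by (rule hiso_comp_right[symmetric, OF pi pF2]) (use sub hiso_susp_excision[OF B] in auto)
  also have "F \<circ> (\<lambda>x. x) = (\<lambda>x. x) \<circ> F" by auto
  also have "hiso k (Y \<times> {0<..}) (B \<times> {0<..}) (susp Y' B') (susp_lower Y' B') ((\<lambda>x. x) \<circ> F)
    \<longleftrightarrow> hiso k (Y \<times> {0<..}) (B \<times> {0<..}) (Y' \<times> {0<..}) (B' \<times> {0<..}) F"
    by (rule hiso_comp_left[OF pF pi]) (use sub hiso_susp_excision[OF B'] in auto)
  also have "\<dots> \<longleftrightarrow> hiso k (Y \<times> {0<..}) (B \<times> {0<..}) Y' B' (fst \<circ> F)"
    by (rule hiso_comp_left[symmetric, OF pF pf]) (use sub hiso_times_positive in auto)
  also have "fst \<circ> F = f \<circ> fst" by (auto simp: F_def)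
  also have "hiso k (Y \<times> {0::real<..}) (B \<times> {0<..}) Y' B' (f \<circ> fst) \<longleftrightarrow> hiso k Y B Y' B' f"
    by (rule hiso_comp_right[OF pf f]) (use sub hiso_times_positive in auto)
  finally show ?thesis unfolding F_def .
qed

section \<open>Iterated suspension by finitely many real coordinates\<close>

text \<open>Euclidean space on the index set \<open>J\<close>, realised by functions vanishing off
  \<open>J\<close>, so that these spaces share one type while \<open>J\<close> grows in an
  induction.\<close>

definition coord_space :: "'i set \<Rightarrow> ('i \<Rightarrow> real) set" where
  "coord_space J = {v. \<forall>i. i \<notin> J \<longrightarrow> v i = 0}"

text \<open>The second member of the product of the pair \<open>(Y, B)\<close> with
  \<open>coord_space J\<close> relative to its nonzero vectors; \<open>susp\<close> is the case of
  one coordinate.\<close>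

definition msusp :: "'a set \<Rightarrow> 'a set \<Rightarrow> 'i set \<Rightarrow> ('a \<times> ('i \<Rightarrow> real)) set" where
  "msusp Y B J = {(y,v). y \<in> Y \<and> v \<in> coord_space J \<and> (y \<in> B \<or> v \<noteq> (\<lambda>_. 0))}"

lemma continuous_on_coord:
  fixes f :: "'a::topological_space \<Rightarrow> 'i \<Rightarrow> 'b::topological_space"
  shows "continuous_on S f \<Longrightarrow> continuous_on S (\<lambda>x. f x i)"
  by (rule continuous_on_product_then_coordinatewise)

lemma continuous_on_fun_upd [continuous_intros]:
  fixes f :: "'a::topological_space \<Rightarrow> 'i \<Rightarrow> 'b::topological_space"
  assumes "continuous_on S f" "continuous_on S g"
  shows "continuous_on S (\<lambda>x. (f x)(i := g x))"
proof (rule continuous_on_coordinatewise_then_product)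
  show "continuous_on S (\<lambda>x. ((f x)(i := g x)) j)" for j
    using assms continuous_on_coord[OF assms(1)] by (cases "j = i") auto
qed

lemma openin_msusp:
  fixes J :: "'i set"
  assumes "openin (top_of_set Y) B"
  shows "openin (top_of_set (Y \<times> coord_space J)) (msusp Y B J)"
proof -
  have BY: "B \<subseteq> Y" using assms openin_imp_subset by auto
  have "openin (top_of_set (coord_space J)) (coord_space J \<inter> {v. v i \<noteq> 0})" for i :: 'i
  proof -
    have "open {v::'i \<Rightarrow> real. v i \<noteq> 0}"
      by (intro open_Collect_neq continuous_on_coord[OF continuous_on_id] continuous_on_const)
    then show ?thesis by (simp add: openin_open_Int)
  qed
  \<comment> \<open>A nonzero vector has some nonzero coordinate, so the condition is a union of
    open ones.\<close>
  then have "openin (top_of_set (Y \<times> coord_space J))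
     (B \<times> coord_space J \<union> (\<Union>i. Y \<times> (coord_space J \<inter> {v. v i \<noteq> 0})))"
    using assms by (intro openin_Un openin_Times openin_clauses(3)) (auto intro!: openin_Times)
  also have "(B \<times> coord_space J \<union> (\<Union>i. Y \<times> (coord_space J \<inter> {v. v i \<noteq> 0}))) = msusp Y B J"
    using BY by (auto simp: msusp_def fun_eq_iff)
  finally show ?thesis .
qed

lemma pair_map_msusp:
  assumes "pair_map Y B Y' B' f"
  shows "pair_map (Y \<times> coord_space J) (msusp Y B J) (Y' \<times> coord_space J) (msusp Y' B' J) (\<lambda>(y,v). (f y, v))"
  unfolding pair_map_def
proof (intro conjI)
  show "continuous_on (Y \<times> coord_space J) (\<lambda>(y,v). (f y, v))"
    unfolding case_prod_beta using assms
    by (intro continuous_intros continuous_on_compose2[where f=fst and g=f and t=Y]) (auto simp: pair_map_def)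
qed (use assms in \<open>auto simp: pair_map_def msusp_def image_subset_iff\<close>)

lemma pair_map_susp:
  assumes "pair_map Y B Y' B' f"
  shows "pair_map (Y \<times> UNIV) (susp Y B) (Y' \<times> UNIV) (susp Y' B') (\<lambda>(y,v). (f y, v))"
  unfolding pair_map_def
proof (intro conjI)
  show "continuous_on (Y \<times> UNIV) (\<lambda>(y,v). (f y, v))"
    unfolding case_prod_beta using assms
    by (intro continuous_intros continuous_on_compose2[where f=fst and g=f and t=Y]) (auto simp: pair_map_def)
qed (use assms in \<open>auto simp: pair_map_def susp_def image_subset_iff\<close>)

text \<open>Adding a coordinate is one more suspension. As \<open>j \<notin> J\<close>, the entry at
  \<open>j\<close> of a vector in \<open>coord_space J\<close> is zero and can be used to store
  \<open>t\<close>.\<close>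

lemma msusp_insert_homeo:
  fixes Y :: "'a::topological_space set" and J :: "'i set"
  assumes j: "j \<notin> J" and BY: "B \<subseteq> Y"
  defines "e \<equiv> (\<lambda>((y,v),t). (y, v(j := t)))"
  shows "pair_map ((Y \<times> coord_space J) \<times> UNIV) (susp (Y \<times> coord_space J) (msusp Y B J))
           (Y \<times> coord_space (insert j J)) (msusp Y B (insert j J)) e" (is "pair_map ?X ?S ?Z ?T e")
    and "hiso k ((Y \<times> coord_space J) \<times> UNIV) (susp (Y \<times> coord_space J) (msusp Y B J))
           (Y \<times> coord_space (insert j J)) (msusp Y B (insert j J)) e"
proof -
  define e' where "e' = (\<lambda>(y,v::'i \<Rightarrow> real). ((y::'a, v(j := 0)), v j))"
  have upd: "v(j := t) = (\<lambda>_. 0) \<longleftrightarrow> v = (\<lambda>_. 0) \<and> t = 0" if "v \<in> coord_space J" for v and t :: real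
  proof
    have vj: "v j = 0" using that j by (simp add: coord_space_def)
    assume eq: "v(j := t) = (\<lambda>_. 0)"
    have "v i = 0" for i using fun_cong[OF eq, of i] vj by (auto split: if_splits)
    then show "v = (\<lambda>_. 0) \<and> t = 0" using fun_cong[OF eq, of j] by auto
  qed auto
  show p: "pair_map ?X ?S ?Z ?T e"
    unfolding pair_map_def
  proof (intro conjI)
    show "continuous_on ?X e"
      unfolding e_def case_prod_beta by (intro continuous_intros)
  qed (use BY upd in \<open>auto simp: susp_def msusp_def e_def coord_space_def\<close>)
  have upd': "v = (\<lambda>_. 0)" if "v(j := 0) = (\<lambda>_. 0)" "v j = 0" for v :: "'i \<Rightarrow> real"
    using that by (auto simp: fun_eq_iff split: if_splits)
  have p': "pair_map ?Z ?T ?X ?S e'"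
    unfolding pair_map_def
  proof (intro conjI)
    show "continuous_on ?Z e'"
      unfolding e'_def case_prod_beta
      by (intro continuous_on_Pair continuous_on_fun_upd continuous_on_const continuous_on_fst continuous_on_snd
          continuous_on_id continuous_on_coord[OF continuous_on_snd[OF continuous_on_id]])
  qed (use BY upd' in \<open>auto simp: susp_def msusp_def e'_def coord_space_def\<close>)
  show "hiso k ?X ?S ?Z ?T e"
    by (rule hiso_homeo[OF p p']) (use j in \<open>auto simp: e_def e'_def coord_space_def\<close>)
qed

theorem hiso_msusp:
  assumes J: "finite (J :: 'i set)"
    and f: "pair_map Y B Y' B' f" and B: "openin (top_of_set Y) B" and B': "openin (top_of_set Y') B'"
  shows "hiso (k + int (card J)) (Y \<times> coord_space J) (msusp Y B J) (Y' \<times> coord_space J) (msusp Y' B' J) (\<lambda>(y,v). (f y, v))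
    \<longleftrightarrow> hiso k Y B Y' B' f"
  using J
proof (induction J)
  case empty
  let ?z = "\<lambda>_::'i. 0::real"
  have cs: "coord_space ({}::'i set) = {?z}" by (auto simp: coord_space_def)
  have p: "pair_map Y B (Y \<times> coord_space ({}::'i set)) (msusp Y B ({}::'i set)) (\<lambda>y. (y, ?z))"
    and p': "pair_map (Y \<times> coord_space ({}::'i set)) (msusp Y B ({}::'i set)) Y B fst"
    if "B \<subseteq> Y" for Y B :: "'c::topological_space set"
    using that by (auto simp: pair_map_def cs msusp_def intro!: continuous_intros)
  have h: "hiso k Y B (Y \<times> coord_space ({}::'i set)) (msusp Y B ({}::'i set)) (\<lambda>y. (y, ?z))"
    if "B \<subseteq> Y" for Y B :: "'c::topological_space set"
    by (rule hiso_homeo[OF p p']) (use that in \<open>auto simp: cs\<close>)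
  have sub: "B \<subseteq> Y" "B' \<subseteq> Y'" using f by (auto simp: pair_map_def)
  show ?case 
    using hiso_square[OF pair_map_msusp[OF f] f p h p h] sub by simp
next
  case (insert j J)
  have sub: "B \<subseteq> Y" "B' \<subseteq> Y'" using f by (auto simp: pair_map_def)
  have "hiso (k + int (card J) + 1) (Y \<times> coord_space (insert j J)) (msusp Y B (insert j J)) 
     (Y' \<times> coord_space (insert j J)) (msusp Y' B' (insert j J)) (\<lambda>(y,v). (f y, v))
    \<longleftrightarrow> hiso (k + int (card J) + 1) ((Y \<times> coord_space J) \<times> UNIV) (susp (Y \<times> coord_space J) (msusp Y B J))
      ((Y' \<times> coord_space J) \<times> UNIV) (susp (Y' \<times> coord_space J) (msusp Y' B' J)) (\<lambda>(yv,t). ((\<lambda>(y,v). (f y, v)) yv, t))"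
    by (rule hiso_square[OF pair_map_msusp[OF f] pair_map_susp[OF pair_map_msusp[OF f]]
        msusp_insert_homeo[OF insert.hyps(2) sub(1)] msusp_insert_homeo[OF insert.hyps(2) sub(2)]]) auto
  also have "\<dots> \<longleftrightarrow> hiso k Y B Y' B' f"
    unfolding insert.IH[symmetric]
    by (rule hiso_susp[OF pair_map_msusp[OF f] openin_msusp[OF B] openin_msusp[OF B']])
  finally show ?case using insert.hyps by (simp add: algebra_simps)
qed

corollary hzero_msusp:
  assumes J: "finite (J :: 'i set)" and B: "openin (top_of_set Y) B"
  shows "hzero (k + int (card J)) (Y \<times> coord_space J) (msusp Y B J) \<longleftrightarrow> hzero k Y B"
proof -
  have e: "pair_map {} {} Y B (\<lambda>y. y)" using openin_imp_subset[OF B] by (auto simp: pair_map_def)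
  have "hzero (k + int (card J)) (Y \<times> coord_space J) (msusp Y B J) \<longleftrightarrow>
    hiso (k + int (card J)) ({} \<times> coord_space J) (msusp {} {} J) (Y \<times> coord_space J) (msusp Y B J) (\<lambda>(y,v). (y, v))"
    using hzero_iff_hiso by (auto simp: msusp_def)
  also have "\<dots> \<longleftrightarrow> hiso k {} {} Y B (\<lambda>y. y)" by (rule hiso_msusp[OF J e _ B]) simp
  also have "\<dots> \<longleftrightarrow> hzero k Y B" by (rule hzero_iff_hiso[symmetric])
  finally show ?thesis .
qed

section \<open>Polynomials with prescribed real roots\<close>

definition root_poly :: "nat \<Rightarrow> (nat \<Rightarrow> real) \<Rightarrow> complex poly" where
  "root_poly j x = (\<Prod>l<j. [:- complex_of_real (x l), 1:])"

definition root_mset :: "nat \<Rightarrow> (nat \<Rightarrow> real) \<Rightarrow> real multiset" where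
  "root_mset j x = mset (map x [0..<j])"

lemma root_poly_Suc: "root_poly (Suc j) x = root_poly j x * [:- complex_of_real (x j), 1:]"
  by (simp add: root_poly_def)

lemma root_mset_Suc: "root_mset (Suc j) x = add_mset (x j) (root_mset j x)"
  by (simp add: root_mset_def)

lemma size_root_mset [simp]: "size (root_mset j x) = j"
  by (simp add: root_mset_def)

lemma root_poly_nonzero [simp]: "root_poly j x \<noteq> 0"
  by (simp add: root_poly_def)

lemma degree_root_poly [simp]: "degree (root_poly j x) = j"
proof (induction j)
  case (Suc j)
  have "degree (root_poly j x * [:- complex_of_real (x j), 1:]) = degree (root_poly j x) + degree [:- complex_of_real (x j), 1:]"
    by (rule degree_mult_eq) simp_all
  then show ?case using Suc by (simp only: root_poly_Suc) simp
qed (simp add: root_poly_def)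

lemma lead_coeff_root_poly [simp]: "coeff (root_poly j x) j = 1"
proof -
  have "lead_coeff (root_poly j x) = 1"
    by (induction j) (simp add: root_poly_def, simp only: root_poly_Suc lead_coeff_mult, simp)
  then show ?thesis by simp
qed

lemma order_linear_of_real:
  "Polynomial.order (complex_of_real y) [:- complex_of_real c, 1:] = (if y = c then 1 else 0)"
proof (cases "y = c")
  case True then show ?thesis using order_power_n_n[of "complex_of_real c" 1] by simp
next
  case False then show ?thesis by (simp add: order_0I)
qed

lemma order_root_poly: "Polynomial.order (complex_of_real y) (root_poly j x) = count (root_mset j x) y"
proof (induction j)
  case 0 show ?case by (simp add: root_poly_def root_mset_def)
next
  case (Suc j)
  have "root_poly j x * [:- complex_of_real (x j), 1:] \<noteq> 0"
    by (simp only: mult_eq_0_iff root_poly_nonzero) simp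
  from order_mult[OF this, of "complex_of_real y"] show ?case
    unfolding root_poly_Suc order_linear_of_real Suc root_mset_Suc by simp
qed

lemma order_power_eq: "p \<noteq> 0 \<Longrightarrow> Polynomial.order a (p ^ n) = n * Polynomial.order a p"
  by (induction n) (simp_all add: order_mult)

text \<open>All roots of \<open>root_poly j x\<close> are real, so only orders at real points
  matter. For the converse the \<open>n\<close>-th powers of the linear factors are split off one at
  a time; the count in the multiset takes care of repeated entries of \<open>x\<close>.\<close>

lemma root_poly_power_dvd_iff:
  assumes "p \<noteq> 0"
  shows "root_poly j x ^ n dvd p \<longleftrightarrow> (\<forall>y. n * count (root_mset j x) y \<le> Polynomial.order (complex_of_real y) p)"
proof
  assume dvd: "root_poly j x ^ n dvd p"
  show "\<forall>y. n * count (root_mset j x) y \<le> Polynomial.order (complex_of_real y) p"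
  proof
    show "n * count (root_mset j x) y \<le> Polynomial.order (complex_of_real y) p" for y
      using dvd_imp_order_le[OF assms dvd, of "complex_of_real y"] by (simp add: order_power_eq order_root_poly)
  qed
next
  assume "\<forall>y. n * count (root_mset j x) y \<le> Polynomial.order (complex_of_real y) p"
  then show "root_poly j x ^ n dvd p" using assms
  proof (induction j arbitrary: p)
    case 0 then show ?case by (simp add: root_poly_def)
  next
    case (Suc j)
    let ?L = "[:- complex_of_real (x j), 1:]"
    have "n \<le> Polynomial.order (complex_of_real (x j)) p"
      using Suc.prems(1)[rule_format, of "x j"] by (simp add: root_mset_Suc)
    then have "?L ^ n dvd p" by (simp add: order_divides)
    then obtain q where q: "p = ?L ^ n * q" by (auto simp: dvd_def)
    then have q0: "q \<noteq> 0" using Suc.prems by auto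
    have "n * count (root_mset j x) y \<le> Polynomial.order (complex_of_real y) q" for y
    proof -
      have "n * count (root_mset (Suc j) x) y \<le> Polynomial.order (complex_of_real y) p" using Suc.prems by blast
      also have "\<dots> = n * (if y = x j then 1 else 0) + Polynomial.order (complex_of_real y) q"
      proof -
        have "?L ^ n * q \<noteq> 0" using Suc.prems(2) q by simp
        from order_mult[OF this] have "Polynomial.order (complex_of_real y) p =
          Polynomial.order (complex_of_real y) (?L ^ n) + Polynomial.order (complex_of_real y) q"
          unfolding q .
        also have "Polynomial.order (complex_of_real y) (?L ^ n) = n * Polynomial.order (complex_of_real y) ?L"
          by (rule order_power_eq) simp
        finally show ?thesis unfolding order_linear_of_real .
      qed
      finally show ?thesis by (auto simp: root_mset_Suc split: if_splits)
    qed
    then have "root_poly j x ^ n dvd q" using Suc.IH q0 by blast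
    then show ?case unfolding q root_poly_Suc power_mult_distrib by (simp add: mult.commute mult_dvd_mono)
  qed
qed

text \<open>A multiset of reals has only one sorted listing, and from index \<open>j\<close> on both
  functions vanish.\<close>

lemma sorted_root_unique:
  assumes "root_mset j x = root_mset j x'" "sorted (map x [0..<j])" "sorted (map x' [0..<j])"
    "x \<in> coord_space {..<j}" "x' \<in> coord_space {..<j}"
  shows "x = x'"
proof
  fix l
  have "map x [0..<j] = map x' [0..<j]"
    using assms(1-3) unfolding root_mset_def by (metis sorted_sort_id mset_sort properties_for_sort)
  then show "x l = x' l" using assms(4,5) 
    by (cases "l < j") (auto simp: coord_space_def)
qed

lemma sorted_root_exists:
  obtains x where "x \<in> coord_space {..<size M}" "sorted (map x [0..<size M])" "root_mset (size M) x = M"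
proof -
  define xs where "xs = sorted_list_of_multiset M"
  have xs: "mset xs = M" "sorted xs" "length xs = size M"
    unfolding xs_def by (auto simp: mset_sorted_list_of_multiset sorted_sorted_list_of_multiset simp flip: size_mset)
  define x where "x l = (if l < size M then xs ! l else 0)" for l
  have "map x [0..<size M] = xs" by (rule nth_equalityI) (auto simp: xs x_def)
  then show thesis using xs that[of x] by (auto simp: root_mset_def x_def coord_space_def)
qed

section \<open>Continuous families of polynomials and their division by real-rooted
  polynomials\<close>

text \<open>The uniform degree bound is what gives the descending recursion for the coefficients of
  a quotient a common starting point.\<close>

definition continuous_poly_on :: "'a::topological_space set \<Rightarrow> ('a \<Rightarrow> complex poly) \<Rightarrow> bool" where
  "continuous_poly_on S F \<longleftrightarrow> (\<forall>k. continuous_on S (\<lambda>s. coeff (F s) k)) \<and> (\<exists>D. \<forall>s\<in>S. degree (F s) \<le> D)"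

named_theorems cpoly_intros

lemma continuous_poly_onI:
  "(\<And>k. continuous_on S (\<lambda>s. coeff (F s) k)) \<Longrightarrow> (\<And>s. s \<in> S \<Longrightarrow> degree (F s) \<le> D) \<Longrightarrow> continuous_poly_on S F"
  by (auto simp: continuous_poly_on_def)

lemma continuous_poly_on_coeff: "continuous_poly_on S F \<Longrightarrow> continuous_on S (\<lambda>s. coeff (F s) k)"
  by (auto simp: continuous_poly_on_def)

lemma continuous_poly_on_const [cpoly_intros]: "continuous_poly_on S (\<lambda>_. p)"
  by (auto simp: continuous_poly_on_def)

lemma continuous_poly_on_add [cpoly_intros]:
  assumes "continuous_poly_on S F" "continuous_poly_on S G"
  shows "continuous_poly_on S (\<lambda>s. F s + G s)"
proof -
  obtain D E where "\<forall>s\<in>S. degree (F s) \<le> D" "\<forall>s\<in>S. degree (G s) \<le> E"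
    using assms by (auto simp: continuous_poly_on_def)
  then have "degree (F s + G s) \<le> max D E" if "s \<in> S" for s
    using that by (meson degree_add_le_max max.mono order_trans)
  then show ?thesis using assms
    by (intro continuous_poly_onI[where D="max D E"]) (auto simp: continuous_poly_on_def intro!: continuous_intros)
qed

lemma continuous_poly_on_mult [cpoly_intros]:
  assumes "continuous_poly_on S F" "continuous_poly_on S G"
  shows "continuous_poly_on S (\<lambda>s. F s * G s)"
proof -
  obtain D E where "\<forall>s\<in>S. degree (F s) \<le> D" "\<forall>s\<in>S. degree (G s) \<le> E"
    using assms by (auto simp: continuous_poly_on_def)
  then have "degree (F s * G s) \<le> D + E" if "s \<in> S" for s
    using that by (meson degree_mult_le add_mono order_trans)
  then show ?thesis using assms
    by (intro continuous_poly_onI[where D="D + E"]) (auto simp: continuous_poly_on_def coeff_mult intro!: continuous_intros)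
qed

lemma continuous_poly_on_smult [cpoly_intros]:
  assumes "continuous_on S c" "continuous_poly_on S F"
  shows "continuous_poly_on S (\<lambda>s. smult (c s) (F s))"
proof -
  obtain D where "\<forall>s\<in>S. degree (F s) \<le> D"
    using assms by (auto simp: continuous_poly_on_def)
  then show ?thesis using assms
    by (intro continuous_poly_onI[where D="D"]) (auto simp: continuous_poly_on_def intro!: continuous_intros intro: order_trans[OF degree_smult_le])
qed

lemma continuous_poly_on_minus [cpoly_intros]:
  assumes "continuous_poly_on S F" shows "continuous_poly_on S (\<lambda>s. - F s)"
  using continuous_poly_on_smult[OF _ assms, of "\<lambda>_. -1"] by simp

lemma continuous_poly_on_diff [cpoly_intros]:
  assumes "continuous_poly_on S F" "continuous_poly_on S G"
  shows "continuous_poly_on S (\<lambda>s. F s - G s)"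
  using continuous_poly_on_add[OF assms(1) continuous_poly_on_minus[OF assms(2)]] by simp

lemma continuous_poly_on_power [cpoly_intros]:
  "continuous_poly_on S F \<Longrightarrow> continuous_poly_on S (\<lambda>s. F s ^ n)"
  by (induction n) (auto intro!: cpoly_intros)

lemma continuous_poly_on_prod [cpoly_intros]:
  "(\<And>i. i \<in> A \<Longrightarrow> continuous_poly_on S (\<lambda>s. F s i)) \<Longrightarrow> continuous_poly_on S (\<lambda>s. \<Prod>i\<in>A. F s i)"
  by (induction A rule: infinite_finite_induct) (auto intro!: cpoly_intros)

lemma continuous_poly_on_sum [cpoly_intros]:
  "(\<And>i. i \<in> A \<Longrightarrow> continuous_poly_on S (\<lambda>s. F s i)) \<Longrightarrow> continuous_poly_on S (\<lambda>s. \<Sum>i\<in>A. F s i)"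
  by (induction A rule: infinite_finite_induct) (auto intro!: cpoly_intros)

lemma continuous_poly_on_monom [cpoly_intros]:
  "continuous_on S c \<Longrightarrow> continuous_poly_on S (\<lambda>s. monom (c s) k)"
proof (rule continuous_poly_onI[where D=k])
  show "continuous_on S c \<Longrightarrow> continuous_on S (\<lambda>s. coeff (monom (c s) k) j)" for j
    by (cases "j = k") auto
qed (rule degree_monom_le)

lemma continuous_poly_on_linear [cpoly_intros]:
  assumes "continuous_on S c" "continuous_on S e"
  shows "continuous_poly_on S (\<lambda>s. [:c s, e s:])"
proof -
  have "[:c s, e s:] = monom (c s) 0 + monom (e s) 1" for s
    by (simp add: monom_altdef)
  then show ?thesis using assms by (auto intro!: cpoly_intros)
qed

text \<open>Synthetic division: compare coefficients in \<open>p = [:-c,1:] * q + r\<close> with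
  constant \<open>r\<close>. Each coefficient of the quotient comes from the next higher
  one.\<close>

lemma coeff_div_linear:
  fixes p :: "complex poly"
  shows "coeff (p div [:-c,1:]) k = coeff p (Suc k) + c * coeff (p div [:-c,1:]) (Suc k)"
proof -
  let ?q = "p div [:-c,1:]"
  have r: "coeff (p mod [:-c,1:]) (Suc k) = 0"
    using degree_mod_less[of "[:-c,1:]" p] by (auto intro!: coeff_eq_0)
  have "p = [:-c,1:] * ?q + p mod [:-c,1:]" by (rule mult_div_mod_eq[symmetric])
  then have "coeff p (Suc k) = coeff ([:-c,1:] * ?q) (Suc k)" using r
    by (metis add.right_neutral coeff_add)
  also have "\<dots> = - c * coeff ?q (Suc k) + coeff ?q k" by simp
  finally show ?thesis by simp
qed

lemma degree_div_linear_le: "degree (p div [:c, 1:]) \<le> degree (p :: complex poly)"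
proof (cases "degree p = 0")
  case True then show ?thesis by (simp add: div_poly_less)
next
  case False
  show ?thesis by (rule less_imp_le, rule degree_div_less) (use False in auto)
qed

lemma continuous_poly_on_div_linear:
  assumes F: "continuous_poly_on S F" and c: "continuous_on S c"
  shows "continuous_poly_on S (\<lambda>s. F s div [:- c s, 1:])"
proof -
  obtain D where D: "\<forall>s\<in>S. degree (F s) \<le> D"
    using F by (auto simp: continuous_poly_on_def)
  have "continuous_on S (\<lambda>s. coeff (F s div [:- c s, 1:]) k)" for k
  proof (induction "Suc D - k" arbitrary: k)
    \<comment> \<open>The measure is zero exactly when \<open>k\<close> exceeds \<open>D\<close>,
      where the coefficient vanishes.\<close>
    case 0
    then have "coeff (F s div [:- c s, 1:]) k = 0" if "s \<in> S" for s
      using D that by (intro coeff_eq_0 le_less_trans[OF degree_div_linear_le]) auto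
    then show ?case by (subst continuous_on_cong[OF refl, of _ _ "\<lambda>_. 0"]) auto
  next
    case (Suc u)
    have "u = Suc D - Suc k" using Suc.hyps(2) by linarith
    note IH = Suc.hyps(1)[OF this]
    show ?case by (subst coeff_div_linear) (intro continuous_intros IH c continuous_poly_on_coeff[OF F])
  qed
  then show ?thesis using D
    by (intro continuous_poly_onI[where D=D]) (auto intro: order_trans[OF degree_div_linear_le])
qed

lemma continuous_poly_on_div_linear_power:
  assumes F: "continuous_poly_on S F" and c: "continuous_on S c"
  shows "continuous_poly_on S (\<lambda>s. F s div [:- c s, 1:] ^ n)"
proof (induction n)
  case (Suc n)
  have "F s div [:- c s, 1:] ^ Suc n = (F s div [:- c s, 1:] ^ n) div [:- c s, 1:]" for s
    by (metis poly_div_mult_right power_Suc2)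
  then show ?case using continuous_poly_on_div_linear[OF Suc c] by simp
qed (simp add: F)

text \<open>Division by a product is iterated division by its factors, so continuity reduces to
  linear divisors with continuously moving roots, which may collide.\<close>

lemma continuous_poly_on_div_root_poly [cpoly_intros]:
  assumes F: "continuous_poly_on S F" and x: "continuous_on S x"
  shows "continuous_poly_on S (\<lambda>s. F s div root_poly j (x s) ^ n)"
proof (induction j)
  case 0 then show ?case using F by (simp add: root_poly_def)
next
  case (Suc j)
  have "F s div root_poly (Suc j) (x s) ^ n = (F s div root_poly j (x s) ^ n) div [:- complex_of_real (x s j), 1:] ^ n" for s
    unfolding root_poly_Suc power_mult_distrib poly_div_mult_right ..
  moreover have "continuous_on S (\<lambda>s. complex_of_real (x s j))"
    by (intro continuous_on_of_real continuous_on_coord[OF x])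
  ultimately show ?case using continuous_poly_on_div_linear_power[OF Suc] by simp
qed

lemma continuous_poly_on_root_poly [cpoly_intros]:
  assumes x: "continuous_on S x"
  shows "continuous_poly_on S (\<lambda>s. root_poly j (x s))"
  unfolding root_poly_def by (intro cpoly_intros continuous_intros continuous_on_coord[OF x])

lemma continuous_poly_on_mod_root_poly [cpoly_intros]:
  assumes F: "continuous_poly_on S F" and x: "continuous_on S x"
  shows "continuous_poly_on S (\<lambda>s. F s mod root_poly j (x s) ^ n)"
  unfolding minus_div_mult_eq_mod[symmetric] by (intro cpoly_intros F x)

section \<open>Tuples of monic polynomials and division with remainder\<close>

definition low_poly :: "nat \<Rightarrow> (nat \<Rightarrow> complex) \<Rightarrow> complex poly" where
  "low_poly d c = (\<Sum>k<d. monom (c k) k)"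

lemma coeff_low_poly: "coeff (low_poly d c) k = (if k < d then c k else 0)"
  by (simp add: low_poly_def coeff_sum if_distrib sum.delta' cong: if_cong) 

lemma coeff_monic_poly: "coeff (monic_poly d c) k = (if k < d then c k else if k = d then 1 else 0)"
proof -
  have "monic_poly d c = monom 1 d + low_poly d c" by (simp add: monic_poly_def low_poly_def)
  then show ?thesis by (simp add: coeff_low_poly)
qed

lemma degree_monic_poly [simp]: "degree (monic_poly d c) = d"
proof (rule antisym)
  show "degree (monic_poly d c) \<le> d" by (rule degree_le) (simp add: coeff_monic_poly)
  show "d \<le> degree (monic_poly d c)" by (rule le_degree) (simp add: coeff_monic_poly)
qed

lemma monic_poly_nonzero [simp]: "monic_poly d c \<noteq> 0"
  using coeff_monic_poly[of d c d] by auto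

lemma monic_poly_eqI:
  assumes "degree p = d" "lead_coeff p = 1" "\<And>k. k < d \<Longrightarrow> c k = coeff p k"
  shows "monic_poly d c = p"
  by (rule poly_eqI) (use assms in \<open>auto simp: coeff_monic_poly coeff_eq_0\<close>)

lemma low_poly_eqI:
  assumes "\<And>k. d \<le> k \<Longrightarrow> coeff p k = 0" "\<And>k. k < d \<Longrightarrow> c k = coeff p k"
  shows "low_poly d c = p"
  by (rule poly_eqI) (use assms in \<open>auto simp: coeff_low_poly\<close>)

text \<open>The remainder has smaller degree than \<open>H * (f div H)\<close>, so this product
  carries the degree and the leading coefficient of \<open>f\<close>.\<close>

lemma monic_div:
  fixes f H :: "complex poly"
  assumes f: "lead_coeff f = 1" and H: "lead_coeff H = 1" and le: "degree H \<le> degree f"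
  shows "degree (f div H) = degree f - degree H" "lead_coeff (f div H) = 1"
proof -
  have H0: "H \<noteq> 0" using H by auto
  let ?q = "f div H" and ?r = "f mod H"
  have eq: "f = H * ?q + ?r" by (rule mult_div_mod_eq[symmetric])
  have q0: "?q \<noteq> 0"
  proof
    assume "?q = 0"
    then have "degree f < degree H \<or> f = 0" using H0 by (auto simp: div_poly_eq_0_iff)
    then show False using le f by auto
  qed
  have dm: "degree (H * ?q) = degree H + degree ?q" using H0 q0 by (rule degree_mult_eq)
  have *: "degree f = degree (H * ?q) \<and> lead_coeff f = lead_coeff (H * ?q)"
  proof (cases "?r = 0")
    case True then show ?thesis using eq by simp
  next
    case False
    then have "degree ?r < degree (H * ?q)" using degree_mod_less[OF H0, of f] dm by auto
    then show ?thesis using degree_add_eq_left[of ?r "H * ?q"] lead_coeff_add_le[of ?r "H * ?q"] eq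
      by (metis add.commute)
  qed
  then show "degree ?q = degree f - degree H" using dm by simp
  have "lead_coeff (H * ?q) = lead_coeff ?q" using H by (simp only: lead_coeff_mult) simp
  then show "lead_coeff ?q = 1" using * f by simp
qed

lemma root_bound_pos: "0 < root_bound d m a"
  unfolding root_bound_def by (intro add_pos_nonneg sum_nonneg) auto

text \<open>Cauchy's argument: at a root the leading term equals minus the lower terms, which are
  too small if \<open>norm z\<close> is at least one plus the sum of their coefficients'
  norms.\<close>

lemma norm_root_less_root_bound:
  assumes i: "i < m" and z: "poly (monic_poly d (a i)) z = 0"
  shows "norm z < root_bound d m a"
proof (rule ccontr)
  assume "\<not> norm z < root_bound d m a"
  then have ge: "root_bound d m a \<le> norm z" by simp
  let ?s = "\<Sum>k<d. norm (a i k)"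
  have "?s \<le> (\<Sum>i<m. \<Sum>k<d. norm (a i k))"
    using i by (intro member_le_sum[of i "{..<m}" "\<lambda>i. \<Sum>k<d. norm (a i k)"]) (auto intro: sum_nonneg)
  then have s: "?s + 1 \<le> norm z" using ge by (simp add: root_bound_def)
  have s0: "0 \<le> ?s" by (intro sum_nonneg) auto
  have z1: "1 \<le> norm z" using s s0 by linarith
  have eq: "z ^ d = - (\<Sum>k<d. a i k * z ^ k)"
    using z by (simp add: monic_poly_def poly_sum poly_monom add_eq_0_iff2)
  show False
  proof (cases d)
    case 0 then show ?thesis using z by (simp add: monic_poly_def)
  next
    case (Suc e)
    have "norm z ^ d = norm (\<Sum>k<d. a i k * z ^ k)" using arg_cong[OF eq, of norm] by (simp add: norm_power)
    also have "\<dots> \<le> (\<Sum>k<d. norm (a i k) * norm z ^ k)"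
      by (rule order_trans[OF norm_sum]) (simp add: norm_mult norm_power)
    \<comment> \<open>As \<open>norm z \<ge> 1\<close>, all lower powers are bounded by the power
      \<open>e = d - 1\<close>.\<close>
    also have "\<dots> \<le> (\<Sum>k<d. norm (a i k) * norm z ^ e)"
      using z1 Suc by (intro sum_mono mult_left_mono power_increasing) auto
    also have "\<dots> = ?s * norm z ^ e" by (simp add: sum_distrib_right)
    finally have "norm z * norm z ^ e \<le> ?s * norm z ^ e" using Suc by simp
    moreover have "0 < norm z ^ e" using z1 by (intro zero_less_power) linarith
    ultimately have "norm z \<le> ?s" by (simp add: mult_le_cancel_right)
    then show False using s by linarith
  qed
qed

lemma continuous_on_root_bound:
  assumes "continuous_on S g"
  shows "continuous_on S (\<lambda>s. root_bound d m (g s))"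
  unfolding root_bound_def
  by (intro continuous_on_add continuous_on_sum continuous_on_norm continuous_on_const
      continuous_on_coord[OF continuous_on_coord[OF assms]])

text \<open>In the notation of the paper, \<open>P d\<close> consists of all \<open>m\<close>-tuples of monic polynomials of degree \<open>d\<close>, and the set \<open>U d 0\<close>
  defined later is \<open>Q\<close>. A remainder modulo a polynomial of degree \<open>j n\<close> has \<open>j n\<close> free coefficients, so tuples of
  remainders are also represented as elements of \<open>P (j * n)\<close>.\<close>

locale tuples =
  fixes K :: "complex set" and m n :: nat
  assumes K: "K = \<real> \<or> K = UNIV" and m: "1 \<le> m" and n: "1 \<le> n" and mn: "(m, n) \<noteq> (1, 1)"
begin

lemma K_closed:
  "0 \<in> K" "1 \<in> K" "complex_of_real x \<in> K"
  "a \<in> K \<Longrightarrow> b \<in> K \<Longrightarrow> a + b \<in> K" "a \<in> K \<Longrightarrow> b \<in> K \<Longrightarrow> a * b \<in> K"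
  "a \<in> K \<Longrightarrow> - a \<in> K" "a \<in> K \<Longrightarrow> b \<in> K \<Longrightarrow> a - b \<in> K"
  using K by auto

lemma K_sum: "(\<And>i. i \<in> A \<Longrightarrow> f i \<in> K) \<Longrightarrow> sum f A \<in> K"
  by (induction A rule: infinite_finite_induct) (auto intro: K_closed)

definition P :: "nat \<Rightarrow> (nat \<Rightarrow> nat \<Rightarrow> complex) set" where
  "P d = {a. (\<forall>i k. (m \<le> i \<or> d \<le> k) \<longrightarrow> a i k = 0) \<and> (\<forall>i<m. \<forall>k<d. a i k \<in> K)}"

definition kpoly :: "complex poly \<Rightarrow> bool" where
  "kpoly p \<longleftrightarrow> (\<forall>k. coeff p k \<in> K)"

lemma kpoly_add: "kpoly p \<Longrightarrow> kpoly q \<Longrightarrow> kpoly (p + q)"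
  and kpoly_diff: "kpoly p \<Longrightarrow> kpoly q \<Longrightarrow> kpoly (p - q)"
  and kpoly_mult: "kpoly p \<Longrightarrow> kpoly q \<Longrightarrow> kpoly (p * q)"
  by (auto simp: kpoly_def coeff_mult intro!: K_closed K_sum)

lemma kpoly_1: "kpoly 1"
  by (auto simp: kpoly_def intro!: K_closed)

lemma kpoly_power: "kpoly p \<Longrightarrow> kpoly (p ^ k)"
  by (induction k) (auto intro: kpoly_mult kpoly_1)

lemma kpoly_smult: "c \<in> K \<Longrightarrow> kpoly p \<Longrightarrow> kpoly (smult c p)"
  by (auto simp: kpoly_def intro!: K_closed)

lemma kpoly_linear: "kpoly [:complex_of_real c, complex_of_real e:]"
  by (auto simp: kpoly_def coeff_pCons K_closed split: nat.split)

lemma kpoly_linear': "kpoly [:- complex_of_real c, 1:]"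
  using kpoly_linear[of "-c" 1] by simp

lemma kpoly_root_poly: "kpoly (root_poly j x)"
  by (induction j) (auto simp only: root_poly_Suc intro!: kpoly_mult kpoly_linear', simp add: root_poly_def kpoly_1)

text \<open>The recursion of \<open>coeff_div_linear\<close> with a real \<open>c\<close> stays
  inside \<open>K\<close>; it starts from the zero coefficients above the degree of
  \<open>p\<close>.\<close>

lemma kpoly_div_linear:
  assumes p: "kpoly p" shows "kpoly (p div [:- complex_of_real c, 1:])"
proof -
  have "coeff (p div [:- complex_of_real c, 1:]) k \<in> K" for k
  proof (induction "Suc (degree p) - k" arbitrary: k)
    case 0
    then have "coeff (p div [:- complex_of_real c, 1:]) k = 0"
      by (intro coeff_eq_0 le_less_trans[OF degree_div_linear_le]) auto
    then show ?case by (simp add: K_closed)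
  next
    case (Suc u)
    have "u = Suc (degree p) - Suc k" using Suc.hyps(2) by linarith
    note IH = Suc.hyps(1)[OF this]
    show ?case by (subst coeff_div_linear) (use p in \<open>auto intro!: K_closed IH simp: kpoly_def\<close>)
  qed
  then show ?thesis by (simp add: kpoly_def)
qed

lemma kpoly_div_root_poly:
  assumes p: "kpoly p" shows "kpoly (p div root_poly j x ^ k)"
proof (induction j)
  case (Suc j)
  have "kpoly (q div [:- complex_of_real c, 1:] ^ k)" if "kpoly q" for q c
  proof (induction k)
    case (Suc k)
    have "q div [:- complex_of_real c, 1:] ^ Suc k = (q div [:- complex_of_real c, 1:] ^ k) div [:- complex_of_real c, 1:]"
      by (metis poly_div_mult_right power_Suc2)
    then show ?case using kpoly_div_linear[OF Suc] by simp
  qed (simp add: that)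
  from this[OF Suc] show ?case unfolding root_poly_Suc power_mult_distrib poly_div_mult_right .
qed (simp add: root_poly_def p)

lemma kpoly_mod_root_poly:
  "kpoly p \<Longrightarrow> kpoly (p mod root_poly j x ^ k)"
  unfolding minus_div_mult_eq_mod[symmetric]
  by (intro kpoly_diff kpoly_mult kpoly_div_root_poly kpoly_power kpoly_root_poly)

text \<open>Encodes polynomials by their coefficients below \<open>d\<close>. A leading
  \<open>1\<close> in degree \<open>d\<close> is dropped, so the same encoding is inverse to
  \<open>monic_poly d\<close> on monic polynomials and to \<open>low_poly d\<close> on
  remainders.\<close>

definition tup :: "nat \<Rightarrow> (nat \<Rightarrow> complex poly) \<Rightarrow> nat \<Rightarrow> nat \<Rightarrow> complex" where
  "tup d F = (\<lambda>i k. if i < m \<and> k < d then coeff (F i) k else 0)"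

lemma tup_in_P: "(\<And>i. i < m \<Longrightarrow> kpoly (F i)) \<Longrightarrow> tup d F \<in> P d"
  by (auto simp: tup_def P_def kpoly_def)

lemma tup_cong: "(\<And>i. i < m \<Longrightarrow> F i = G i) \<Longrightarrow> tup d F = tup d G"
  by (auto simp: tup_def fun_eq_iff)

lemma monic_poly_tup:
  "i < m \<Longrightarrow> degree (F i) = d \<Longrightarrow> lead_coeff (F i) = 1 \<Longrightarrow> monic_poly d (tup d F i) = F i"
  by (rule monic_poly_eqI) (auto simp: tup_def)

lemma low_poly_tup:
  "i < m \<Longrightarrow> (\<And>k. d \<le> k \<Longrightarrow> coeff (F i) k = 0) \<Longrightarrow> low_poly d (tup d F i) = F i"
  by (rule low_poly_eqI) (auto simp: tup_def)

lemma tup_monic_poly: "a \<in> P d \<Longrightarrow> tup d (\<lambda>i. monic_poly d (a i)) = a"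
  by (auto simp: tup_def P_def fun_eq_iff coeff_monic_poly)

lemma tup_low_poly: "a \<in> P d \<Longrightarrow> tup d (\<lambda>i. low_poly d (a i)) = a"
  by (auto simp: tup_def P_def fun_eq_iff coeff_low_poly)

lemma kpoly_monic_poly: "a \<in> P d \<Longrightarrow> i < m \<Longrightarrow> kpoly (monic_poly d (a i))"
  by (auto simp: kpoly_def P_def coeff_monic_poly K_closed)

lemma kpoly_low_poly: "a \<in> P d \<Longrightarrow> i < m \<Longrightarrow> kpoly (low_poly d (a i))"
  by (auto simp: kpoly_def P_def coeff_low_poly K_closed)

lemma continuous_poly_on_monic_poly [cpoly_intros]:
  assumes "continuous_on S g"
  shows "continuous_poly_on S (\<lambda>s. monic_poly d (g s i))"
  unfolding monic_poly_def
  by (intro cpoly_intros continuous_on_coord[OF continuous_on_coord[OF assms]])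

lemma continuous_poly_on_low_poly [cpoly_intros]:
  assumes "continuous_on S g"
  shows "continuous_poly_on S (\<lambda>s. low_poly d (g s i))"
  unfolding low_poly_def
  by (intro cpoly_intros continuous_on_coord[OF continuous_on_coord[OF assms]])

lemma continuous_on_tup:
  assumes "\<And>i. i < m \<Longrightarrow> continuous_poly_on S (\<lambda>s. F s i)"
  shows "continuous_on S (\<lambda>s. tup d (F s))"
proof (intro continuous_on_coordinatewise_then_product)
  fix i k
  show "continuous_on S (\<lambda>s. tup d (F s) i k)"
    by (cases "i < m \<and> k < d") (auto simp: tup_def intro: continuous_poly_on_coeff assms)
qed

definition quo :: "nat \<Rightarrow> nat \<Rightarrow> (nat \<Rightarrow> real) \<Rightarrow> (nat \<Rightarrow> nat \<Rightarrow> complex) \<Rightarrow> nat \<Rightarrow> nat \<Rightarrow> complex" where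
  "quo d j x a = tup (d - j * n) (\<lambda>i. monic_poly d (a i) div root_poly j x ^ n)"

definition rem :: "nat \<Rightarrow> nat \<Rightarrow> (nat \<Rightarrow> real) \<Rightarrow> (nat \<Rightarrow> nat \<Rightarrow> complex) \<Rightarrow> nat \<Rightarrow> nat \<Rightarrow> complex" where
  "rem d j x a = tup (j * n) (\<lambda>i. monic_poly d (a i) mod root_poly j x ^ n)"

text \<open>For fixed \<open>x\<close> and \<open>j * n \<le> d\<close> this is inverse to the pair
  of \<open>quo\<close> and \<open>rem\<close>: a tuple is reassembled from the quotient
  \<open>b\<close> and the remainder \<open>r\<close>.\<close>

definition asm :: "nat \<Rightarrow> nat \<Rightarrow> (nat \<Rightarrow> real) \<Rightarrow> (nat \<Rightarrow> nat \<Rightarrow> complex) \<Rightarrow> (nat \<Rightarrow> nat \<Rightarrow> complex) \<Rightarrow> nat \<Rightarrow> nat \<Rightarrow> complex" where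
  "asm d j x b r = tup d (\<lambda>i. root_poly j x ^ n * monic_poly (d - j * n) (b i) + low_poly (j * n) (r i))"

lemma degree_root_poly_power [simp]: "degree (root_poly j x ^ k) = j * k"
  by (simp add: degree_power_eq)

lemma lead_coeff_root_poly_power: "lead_coeff (root_poly j x ^ k) = 1"
  by (subst lead_coeff_power) simp

lemma lead_coeff_monic_poly: "lead_coeff (monic_poly d c) = 1"
  by (simp add: coeff_monic_poly)

lemma monic_poly_quo:
  assumes "j * n \<le> d" "i < m"
  shows "monic_poly (d - j * n) (quo d j x a i) = monic_poly d (a i) div root_poly j x ^ n"
  unfolding quo_def
proof (rule monic_poly_tup[OF assms(2)])
  have le: "degree (root_poly j x ^ n) \<le> degree (monic_poly d (a i))" using assms by simp
  show "degree (monic_poly d (a i) div root_poly j x ^ n) = d - j * n"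
    using monic_div(1)[OF lead_coeff_monic_poly lead_coeff_root_poly_power le] by simp
  show "lead_coeff (monic_poly d (a i) div root_poly j x ^ n) = 1"
    using monic_div(2)[OF lead_coeff_monic_poly lead_coeff_root_poly_power le] .
qed

lemma coeff_mod_root_poly:
  assumes "j * k \<le> l" shows "coeff (p mod root_poly j x ^ k) l = 0"
proof (cases "p mod root_poly j x ^ k = 0")
  case False
  then have "degree (p mod root_poly j x ^ k) < j * k"
    using degree_mod_less[of "root_poly j x ^ k" p] by simp
  then show ?thesis using assms by (intro coeff_eq_0) simp
qed simp

lemma low_poly_rem:
  assumes "i < m"
  shows "low_poly (j * n) (rem d j x a i) = monic_poly d (a i) mod root_poly j x ^ n"
  unfolding rem_def by (rule low_poly_tup[OF assms]) (rule coeff_mod_root_poly)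

lemma monic_poly_asm:
  assumes "j * n \<le> d" "i < m"
  shows "monic_poly d (asm d j x b r i) = root_poly j x ^ n * monic_poly (d - j * n) (b i) + low_poly (j * n) (r i)"
  unfolding asm_def
proof (rule monic_poly_tup[OF assms(2)])
  let ?A = "root_poly j x ^ n * monic_poly (d - j * n) (b i)" and ?B = "low_poly (j * n) (r i)"
  have dA: "degree ?A = d" using assms by (simp add: degree_mult_eq)
  have lA: "lead_coeff ?A = 1"
    unfolding lead_coeff_mult lead_coeff_root_poly_power lead_coeff_monic_poly by simp
  \<comment> \<open>Since \<open>j * n \<le> d\<close>, the remainder does not reach degree
    \<open>d\<close> and cannot disturb the leading term.\<close>
  have B: "coeff ?B k = 0" if "d \<le> k" for k using that assms by (simp add: coeff_low_poly)
  have c: "coeff (?A + ?B) k = coeff ?A k" if "d \<le> k" for k using B[OF that] by simp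
  show deg: "degree (?A + ?B) = d"
  proof (rule antisym)
    show "degree (?A + ?B) \<le> d"
    proof (rule degree_le, intro allI impI)
      fix k assume "d < k" then show "coeff (?A + ?B) k = 0" using c[of k] dA by (simp add: coeff_eq_0)
    qed
    show "d \<le> degree (?A + ?B)" using c[of d] lA dA by (intro le_degree) simp
  qed
  show "lead_coeff (?A + ?B) = 1" unfolding deg using c[of d] lA dA by simp
qed

lemma quo_in_P: "a \<in> P d \<Longrightarrow> quo d j x a \<in> P (d - j * n)"
  unfolding quo_def by (rule tup_in_P) (intro kpoly_div_root_poly kpoly_monic_poly)

lemma rem_in_P: "a \<in> P d \<Longrightarrow> rem d j x a \<in> P (j * n)"
  unfolding rem_def by (rule tup_in_P) (intro kpoly_mod_root_poly kpoly_monic_poly)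

lemma asm_in_P: "b \<in> P (d - j * n) \<Longrightarrow> r \<in> P (j * n) \<Longrightarrow> asm d j x b r \<in> P d"
  unfolding asm_def by (rule tup_in_P) (intro kpoly_add kpoly_mult kpoly_power kpoly_root_poly kpoly_monic_poly kpoly_low_poly)

lemma asm_quo_rem:
  assumes "j * n \<le> d" "a \<in> P d" shows "asm d j x (quo d j x a) (rem d j x a) = a"
proof -
  have "asm d j x (quo d j x a) (rem d j x a) = tup d (\<lambda>i. monic_poly d (a i))"
    unfolding asm_def by (rule tup_cong) (simp add: monic_poly_quo[OF assms(1)] low_poly_rem)
  then show ?thesis using tup_monic_poly[OF assms(2)] by simp
qed

lemma
  assumes "j * n \<le> d" "b \<in> P (d - j * n)" "r \<in> P (j * n)"
  shows quo_asm: "quo d j x (asm d j x b r) = b" and rem_asm: "rem d j x (asm d j x b r) = r"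
proof -
  have *: "(root_poly j x ^ n * q + low_poly (j * n) c) div root_poly j x ^ n = q"
     "(root_poly j x ^ n * q + low_poly (j * n) c) mod root_poly j x ^ n = low_poly (j * n) c" for q c
  proof -
    let ?H = "root_poly j x ^ n" and ?r = "low_poly (j * n) c"
    have H0: "?H \<noteq> 0" by simp
    have "?r div ?H = 0 \<and> ?r mod ?H = ?r"
    proof (cases "?r = 0")
      case False
      have "coeff ?r (degree ?r) \<noteq> 0" using False by simp
      then have "degree ?r < j * n" unfolding coeff_low_poly by (auto split: if_splits)
      then show ?thesis by (simp add: div_poly_less mod_poly_less)
    qed simp
    then show "(?H * q + ?r) div ?H = q" "(?H * q + ?r) mod ?H = ?r" using H0 by simp_all
  qed
  have "quo d j x (asm d j x b r) = tup (d - j * n) (\<lambda>i. monic_poly (d - j * n) (b i))"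
    unfolding quo_def by (rule tup_cong) (simp only: monic_poly_asm[OF assms(1)] *)
  then show "quo d j x (asm d j x b r) = b" using tup_monic_poly[OF assms(2)] by simp
  have "rem d j x (asm d j x b r) = tup (j * n) (\<lambda>i. low_poly (j * n) (r i))"
    unfolding rem_def by (rule tup_cong) (simp only: monic_poly_asm[OF assms(1)] *)
  then show "rem d j x (asm d j x b r) = r" using tup_low_poly[OF assms(3)] by simp
qed

lemma continuous_on_quo:
  assumes "continuous_on S x" "continuous_on S a"
  shows "continuous_on S (\<lambda>s. quo d j (x s) (a s))"
  unfolding quo_def by (intro continuous_on_tup cpoly_intros assms)

lemma continuous_on_rem:
  assumes "continuous_on S x" "continuous_on S a"
  shows "continuous_on S (\<lambda>s. rem d j (x s) (a s))"
  unfolding rem_def by (intro continuous_on_tup cpoly_intros assms)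

lemma continuous_on_asm:
  assumes "continuous_on S x" "continuous_on S b" "continuous_on S r"
  shows "continuous_on S (\<lambda>s. asm d j (x s) (b s) (r s))"
  unfolding asm_def by (intro continuous_on_tup cpoly_intros assms)

end

section \<open>Common real roots\<close>

lemma le_iff_imp_eq: "(\<And>c. c \<le> a \<longleftrightarrow> c \<le> b) \<Longrightarrow> a = b" for a b :: "'a::order"
  by (meson order_antisym order_refl)

context tuples
begin

text \<open>The largest \<open>c\<close> such that the power of \<open>z - y\<close> with exponent
  \<open>c * n\<close> divides every polynomial of the tuple; the division rounds down.\<close>

definition root_count :: "nat \<Rightarrow> (nat \<Rightarrow> nat \<Rightarrow> complex) \<Rightarrow> real \<Rightarrow> nat" where
  "root_count d a y = Min ((\<lambda>i. Polynomial.order (complex_of_real y) (monic_poly d (a i)) div n) ` {..<m})"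

definition roots :: "nat \<Rightarrow> (nat \<Rightarrow> nat \<Rightarrow> complex) \<Rightarrow> real multiset" where
  "roots d a = Abs_multiset (root_count d a)"

lemma m_nonempty: "{..<m} \<noteq> {}"
  using m by (auto simp: lessThan_empty_iff)

lemma le_root_count_iff:
  "c \<le> root_count d a y \<longleftrightarrow> (\<forall>i<m. n * c \<le> Polynomial.order (complex_of_real y) (monic_poly d (a i)))"
proof -
  have "c \<le> root_count d a y \<longleftrightarrow> (\<forall>i\<in>{..<m}. c \<le> Polynomial.order (complex_of_real y) (monic_poly d (a i)) div n)"
    unfolding root_count_def using m_nonempty by (subst Min_ge_iff) auto
  then show ?thesis using n by (simp add: less_eq_div_iff_mult_less_eq mult.commute Ball_def)
qed

text \<open>A point of positive count is a root of the first polynomial. So there are finitely many,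
  and \<open>Abs_multiset\<close> loses nothing.\<close>

lemma count_roots [simp]: "count (roots d a) y = root_count d a y"
proof -
  have "finite {y. 0 < root_count d a y}"
  proof (rule finite_subset)
    have "finite {z. poly (monic_poly d (a 0)) z = 0}" by (rule poly_roots_finite) simp
    then show "finite (complex_of_real -` {z. poly (monic_poly d (a 0)) z = 0})"
      by (rule finite_vimageI) (auto simp: inj_def)
    show "{y. 0 < root_count d a y} \<subseteq> complex_of_real -` {z. poly (monic_poly d (a 0)) z = 0}"
    proof
      fix y assume "y \<in> {y. 0 < root_count d a y}"
      then have "1 \<le> root_count d a y" by simp
      then have "n * 1 \<le> Polynomial.order (complex_of_real y) (monic_poly d (a 0))"
        using m unfolding le_root_count_iff by auto
      then show "y \<in> complex_of_real -` {z. poly (monic_poly d (a 0)) z = 0}"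
        using n by (simp add: order_root)
    qed
  qed
  then show ?thesis by (simp add: roots_def)
qed

lemma roots_subset_iff: "X \<subseteq># roots d a \<longleftrightarrow>
   (\<forall>i<m. \<forall>y. n * count X y \<le> Polynomial.order (complex_of_real y) (monic_poly d (a i)))"
  unfolding subseteq_mset_def count_roots le_root_count_iff by blast

lemma root_poly_dvd_iff:
  "(\<forall>i<m. root_poly j x ^ n dvd monic_poly d (a i)) \<longleftrightarrow> root_mset j x \<subseteq># roots d a"
  unfolding roots_subset_iff by (simp add: root_poly_power_dvd_iff)

text \<open>The \<open>n\<close>-th power of the polynomial with exactly these roots divides the
  first polynomial, so its degree is at most \<open>d\<close>.\<close>

lemma size_roots_le: "size (roots d a) * n \<le> d"
proof -
  obtain x where x: "root_mset (size (roots d a)) x = roots d a" using sorted_root_exists by blast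
  then have "root_poly (size (roots d a)) x ^ n dvd monic_poly d (a 0)"
    using root_poly_dvd_iff[of "size (roots d a)" x d a] m by auto
  then have "degree (root_poly (size (roots d a)) x ^ n) \<le> degree (monic_poly d (a 0))"
    by (rule dvd_imp_degree_le) simp
  then show ?thesis by simp
qed

text \<open>This expresses an inclusion of root multisets by the vanishing of continuous functions
  of \<open>a\<close> and \<open>x\<close>.\<close>

lemma rem_eq_0_iff:
  "rem d j x a = (\<lambda>_ _. 0) \<longleftrightarrow> root_mset j x \<subseteq># roots d a"
proof -
  have "rem d j x a = (\<lambda>_ _. 0) \<longleftrightarrow> (\<forall>i<m. monic_poly d (a i) mod root_poly j x ^ n = 0)"
  proof
    assume "rem d j x a = (\<lambda>_ _. 0)"
    then have "low_poly (j * n) (rem d j x a i) = 0" for i by (auto intro!: low_poly_eqI)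
    then show "\<forall>i<m. monic_poly d (a i) mod root_poly j x ^ n = 0" by (simp flip: low_poly_rem)
  next
    assume "\<forall>i<m. monic_poly d (a i) mod root_poly j x ^ n = 0"
    then show "rem d j x a = (\<lambda>_ _. 0)" by (auto simp: rem_def tup_def fun_eq_iff)
  qed
  then show ?thesis by (simp add: root_poly_dvd_iff[symmetric] dvd_eq_mod_eq_0)
qed

text \<open>With remainder zero, orders add up. The contribution of \<open>x\<close> is a multiple
  of \<open>n\<close>, so it passes through the rounding and through the minimum over the
  tuple.\<close>

lemma roots_asm_0:
  assumes "j * n \<le> d"
  shows "roots d (asm d j x b (\<lambda>_ _. 0)) = root_mset j x + roots (d - j * n) b"
proof (rule multiset_eqI)
  fix y
  have o: "Polynomial.order (complex_of_real y) (monic_poly d (asm d j x b (\<lambda>_ _. 0) i))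
     = n * count (root_mset j x) y + Polynomial.order (complex_of_real y) (monic_poly (d - j * n) (b i))"
    if "i < m" for i
  proof -
    have l: "low_poly (j * n) (\<lambda>_. 0) = 0" by (rule low_poly_eqI) auto
    have "root_poly j x ^ n * monic_poly (d - j * n) (b i) \<noteq> 0" by simp
    from order_mult[OF this] show ?thesis
      by (simp add: monic_poly_asm[OF assms that] l order_power_eq order_root_poly)
  qed
  have *: "c \<le> root_count d (asm d j x b (\<lambda>_ _. 0)) y \<longleftrightarrow> c \<le> count (root_mset j x) y + root_count (d - j * n) b y" for c
  proof (cases "c \<le> count (root_mset j x) y")
    case True then show ?thesis unfolding le_root_count_iff by (auto simp: o intro: trans_le_add1)
  next
    case False
    then obtain e where e: "c = count (root_mset j x) y + e" using nat_le_linear le_Suc_ex by metis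
    show ?thesis unfolding e add_le_cancel_left le_root_count_iff by (auto simp: o distrib_left)
  qed
  show "count (roots d (asm d j x b (\<lambda>_ _. 0))) y = count (root_mset j x + roots (d - j * n) b) y"
    using le_iff_imp_eq[OF *] by simp
qed

definition U :: "nat \<Rightarrow> nat \<Rightarrow> (nat \<Rightarrow> nat \<Rightarrow> complex) set" where
  "U d j = {a \<in> P d. size (roots d a) \<le> j}"

lemma Qspace_eq: "Qspace K d m n = U d 0"
proof -
  have "(\<exists>x. \<forall>i<m. n \<le> Polynomial.order (complex_of_real x) (monic_poly d (a i))) \<longleftrightarrow> \<not> size (roots d a) \<le> 0" for a
  proof -
    have "(\<exists>x. \<forall>i<m. n \<le> Polynomial.order (complex_of_real x) (monic_poly d (a i))) \<longleftrightarrow> (\<exists>x. 1 \<le> root_count d a x)"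
      by (simp only: le_root_count_iff) simp
    also have "\<dots> \<longleftrightarrow> roots d a \<noteq> {#}"
      by (auto simp: multiset_eq_iff Suc_le_eq)
    finally show ?thesis by simp
  qed
  then show ?thesis by (auto simp: Qspace_def U_def P_def)
qed

lemma U_subset_P: "U d j \<subseteq> P d" by (auto simp: U_def)

lemma U_mono: "i \<le> j \<Longrightarrow> U d i \<subseteq> U d j" by (auto simp: U_def)

lemma U_eq_P: "d < (j + 1) * n \<Longrightarrow> U d j = P d"
proof -
  assume d: "d < (j + 1) * n"
  have "size (roots d a) < j + 1" for a
    using size_roots_le[of d a] d by (meson le_less_trans mult_less_cancel2)
  then have "size (roots d a) \<le> j" for a by (simp add: less_Suc_eq_le)
  then show "U d j = P d" by (auto simp: U_def)
qed

text \<open>The position \<open>c\<close> is a parameter because a homotopy below moves it between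
  the root bounds of two different tuples.\<close>

definition add_root :: "nat \<Rightarrow> real \<Rightarrow> (nat \<Rightarrow> nat \<Rightarrow> complex) \<Rightarrow> nat \<Rightarrow> nat \<Rightarrow> complex" where
  "add_root d c a = tup (d + 1) (\<lambda>i. monic_poly d (a i) * [:- complex_of_real (c + real i), 1:])"

lemma stab_eq_add_root: "stab d m a = add_root d (root_bound d m a) a"
  by (auto simp: stab_def add_root_def tup_def fun_eq_iff)

lemma add_root_in_P: "a \<in> P d \<Longrightarrow> add_root d c a \<in> P (d + 1)"
  unfolding add_root_def by (rule tup_in_P) (intro kpoly_mult kpoly_monic_poly kpoly_linear')

lemma monic_poly_add_root:
  assumes "i < m"
  shows "monic_poly (d + 1) (add_root d c a i) = monic_poly d (a i) * [:- complex_of_real (c + real i), 1:]"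
  unfolding add_root_def
proof (rule monic_poly_tup[OF assms])
  show "degree (monic_poly d (a i) * [:- complex_of_real (c + real i), 1:]) = d + 1"
    by (subst degree_mult_eq) auto
  show "lead_coeff (monic_poly d (a i) * [:- complex_of_real (c + real i), 1:]) = 1"
    unfolding lead_coeff_mult lead_coeff_monic_poly by simp
qed

lemma continuous_on_add_root:
  assumes "continuous_on S c" "continuous_on S a"
  shows "continuous_on S (\<lambda>s. add_root d (c s) (a s))"
  unfolding add_root_def
  by (intro continuous_on_tup cpoly_intros assms continuous_intros)

lemma continuous_on_stab: "continuous_on S a \<Longrightarrow> continuous_on S (\<lambda>s. stab d m (a s))"
  unfolding stab_eq_add_root by (intro continuous_on_add_root continuous_on_root_bound)

text \<open>This is where \<open>(m, n) \<noteq> (1, 1)\<close> enters: a root \<open>c + i\<close> is not a root of the other polynomials of the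
  tuple if \<open>m \<ge> 2\<close>, and its multiplicity is less than \<open>n\<close> if \<open>m = 1\<close>.\<close>

lemma roots_add_root:
  assumes c: "\<And>i y. i < m \<Longrightarrow> poly (monic_poly d (a i)) (complex_of_real y) = 0 \<Longrightarrow> y < c"
  shows "roots (d + 1) (add_root d c a) = roots d a"
proof (rule multiset_eqI)
  fix y
  have o: "Polynomial.order (complex_of_real y) (monic_poly (d + 1) (add_root d c a i))
     = Polynomial.order (complex_of_real y) (monic_poly d (a i)) + (if y = c + real i then 1 else 0)"
    if "i < m" for i
  proof -
    have "monic_poly d (a i) * [:- complex_of_real (c + real i), 1:] \<noteq> 0"
      by (simp only: mult_eq_0_iff monic_poly_nonzero) simp
    from order_mult[OF this, of "complex_of_real y"] show ?thesis unfolding monic_poly_add_root[OF that] order_linear_of_real .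
  qed
  show "count (roots (d + 1) (add_root d c a)) y = count (roots d a) y"
  proof (cases "c \<le> y")
    case False
    then have "Polynomial.order (complex_of_real y) (monic_poly (d + 1) (add_root d c a i))
      = Polynomial.order (complex_of_real y) (monic_poly d (a i))" if "i < m" for i
      using o[OF that] by auto
    then have "e \<le> root_count (d + 1) (add_root d c a) y \<longleftrightarrow> e \<le> root_count d a y" for e
      unfolding le_root_count_iff by simp
    from le_iff_imp_eq[OF this] show ?thesis by simp
  next
    case True
    have z: "Polynomial.order (complex_of_real y) (monic_poly d (a i)) = 0" if "i < m" for i
      using c[OF that, of y] True by (intro order_0I) auto
    have "\<not> 1 \<le> root_count d a y" unfolding le_root_count_iff using z[of 0] m n by (auto intro!: exI[of _ 0])
    moreover have "\<not> 1 \<le> root_count (d + 1) (add_root d c a) y"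
    proof
      assume "1 \<le> root_count (d + 1) (add_root d c a) y"
      then have le: "n \<le> (if y = c + real i then 1 else 0)" if "i < m" for i
        using o[OF that] z[OF that] that unfolding le_root_count_iff by auto
      have y0: "y = c" and n1: "n = 1" using le[of 0] m n by (auto split: if_splits)
      then have "1 < m" using mn m by auto
      then show False using le[of 1] y0 n1 by auto
    qed
    ultimately show ?thesis by simp
  qed
qed

lemma real_root_less_root_bound:
  "i < m \<Longrightarrow> poly (monic_poly d (a i)) (complex_of_real y) = 0 \<Longrightarrow> y < root_bound d m a"
  using norm_root_less_root_bound[of i m d a "complex_of_real y"] by simp

lemma roots_stab: "roots (d + 1) (stab d m a) = roots d a"
  unfolding stab_eq_add_root by (rule roots_add_root) (rule real_root_less_root_bound)

lemma stab_in_P: "a \<in> P d \<Longrightarrow> stab d m a \<in> P (d + 1)"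
  unfolding stab_eq_add_root by (rule add_root_in_P)

lemma stab_in_U: "a \<in> U d j \<Longrightarrow> stab d m a \<in> U (d + 1) j"
  by (simp add: U_def stab_in_P roots_stab del: One_nat_def Suc_eq_plus1 add_Suc_right)

lemma abs_root_less_root_bound:
  assumes "y \<in># roots d a"
  shows "\<bar>y\<bar> < root_bound d m a"
proof -
  have "1 \<le> root_count d a y" using assms by (simp flip: count_roots)
  then have "n \<le> Polynomial.order (complex_of_real y) (monic_poly d (a 0))"
    unfolding le_root_count_iff using m by auto
  then have "poly (monic_poly d (a 0)) (complex_of_real y) = 0" using n by (simp add: order_root)
  then show ?thesis using norm_root_less_root_bound[of 0 m d a "complex_of_real y"] m by simp
qed

lemma zero_in_P: "(\<lambda>_ _. 0) \<in> P d" by (auto simp: P_def K_closed)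

end

section \<open>The closed incidence of tuples and common roots, and its proper projection\<close>

text \<open>A product of intervals for \<open>l < j\<close> and of points \<open>{0}\<close> for the
  other indices, compact by Tychonoff. It will hold root vectors divided by the root bound.\<close>

lemma compact_cube: "compact {y :: nat \<Rightarrow> real. y \<in> coord_space {..<j} \<and> (\<forall>l. \<bar>y l\<bar> \<le> 1)}"
proof -
  let ?I = "\<lambda>l. if l < j then {-1..1} else {0::real}"
  have "compactin (product_topology (\<lambda>_. euclidean) UNIV) (PiE (UNIV::nat set) ?I)"
    by (subst compactin_PiE) auto
  then have "compact (PiE (UNIV::nat set) ?I)" by (simp add: euclidean_product_topology)
  moreover have "PiE (UNIV::nat set) ?I = {y. y \<in> coord_space {..<j} \<and> (\<forall>l. \<bar>y l\<bar> \<le> 1)}"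
    by (auto simp: PiE_iff coord_space_def abs_le_iff split: if_splits) (metis abs_le_iff abs_zero zero_le_one linorder_not_less atLeastAtMost_iff minus_le_iff)+
  ultimately show ?thesis by simp
qed

lemma closedin_fst_image:
  assumes T: "compact T" and C: "closedin (top_of_set (S \<times> T)) C"
  shows "closedin (top_of_set S) (fst ` C)"
proof -
  have "prod_topology (top_of_set S) (top_of_set T) = top_of_set (S \<times> T)"
    by (simp add: subtopology_Times flip: euclidean_product_topology)
  moreover have "closed_map (prod_topology (top_of_set S) (top_of_set T)) (top_of_set S) fst"
    using T by (intro closed_map_fst) (simp add: compact_space_subtopology)
  ultimately show ?thesis using C by (simp add: closed_map_def)
qed

lemma closedin_restrict:
  assumes "closedin (top_of_set X) Z" "S \<subseteq> X"
  shows "closedin (top_of_set S) (S \<inter> Z)"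
proof -
  obtain T where T: "closed T" "Z = X \<inter> T" using assms(1) unfolding closedin_closed by blast
  then have "S \<inter> Z = S \<inter> T" using assms(2) by blast
  then show ?thesis using T(1) unfolding closedin_closed by blast
qed

context tuples
begin

abbreviation V :: "nat \<Rightarrow> (nat \<Rightarrow> real) set" where "V j \<equiv> coord_space {..<j}"

text \<open>Here \<open>x\<close> lists some \<open>j\<close> of the common roots of
  \<open>a\<close>, in general not all of them. This makes the condition closed on all of
  \<open>P d\<close>.\<close>

definition incidence :: "nat \<Rightarrow> nat \<Rightarrow> ((nat \<Rightarrow> nat \<Rightarrow> complex) \<times> (nat \<Rightarrow> real)) set" where
  "incidence d j = {(a,x). a \<in> P d \<and> x \<in> V j \<and> sorted (map x [0..<j]) \<and> rem d j x a = (\<lambda>_ _. 0)}"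

lemma sorted_map_iff: "sorted (map x [0..<j]) \<longleftrightarrow> (\<forall>k l. k \<le> l \<longrightarrow> l < j \<longrightarrow> x k \<le> (x l :: real))"
  by (auto simp: sorted_iff_nth_mono)

lemma closedin_incidence: "closedin (top_of_set (P d \<times> V j)) (incidence d j)"
proof -
  let ?X = "P d \<times> V j"
  have x: "continuous_on ?X snd" and a: "continuous_on ?X fst" by (auto intro: continuous_on_fst continuous_on_snd)
  have 1: "closedin (top_of_set ?X) {p \<in> ?X. k \<le> l \<longrightarrow> l < j \<longrightarrow> snd p k \<le> snd p l}" for k l
  proof (cases "k \<le> l \<and> l < j")
    case True
    have "closedin (top_of_set ?X) (?X \<inter> (\<lambda>p. snd p k - snd p l) -` {..0})"
      by (intro continuous_closedin_preimage continuous_on_diff continuous_on_coord[OF x] closed_atMost)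
    also have "?X \<inter> (\<lambda>p. snd p k - snd p l) -` {..0} = {p \<in> ?X. snd p k \<le> snd p l}" by auto
    finally show ?thesis using True by simp
  next
    case False
    then have eq: "{p \<in> ?X. k \<le> l \<longrightarrow> l < j \<longrightarrow> snd p k \<le> snd p l} = ?X" by auto
    show ?thesis unfolding eq using closedin_topspace[of "top_of_set ?X"] by simp
  qed
  have 2: "closedin (top_of_set ?X) {p \<in> ?X. rem d j (snd p) (fst p) i k = 0}" for i k
  proof -
    have "closedin (top_of_set ?X) (?X \<inter> (\<lambda>p. rem d j (snd p) (fst p) i k) -` {0})"
      by (intro continuous_closedin_preimage continuous_on_coord[OF continuous_on_coord[OF continuous_on_rem[OF x a]]] closed_singleton)
    also have "?X \<inter> (\<lambda>p. rem d j (snd p) (fst p) i k) -` {0} = {p \<in> ?X. rem d j (snd p) (fst p) i k = 0}" by auto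
    finally show ?thesis .
  qed
  have "closedin (top_of_set ?X) ((\<Inter>k. \<Inter>l. {p \<in> ?X. k \<le> l \<longrightarrow> l < j \<longrightarrow> snd p k \<le> snd p l}) \<inter>
      (\<Inter>i. \<Inter>k. {p \<in> ?X. rem d j (snd p) (fst p) i k = 0}))"
    by (intro closedin_Int closedin_INT 1 2 UNIV_not_empty)
  also have "\<dots> = incidence d j"
    by (auto simp: incidence_def sorted_map_iff fun_eq_iff)
  finally show ?thesis .
qed

lemma incidence_roots: "(a,x) \<in> incidence d j \<Longrightarrow> root_mset j x \<subseteq># roots d a"
  by (simp add: incidence_def rem_eq_0_iff)

lemma incidence_bound: 
  assumes "(a,x) \<in> incidence d j" shows "\<bar>x l\<bar> < root_bound d m a"
proof (cases "l < j")
  case True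
  then have "x l \<in># root_mset j x" by (auto simp: root_mset_def)
  then have "x l \<in># roots d a" using incidence_roots[OF assms] by (rule mset_subset_eqD[rotated])
  then show ?thesis by (rule abs_root_less_root_bound)
next
  case False
  then show ?thesis using assms root_bound_pos by (simp add: incidence_def coord_space_def)
qed

text \<open>The roots are bounded by the continuous function \<open>root_bound d m\<close>. After
  dividing by it the root vectors lie in a compact cube, and projection along a compact factor is
  closed.\<close>

lemma closedin_fst_incidence:
  assumes C: "closedin (top_of_set (P d \<times> V j)) C" and sub: "C \<subseteq> incidence d j"
  shows "closedin (top_of_set (P d)) (fst ` C)"
proof -
  let ?B = "{y :: nat \<Rightarrow> real. y \<in> V j \<and> (\<forall>l. \<bar>y l\<bar> \<le> 1)}"
  let ?g = "\<lambda>(a,y). (a, \<lambda>l. root_bound d m a * y l)"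
  have cg: "continuous_on (P d \<times> ?B) ?g"
    unfolding case_prod_beta
  proof (intro continuous_on_Pair continuous_on_fst continuous_on_id continuous_on_coordinatewise_then_product)
    show "continuous_on (P d \<times> ?B) (\<lambda>p. root_bound d m (fst p) * snd p l)" for l
      by (intro continuous_on_mult continuous_on_root_bound continuous_on_fst continuous_on_id
          continuous_on_coord[OF continuous_on_snd[OF continuous_on_id]])
  qed
  have "closedin (top_of_set (P d \<times> ?B)) ((P d \<times> ?B) \<inter> ?g -` C)"
    by (rule continuous_closedin_preimage_gen[OF cg _ C]) (auto simp: coord_space_def)
  then have cl: "closedin (top_of_set (P d)) (fst ` ((P d \<times> ?B) \<inter> ?g -` C))"
    by (rule closedin_fst_image[OF compact_cube])
  have "fst ` ((P d \<times> ?B) \<inter> ?g -` C) = fst ` C"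
  proof (intro equalityI subsetI)
    fix a assume "a \<in> fst ` C"
    then obtain x where x: "(a,x) \<in> C" by auto
    then have i: "(a,x) \<in> incidence d j" using sub by auto
    define y where "y = (\<lambda>l. x l / root_bound d m a)"
    have y: "x = (\<lambda>l. root_bound d m a * y l)" using root_bound_pos[of d m a] by (auto simp: y_def)
    have "y \<in> ?B" using i incidence_bound[OF i] root_bound_pos[of d m a]
      by (auto simp: y_def incidence_def coord_space_def abs_divide divide_le_eq less_imp_le)
    moreover have "a \<in> P d" using i by (simp add: incidence_def)
    ultimately show "a \<in> fst ` ((P d \<times> ?B) \<inter> ?g -` C)" using x y by (intro image_eqI[of _ _ "(a,y)"]) auto
  qed (force simp: image_iff)
  then show ?thesis using cl by simp
qed

text \<open>More than \<open>j\<close> common roots exist exactly when some \<open>Suc j\<close> of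
  them can be listed. Hence the complement of \<open>U d j\<close> is a closed projection.\<close>

lemma P_diff_U: "P d - U d j = fst ` incidence d (Suc j)"
proof (intro equalityI subsetI)
  fix a assume "a \<in> P d - U d j"
  then have a: "a \<in> P d" "Suc j \<le> size (roots d a)" by (auto simp: U_def)
  \<comment> \<open>Any \<open>Suc j\<close> of the common roots would do; the smallest ones are
    taken.\<close>
  define M where "M = mset (take (Suc j) (sorted_list_of_multiset (roots d a)))"
  have l: "length (sorted_list_of_multiset (roots d a)) = size (roots d a)"
    by (metis mset_sorted_list_of_multiset size_mset)
  have "size M = Suc j" using a l by (simp add: M_def)
  moreover have "M \<subseteq># roots d a" unfolding M_def 
    by (metis append_take_drop_id mset_append mset_sorted_list_of_multiset mset_subset_eq_add_left)
  ultimately obtain x where "x \<in> V (Suc j)" "sorted (map x [0..<Suc j])" "root_mset (Suc j) x \<subseteq># roots d a"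
    using sorted_root_exists[of M] by metis
  then have "(a,x) \<in> incidence d (Suc j)" using a by (simp add: incidence_def rem_eq_0_iff)
  then show "a \<in> fst ` incidence d (Suc j)" by force
next
  fix a assume "a \<in> fst ` incidence d (Suc j)"
  then obtain x where x: "(a,x) \<in> incidence d (Suc j)" by auto
  then have "size (root_mset (Suc j) x) \<le> size (roots d a)" by (intro size_mset_mono incidence_roots)
  then show "a \<in> P d - U d j" using x by (auto simp: U_def incidence_def)
qed

lemma openin_U: "openin (top_of_set (P d)) (U d j)"
proof -
  have "closedin (top_of_set (P d)) (P d - U d j)"
    unfolding P_diff_U by (rule closedin_fst_incidence[OF closedin_incidence subset_refl])
  then show ?thesis using U_subset_P[of d j] by (simp add: openin_closedin_eq)
qed

lemma openin_U_U: "i \<le> j \<Longrightarrow> openin (top_of_set (U d j)) (U d i)"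
  using openin_U[of d i] U_mono[of i j d] U_subset_P by (metis openin_subset_trans)

section \<open>Strata with a fixed number of common roots and their root vectors\<close>

definition stratum :: "nat \<Rightarrow> nat \<Rightarrow> (nat \<Rightarrow> nat \<Rightarrow> complex) set" where
  "stratum d j = {a \<in> P d. size (roots d a) = j}"

text \<open>Depends on \<open>a\<close> only through \<open>roots d a\<close>, so stabilization
  leaves it literally unchanged.\<close>

definition sroot :: "nat \<Rightarrow> nat \<Rightarrow> (nat \<Rightarrow> nat \<Rightarrow> complex) \<Rightarrow> nat \<Rightarrow> real" where
  "sroot d j a = (SOME x. x \<in> V j \<and> sorted (map x [0..<j]) \<and> root_mset j x = roots d a)"

lemma sroot:
  assumes "a \<in> stratum d j"
  shows "sroot d j a \<in> V j" "sorted (map (sroot d j a) [0..<j])" "root_mset j (sroot d j a) = roots d a"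
proof -
  have "\<exists>x. x \<in> V j \<and> sorted (map x [0..<j]) \<and> root_mset j x = roots d a"
    using sorted_root_exists[of "roots d a"] assms by (auto simp: stratum_def)
  from someI_ex[OF this] show "sroot d j a \<in> V j" "sorted (map (sroot d j a) [0..<j])" "root_mset j (sroot d j a) = roots d a"
    by (auto simp: sroot_def)
qed

text \<open>A listing of \<open>j\<close> common roots of a tuple that has exactly \<open>j\<close>
  must exhaust them, since a proper submultiset is smaller.\<close>

lemma incidence_stratum_iff:
  assumes a: "a \<in> stratum d j"
  shows "(a,x) \<in> incidence d j \<longleftrightarrow> x = sroot d j a"
proof
  assume i: "(a,x) \<in> incidence d j"
  have "root_mset j x = roots d a"
  proof (rule ccontr)
    assume "root_mset j x \<noteq> roots d a"
    then have "root_mset j x \<subset># roots d a" using incidence_roots[OF i] by simp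
    from mset_subset_size[OF this] show False using a by (simp add: stratum_def)
  qed
  then show "x = sroot d j a" using i sroot[OF a] by (intro sorted_root_unique) (auto simp: incidence_def)
next
  assume "x = sroot d j a"
  then show "(a,x) \<in> incidence d j" using sroot[OF a] a by (simp add: incidence_def rem_eq_0_iff stratum_def)
qed

lemma incidence_U_iff:
  assumes a: "a \<in> U d j"
  shows "(a,x) \<in> incidence d j \<longleftrightarrow> a \<in> stratum d j \<and> x = sroot d j a"
proof -
  have "a \<in> stratum d j" if i: "(a,x) \<in> incidence d j"
    using size_mset_mono[OF incidence_roots[OF i]] a by (auto simp: U_def stratum_def)
  then show ?thesis using incidence_stratum_iff by blast
qed

text \<open>Over the stratum \<open>incidence d j\<close> is the graph of \<open>sroot d j\<close>.
  The preimage of a closed \<open>T\<close> is therefore the projection of a closed part of the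
  incidence set, which is closed by \<open>closedin_fst_incidence\<close>.\<close>

lemma continuous_on_sroot: "continuous_on (stratum d j) (sroot d j)"
  unfolding continuous_closedin_preimage_eq
proof (intro allI impI)
  fix T :: "(nat \<Rightarrow> real) set" assume T: "closed T"
  have "closedin (top_of_set (P d \<times> V j)) (incidence d j \<inter> ((P d \<times> V j) \<inter> snd -` T))"
    by (intro closedin_Int closedin_incidence continuous_closedin_preimage T continuous_on_snd continuous_on_id)
  then have "closedin (top_of_set (P d)) (fst ` (incidence d j \<inter> ((P d \<times> V j) \<inter> snd -` T)))"
    by (rule closedin_fst_incidence) auto
  then have "closedin (top_of_set (stratum d j)) (stratum d j \<inter> fst ` (incidence d j \<inter> ((P d \<times> V j) \<inter> snd -` T)))"
    by (rule closedin_restrict) (auto simp: stratum_def)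
  also have "stratum d j \<inter> fst ` (incidence d j \<inter> ((P d \<times> V j) \<inter> snd -` T)) = stratum d j \<inter> sroot d j -` T"
  proof (intro equalityI subsetI)
    fix a assume "a \<in> stratum d j \<inter> fst ` (incidence d j \<inter> ((P d \<times> V j) \<inter> snd -` T))"
    then show "a \<in> stratum d j \<inter> sroot d j -` T" using incidence_stratum_iff by auto
  next
    fix a assume a: "a \<in> stratum d j \<inter> sroot d j -` T"
    then have "(a, sroot d j a) \<in> incidence d j" using incidence_stratum_iff by blast
    moreover have "(a, sroot d j a) \<in> P d \<times> V j" using a sroot(1) by (auto simp: stratum_def)
    ultimately show "a \<in> stratum d j \<inter> fst ` (incidence d j \<inter> ((P d \<times> V j) \<inter> snd -` T))"
      using a by (intro IntI image_eqI[of _ _ "(a, sroot d j a)"]) auto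
  qed
  finally show "closedin (top_of_set (stratum d j)) (stratum d j \<inter> sroot d j -` T)" .
qed

lemma U_diff_U: "1 \<le> j \<Longrightarrow> U d j - U d (j - 1) = stratum d j"
  by (auto simp: U_def stratum_def)

lemma closedin_stratum: "closedin (top_of_set (U d j)) (stratum d j)"
proof (cases "j = 0")
  case True
  then have "stratum d j = U d j" by (auto simp: U_def stratum_def)
  then show ?thesis using closedin_topspace[of "top_of_set (U d j)"] by simp
next
  case False
  then have "stratum d j = U d j - U d (j - 1)" using U_diff_U by simp
  then show ?thesis using openin_U_U[of "j - 1" j d] by (simp add: closedin_diff)
qed

text \<open>Tietze's theorem in each coordinate \<open>l < j\<close>, applied on the closed stratum.
  Away from the stratum the values of \<phi> have no relation to roots and need not be
  sorted.\<close>

lemma sroot_extension: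
  obtains \<phi> where "continuous_on (U d j) \<phi>" "\<And>a. a \<in> stratum d j \<Longrightarrow> \<phi> a = sroot d j a" "\<And>a. a \<in> U d j \<Longrightarrow> \<phi> a \<in> V j"
proof -
  have "\<exists>f. continuous_on (U d j) f \<and> (\<forall>a\<in>stratum d j. f a = sroot d j a l)" for l
    by (rule Tietze_unbounded[OF continuous_on_coord[OF continuous_on_sroot] closedin_stratum]) blast
  then obtain f where f: "\<And>l. continuous_on (U d j) (f l)" "\<And>l a. a \<in> stratum d j \<Longrightarrow> f l a = sroot d j a l"
    by metis
  define \<phi> where "\<phi> a l = (if l < j then f l a else 0)" for a l
  show thesis
  proof (rule that[of \<phi>])
    show "continuous_on (U d j) \<phi>"
    proof (rule continuous_on_coordinatewise_then_product)
      show "continuous_on (U d j) (\<lambda>a. \<phi> a l)" for l using f(1) by (cases "l < j") (auto simp: \<phi>_def)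
    qed
    show "\<phi> a = sroot d j a" if "a \<in> stratum d j" for a
      using f(2)[OF that] sroot(1)[OF that] by (auto simp: \<phi>_def fun_eq_iff coord_space_def)
    show "\<phi> a \<in> V j" for a by (auto simp: \<phi>_def coord_space_def)
  qed
qed

end

section \<open>The filtration by the number of common roots\<close>

context tuples
begin

text \<open>Written through the closed set \<open>incidence d j\<close>; by \<open>graph_iff\<close>
  it is the graph of \<open>sroot d j\<close> over the stratum.\<close>

definition graph :: "nat \<Rightarrow> nat \<Rightarrow> ((nat \<Rightarrow> nat \<Rightarrow> complex) \<times> (nat \<Rightarrow> real)) set" where
  "graph d j = incidence d j \<inter> (U d j \<times> V j)"

definition shear :: "((nat \<Rightarrow> nat \<Rightarrow> complex) \<Rightarrow> nat \<Rightarrow> real) \<Rightarrow> (nat \<Rightarrow> nat \<Rightarrow> complex) \<times> (nat \<Rightarrow> real) \<Rightarrow> (nat \<Rightarrow> nat \<Rightarrow> complex) \<times> (nat \<Rightarrow> real)" where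
  "shear \<phi> = (\<lambda>(a,v). (a, \<lambda>l. v l + \<phi> a l))"

lemma closedin_graph: "closedin (top_of_set (U d j \<times> V j)) (graph d j)"
  unfolding graph_def Int_commute[of "incidence d j"]
  by (rule closedin_restrict[OF closedin_incidence]) (use U_subset_P in auto)

lemma graph_iff: "(a,x) \<in> graph d j \<longleftrightarrow> a \<in> stratum d j \<and> x = sroot d j a"
proof
  assume "(a,x) \<in> graph d j"
  then show "a \<in> stratum d j \<and> x = sroot d j a" using incidence_U_iff by (auto simp: graph_def)
next
  assume *: "a \<in> stratum d j \<and> x = sroot d j a"
  then have "a \<in> U d j" by (auto simp: stratum_def U_def)
  with * show "(a,x) \<in> graph d j" using incidence_stratum_iff sroot(1) by (auto simp: graph_def)
qed

lemma continuous_on_shear: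
  assumes "continuous_on A \<phi>"
  shows "continuous_on (A \<times> B) (shear \<phi>)"
  unfolding shear_def case_prod_beta
proof (intro continuous_on_Pair continuous_on_fst continuous_on_id continuous_on_coordinatewise_then_product)
  have c: "continuous_on (A \<times> B) (\<lambda>p. \<phi> (fst p))"
    by (rule continuous_on_compose2[OF assms]) (auto intro: continuous_on_fst)
  show "continuous_on (A \<times> B) (\<lambda>p. snd p l + \<phi> (fst p) l)" for l
    by (intro continuous_on_add continuous_on_coord[OF c] continuous_on_coord[OF continuous_on_snd[OF continuous_on_id]])
qed

lemma msusp_U_eq:
  assumes j: "1 \<le> j"
  shows "msusp (U d j) (U d (j - 1)) {..<j} = {(a,v). a \<in> U d j \<and> v \<in> V j \<and> (a \<in> stratum d j \<longrightarrow> v \<noteq> (\<lambda>_. 0))}"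
  using U_diff_U[OF j, of d] U_mono[of "j - 1" j d] by (auto simp: msusp_def)

text \<open>On the stratum \<phi> is the root vector, so the shear carries the stratum at height
  zero onto \<open>graph d j\<close>. Shearing by the negative of \<phi> is the inverse.\<close>

lemma shear_pair_map:
  assumes j: "1 \<le> j" and \<phi>: "continuous_on (U d j) \<phi>" "\<And>a. a \<in> stratum d j \<Longrightarrow> \<phi> a = sroot d j a"
    "\<And>a. a \<in> U d j \<Longrightarrow> \<phi> a \<in> V j"
  shows "pair_map (U d j \<times> V j) (msusp (U d j) (U d (j - 1)) {..<j}) (U d j \<times> V j) (U d j \<times> V j - graph d j) (shear \<phi>)"
    and "hiso k (U d j \<times> V j) (msusp (U d j) (U d (j - 1)) {..<j}) (U d j \<times> V j) (U d j \<times> V j - graph d j) (shear \<phi>)"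
proof -
  have V: "(\<lambda>l. v l + \<phi> a l) \<in> V j" "(\<lambda>l. v l - \<phi> a l) \<in> V j" if "a \<in> U d j" "v \<in> V j" for a v
    using that \<phi>(3) by (auto simp: coord_space_def)
  show p: "pair_map (U d j \<times> V j) (msusp (U d j) (U d (j - 1)) {..<j}) (U d j \<times> V j) (U d j \<times> V j - graph d j) (shear \<phi>)"
    unfolding pair_map_def
  proof (intro conjI)
    show "shear \<phi> ` msusp (U d j) (U d (j - 1)) {..<j} \<subseteq> U d j \<times> V j - graph d j"
    proof (rule image_subsetI)
      fix p assume "p \<in> msusp (U d j) (U d (j - 1)) {..<j}"
      then obtain a v where p: "p = (a,v)" "a \<in> U d j" "v \<in> V j" "a \<in> stratum d j \<Longrightarrow> v \<noteq> (\<lambda>_. 0)"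
        unfolding msusp_U_eq[OF j] by auto
      have "v = (\<lambda>_. 0)" if "a \<in> stratum d j" "(\<lambda>l. v l + \<phi> a l) = sroot d j a"
        using fun_cong[OF that(2)] \<phi>(2)[OF that(1)] by auto
      then have "(a, \<lambda>l. v l + \<phi> a l) \<notin> graph d j" using p(4) graph_iff by blast
      then show "shear \<phi> p \<in> U d j \<times> V j - graph d j" using p V by (simp add: shear_def)
    qed
  qed (auto simp: shear_def V msusp_def intro!: continuous_on_shear[OF \<phi>(1), unfolded shear_def])
  define g where "g = shear (\<lambda>a l. - \<phi> a l)"
  have p': "pair_map (U d j \<times> V j) (U d j \<times> V j - graph d j) (U d j \<times> V j) (msusp (U d j) (U d (j - 1)) {..<j}) g"
    unfolding pair_map_def
  proof (intro conjI)
    show "continuous_on (U d j \<times> V j) g" unfolding g_def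
      by (intro continuous_on_shear continuous_on_coordinatewise_then_product continuous_on_minus continuous_on_coord[OF \<phi>(1)])
    show "g ` (U d j \<times> V j - graph d j) \<subseteq> msusp (U d j) (U d (j - 1)) {..<j}"
    proof (rule image_subsetI)
      fix p assume "p \<in> U d j \<times> V j - graph d j"
      then obtain a v where p: "p = (a,v)" "a \<in> U d j" "v \<in> V j" "(a,v) \<notin> graph d j" by auto
      have "v = sroot d j a" if "a \<in> stratum d j" "(\<lambda>l. v l - \<phi> a l) = (\<lambda>_. 0)"
        using fun_cong[OF that(2)] \<phi>(2)[OF that(1)] by auto
      then show "g p \<in> msusp (U d j) (U d (j - 1)) {..<j}"
        unfolding msusp_U_eq[OF j] using p V graph_iff by (auto simp: g_def shear_def)
    qed
  qed (auto simp: g_def shear_def V msusp_def)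
  show "hiso k (U d j \<times> V j) (msusp (U d j) (U d (j - 1)) {..<j}) (U d j \<times> V j) (U d j \<times> V j - graph d j) (shear \<phi>)"
    by (rule hiso_homeo[OF p p']) (auto simp: g_def shear_def)
qed

section \<open>Coordinates by root vector, quotient and remainder near the graph\<close>

text \<open>In the coordinates \<open>x\<close>, \<open>quo d j x a\<close>,
  \<open>rem d j x a\<close> this is a product for \<open>j * n \<le> d\<close>: the root vector is
  any element of \<open>V j\<close>, sorted or not, the quotient lies in
  \<open>U (d - j * n) 0\<close>, and the remainder is free.\<close>

definition chart :: "nat \<Rightarrow> nat \<Rightarrow> ((nat \<Rightarrow> nat \<Rightarrow> complex) \<times> (nat \<Rightarrow> real)) set" where
  "chart d j = {(a,x). a \<in> P d \<and> x \<in> V j \<and> quo d j x a \<in> U (d - j * n) 0}"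

lemma openin_chart: "openin (top_of_set (P d \<times> V j)) (chart d j)"
proof -
  have "openin (top_of_set (P d \<times> V j)) ((P d \<times> V j) \<inter> (\<lambda>p. quo d j (snd p) (fst p)) -` U (d - j * n) 0)"
    by (rule continuous_openin_preimage[OF _ _ openin_U])
      (auto intro!: continuous_on_quo continuous_on_fst continuous_on_snd continuous_on_id quo_in_P)
  also have "(P d \<times> V j) \<inter> (\<lambda>p. quo d j (snd p) (fst p)) -` U (d - j * n) 0 = chart d j"
    by (auto simp: chart_def)
  finally show ?thesis .
qed

text \<open>If the remainder vanishes, the common roots of \<open>a\<close> are the entries of
  \<open>x\<close> together with those of the quotient. So there are at most \<open>j\<close>
  exactly when the quotient has none.\<close>

lemma graph_eq_chart:
  assumes "j * n \<le> d"
  shows "graph d j = incidence d j \<inter> chart d j"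
proof -
  have "a \<in> U d j \<longleftrightarrow> quo d j x a \<in> U (d - j * n) 0" if i: "(a,x) \<in> incidence d j" for a x
  proof -
    have a: "a \<in> P d" "rem d j x a = (\<lambda>_ _. 0)" using i by (auto simp: incidence_def)
    have "asm d j x (quo d j x a) (\<lambda>_ _. 0) = a" using asm_quo_rem[OF assms a(1), of x] a(2) by simp
    then have "roots d a = root_mset j x + roots (d - j * n) (quo d j x a)"
      using roots_asm_0[OF assms] by metis
    then show ?thesis using a quo_in_P by (simp add: U_def)
  qed
  then show ?thesis by (auto simp: graph_def chart_def incidence_def)
qed

lemma closedin_graph_chart: 
  assumes "j * n \<le> d" shows "closedin (top_of_set (chart d j)) (graph d j)"
  unfolding graph_eq_chart[OF assms] Int_commute[of "incidence d j"]
  by (rule closedin_restrict[OF closedin_incidence]) (auto simp: chart_def)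

text \<open>The graph is closed both in the chart and in \<open>U d j \<times> V j\<close>. Excising
  down to a common open neighbourhood \<open>N\<close> makes it possible to replace one by the
  other.\<close>

lemma hiso_graph_chart:
  assumes jn: "j * n \<le> d"
    and N: "openin (top_of_set (P d \<times> V j)) N" "graph d j \<subseteq> N" 
  shows "N \<subseteq> chart d j \<Longrightarrow> hiso k N (N - graph d j) (chart d j) (chart d j - graph d j) (\<lambda>p. p)"
    and "N \<subseteq> U d j \<times> V j \<Longrightarrow> hiso k N (N - graph d j) (U d j \<times> V j) (U d j \<times> V j - graph d j) (\<lambda>p. p)"
proof -
  show "hiso k N (N - graph d j) (chart d j) (chart d j - graph d j) (\<lambda>p. p)" if "N \<subseteq> chart d j"
    by (rule hiso_excision[OF closedin_graph_chart[OF jn] openin_subset_trans[OF N(1) that] N(2)])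
      (auto simp: chart_def)
  show "hiso k N (N - graph d j) (U d j \<times> V j) (U d j \<times> V j - graph d j) (\<lambda>p. p)" if "N \<subseteq> U d j \<times> V j"
    by (rule hiso_excision[OF closedin_graph openin_subset_trans[OF N(1) that] N(2)])
      (use U_subset_P in auto)
qed

lemma openin_U_times_V: "openin (top_of_set (P d \<times> V j)) (U d j \<times> V j)"
  by (intro openin_Times openin_U) simp

text \<open>Moves the root vector towards \<open>w\<close> while quotient and remainder stay fixed.\<close>

definition slide :: "nat \<Rightarrow> nat \<Rightarrow> (nat \<Rightarrow> real) \<Rightarrow> real \<Rightarrow> (nat \<Rightarrow> nat \<Rightarrow> complex) \<times> (nat \<Rightarrow> real) \<Rightarrow> (nat \<Rightarrow> nat \<Rightarrow> complex) \<times> (nat \<Rightarrow> real)" where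
  "slide d j w t = (\<lambda>(a,x). let y = (\<lambda>l. (1 - t) * x l + t * w l) in (asm d j y (quo d j x a) (rem d j x a), y))"

lemma continuous_on_slide: "continuous_on (T \<times> A) (\<lambda>(t,p). slide d j w t p)"
proof -
  have x: "continuous_on (T \<times> A) (\<lambda>p. snd (snd p))" and a: "continuous_on (T \<times> A) (\<lambda>p. fst (snd p))"
    by (intro continuous_on_fst continuous_on_snd continuous_on_id)+
  have y: "continuous_on (T \<times> A) (\<lambda>p l. (1 - fst p) * snd (snd p) l + fst p * w l)"
    by (intro continuous_on_coordinatewise_then_product continuous_on_add continuous_on_mult continuous_on_diff
      continuous_on_const continuous_on_fst continuous_on_id continuous_on_coord[OF x])
  show ?thesis
    unfolding slide_def case_prod_beta Let_def
    by (intro continuous_on_Pair continuous_on_asm continuous_on_quo continuous_on_rem x a y)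
qed

lemma slide_in_chart:
  assumes "j * n \<le> d" "w \<in> V j" "p \<in> chart d j"
  shows "slide d j w t p \<in> chart d j"
    and "quo d j (snd (slide d j w t p)) (fst (slide d j w t p)) = quo d j (snd p) (fst p)"
    and "rem d j (snd (slide d j w t p)) (fst (slide d j w t p)) = rem d j (snd p) (fst p)"
proof -
  obtain a x where p: "p = (a,x)" by (cases p)
  define y where "y = (\<lambda>l. (1 - t) * x l + t * w l)"
  have s: "slide d j w t p = (asm d j y (quo d j x a) (rem d j x a), y)" by (simp add: slide_def p y_def Let_def)
  have a: "a \<in> P d" "x \<in> V j" "quo d j x a \<in> U (d - j * n) 0" using assms p by (auto simp: chart_def)
  have q: "quo d j x a \<in> P (d - j * n)" and r: "rem d j x a \<in> P (j * n)"
    using a quo_in_P rem_in_P by blast+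
  note * = quo_asm[OF assms(1) q r] rem_asm[OF assms(1) q r] asm_in_P[OF q r]
  show "slide d j w t p \<in> chart d j" using a assms(2) unfolding s by (simp add: chart_def * y_def) (simp add: coord_space_def)
  show "quo d j (snd (slide d j w t p)) (fst (slide d j w t p)) = quo d j (snd p) (fst p)"
    "rem d j (snd (slide d j w t p)) (fst (slide d j w t p)) = rem d j (snd p) (fst p)"
    unfolding s by (simp_all add: p *)
qed

lemma slide_0:
  assumes "j * n \<le> d" "p \<in> chart d j"
  shows "slide d j w 0 p = p"
  using assms by (auto simp: slide_def chart_def asm_quo_rem)

text \<open>Sliding \<open>x\<close> to a strictly decreasing \<open>w\<close>, with quotient and
  remainder fixed, never makes an unsorted vector sorted and ends at an unsorted one. Thus the chart
  is pushed off the graph.\<close>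

lemma hzero_chart:
  assumes j: "2 \<le> j" and jn: "j * n \<le> d"
  shows "hzero k (chart d j) (chart d j - graph d j)"
proof -
  \<comment> \<open>For \<open>j \<ge> 2\<close> the entries 0 and -1 at the first two indices
    already violate sortedness.\<close>
  define w where "w l = (if l < j then - real l else 0)" for l
  have w: "w \<in> V j" by (simp add: w_def coord_space_def)
  have g: "p \<in> graph d j \<longleftrightarrow> sorted (map (snd p) [0..<j]) \<and> rem d j (snd p) (fst p) = (\<lambda>_ _. 0)" if "p \<in> chart d j" for p
    using that by (auto simp: graph_eq_chart[OF jn] incidence_def chart_def)
  have snd_slide: "snd (slide d j w t p) = (\<lambda>l. (1 - t) * snd p l + t * w l)" for t p
    by (cases p) (simp add: slide_def Let_def)
  show ?thesis
  proof (rule hzero_push_off[where h="slide d j w"])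
    show "continuous_on ({0..1} \<times> chart d j) (\<lambda>(t, p). slide d j w t p)" by (rule continuous_on_slide)
    show "slide d j w t p \<in> chart d j" if "p \<in> chart d j" for t p using slide_in_chart(1)[OF jn w that] .
    show "slide d j w 0 p = p" if "p \<in> chart d j" for p using slide_0[OF jn that] .
    show "slide d j w 1 p \<in> chart d j - graph d j" if p: "p \<in> chart d j" for p
    proof -
      have "\<not> sorted (map (snd (slide d j w 1 p)) [0..<j])"
      proof
        assume "sorted (map (snd (slide d j w 1 p)) [0..<j])"
        then have "w 0 \<le> w 1" unfolding sorted_map_iff snd_slide using j by fastforce
        then show False using j by (simp add: w_def)
      qed
      then show ?thesis using slide_in_chart(1)[OF jn w p] g by blast
    qed
    show "slide d j w t p \<in> chart d j - graph d j" if t: "t \<in> {0..1}" and p: "p \<in> chart d j - graph d j" for t p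
    proof (cases "t = 1")
      case False
      have pc: "p \<in> chart d j" using p by simp
      have "slide d j w t p \<notin> graph d j"
      proof
        assume "slide d j w t p \<in> graph d j"
        then have s: "sorted (map (snd (slide d j w t p)) [0..<j])" and r: "rem d j (snd p) (fst p) = (\<lambda>_ _. 0)"
          using g[OF slide_in_chart(1)[OF jn w pc]] slide_in_chart(3)[OF jn w pc] by auto
        have "snd p a \<le> snd p b" if ab: "a \<le> b" "b < j" for a b
        proof -
          have "(1 - t) * snd p a + t * w a \<le> (1 - t) * snd p b + t * w b"
            using s ab unfolding sorted_map_iff snd_slide by blast
          \<comment> \<open>As \<open>w\<close> decreases, removing its contribution from a sorted
            vector leaves a sorted one, and \<open>1 - t > 0\<close> can be cancelled.\<close>
          moreover have "t * w b \<le> t * w a" using t ab by (intro mult_left_mono) (auto simp: w_def)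
          ultimately have "(1 - t) * snd p a \<le> (1 - t) * snd p b" by linarith
          then show ?thesis using t False by (simp add: mult_le_cancel_left)
        qed
        then have "p \<in> graph d j" using g[OF pc] r by (simp add: sorted_map_iff)
        then show False using p by simp
      qed
      then show ?thesis using slide_in_chart(1)[OF jn w pc] by blast
    next
      case True
      have pc: "p \<in> chart d j" using p by simp
      have "\<not> sorted (map (snd (slide d j w 1 p)) [0..<j])"
      proof
        assume "sorted (map (snd (slide d j w 1 p)) [0..<j])"
        then have "w 0 \<le> w 1" unfolding sorted_map_iff snd_slide using j by fastforce
        then show False using j by (simp add: w_def)
      qed
      then show ?thesis using slide_in_chart(1)[OF jn w pc] g True by blast
    qed
  qed auto
qed

text \<open>Suspend by \<open>j\<close> coordinates, shear the stratum onto the graph, then pass to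
  the chart by two excisions.\<close>

lemma hzero_U_iff_chart:
  assumes j: "1 \<le> j" and jn: "j * n \<le> d"
  shows "hzero k (U d j) (U d (j - 1)) \<longleftrightarrow> hzero (k + int j) (chart d j) (chart d j - graph d j)"
proof -
  obtain \<phi> where \<phi>: "continuous_on (U d j) \<phi>" "\<And>a. a \<in> stratum d j \<Longrightarrow> \<phi> a = sroot d j a"
    "\<And>a. a \<in> U d j \<Longrightarrow> \<phi> a \<in> V j" by (rule sroot_extension[of d j]) (rule that)
  let ?N = "chart d j \<inter> (U d j \<times> V j)" and ?k = "k + int (card {..<j})"
  have N: "openin (top_of_set (P d \<times> V j)) ?N" by (intro openin_Int openin_chart openin_U_times_V)
  have gN: "graph d j \<subseteq> ?N" using graph_eq_chart[OF jn] by (auto simp: graph_def)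
  have "hzero k (U d j) (U d (j - 1)) \<longleftrightarrow> hzero ?k (U d j \<times> V j) (msusp (U d j) (U d (j - 1)) {..<j})"
    by (rule hzero_msusp[symmetric]) (auto intro: openin_U_U)
  also have "\<dots> \<longleftrightarrow> hzero ?k (U d j \<times> V j) (U d j \<times> V j - graph d j)"
    by (rule hiso_hzero[OF shear_pair_map(2)[OF j \<phi>]])
  also have "\<dots> \<longleftrightarrow> hzero ?k ?N (?N - graph d j)"
    by (rule hiso_hzero[OF hiso_graph_chart(2)[OF jn N gN], symmetric]) simp
  also have "\<dots> \<longleftrightarrow> hzero ?k (chart d j) (chart d j - graph d j)"
    by (rule hiso_hzero[OF hiso_graph_chart(1)[OF jn N gN]]) simp
  finally show ?thesis by simp
qed

lemma hzero_step:
  assumes j: "2 \<le> j" shows "hzero k (U d j) (U d (j - 1))"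
proof (cases "j * n \<le> d")
  case False
  \<comment> \<open>Here \<open>d < j * n\<close>, so no tuple has \<open>j\<close> common
    roots.\<close>
  then have "U d j = P d" "U d (j - 1) = P d" using j n by (auto intro!: U_eq_P)
  then show ?thesis by (simp add: hzero_same)
next
  case True
  have "1 \<le> j" using j by simp
  then show ?thesis using hzero_U_iff_chart[OF _ True] hzero_chart[OF j True] by blast
qed

text \<open>Climb through the filtration from \<open>U d 1\<close>, each step having no relative
  homology. By \<open>n \<ge> 1\<close> it has reached \<open>P d\<close> at index
  \<open>Suc d\<close>.\<close>

lemma hzero_P_U1: "hzero k (P d) (U d 1)"
proof -
  have "hzero k (U d (Suc j)) (U d 1)" for j
  proof (induction j)
    case (Suc j)
    show ?case
      by (rule hzero_triple[OF U_mono U_mono _ Suc]) (use hzero_step[of "Suc (Suc j)" k d] in auto)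
  qed (simp add: hzero_same)
  moreover have "U d (Suc d) = P d"
  proof (rule U_eq_P)
    have "d < (Suc d + 1) * 1" by simp
    also have "\<dots> \<le> (Suc d + 1) * n" using n by (rule mult_le_mono2)
    finally show "d < (Suc d + 1) * n" .
  qed
  ultimately show ?thesis by metis
qed

end

section \<open>Naturality with respect to stabilization\<close>

context tuples
begin

text \<open>Polymorphic because the second component is a root vector over the graph but a remainder
  in \<open>fib\<close>.\<close>

definition stab_fst :: "nat \<Rightarrow> (nat \<Rightarrow> nat \<Rightarrow> complex) \<times> 'b \<Rightarrow> (nat \<Rightarrow> nat \<Rightarrow> complex) \<times> 'b" where
  "stab_fst d = (\<lambda>(a,v). (stab d m a, v))"

lemma continuous_on_stab_fst: "continuous_on A (stab_fst d)"
  unfolding stab_fst_def case_prod_beta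
  by (intro continuous_on_Pair continuous_on_stab continuous_on_fst continuous_on_snd continuous_on_id)

lemma stab_stratum_iff: "a \<in> P d \<Longrightarrow> stab d m a \<in> stratum (d + 1) j \<longleftrightarrow> a \<in> stratum d j"
  using stab_in_P[of a d] roots_stab[of d a] by (simp add: stratum_def)

lemma sroot_stab: "sroot (d + 1) j (stab d m a) = sroot d j a"
  unfolding sroot_def roots_stab ..

lemma graph_stab_iff: "a \<in> P d \<Longrightarrow> (stab d m a, x) \<in> graph (d + 1) j \<longleftrightarrow> (a,x) \<in> graph d j"
  by (simp only: graph_iff stab_stratum_iff sroot_stab)

lemma pair_map_stab: "i \<le> j \<Longrightarrow> pair_map (U d j) (U d i) (U (d + 1) j) (U (d + 1) i) (stab d m)"
  unfolding pair_map_def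
proof (intro conjI U_mono)
  show "continuous_on (U d j) (stab d m)" using continuous_on_stab[OF continuous_on_id] by auto
  have *: "stab d m ` U d l \<subseteq> U (d + 1) l" for l using stab_in_U by blast
  show "stab d m ` U d j \<subseteq> U (d + 1) j" "stab d m ` U d i \<subseteq> U (d + 1) i" by (fact *)+
qed

lemma pair_map_stab_graph:
  "pair_map (U d j \<times> V j) (U d j \<times> V j - graph d j) (U (d + 1) j \<times> V j) (U (d + 1) j \<times> V j - graph (d + 1) j) (stab_fst d)"
  unfolding pair_map_def
proof (intro conjI continuous_on_stab_fst)
  have 1: "stab_fst d (a,x) \<in> U (d + 1) j \<times> V j" if "(a,x) \<in> U d j \<times> V j" for a x
    using that stab_in_U[of a d j] by (auto simp: stab_fst_def)
  have 2: "stab_fst d (a,x) \<notin> graph (d + 1) j" if "(a,x) \<in> U d j \<times> V j" "(a,x) \<notin> graph d j" for a x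
  proof -
    have "a \<in> P d" using that U_subset_P by blast
    from graph_stab_iff[OF this, of x j] show ?thesis using that(2) by (simp only: stab_fst_def prod.case) simp
  qed
  show "stab_fst d ` (U d j \<times> V j) \<subseteq> U (d + 1) j \<times> V j" using 1 by blast
  show "stab_fst d ` (U d j \<times> V j - graph d j) \<subseteq> U (d + 1) j \<times> V j - graph (d + 1) j" using 1 2 by blast
qed auto

text \<open>Extensions of the root vector are chosen independently in degrees \<open>d\<close> and
  \<open>d + 1\<close>, so the square of shears and stabilizations commutes only up to
  homotopy.\<close>

lemma hiso_stab_graph:
  assumes j: "1 \<le> j"
  shows "hiso (k + int j) (U d j \<times> V j) (U d j \<times> V j - graph d j)
      (U (d + 1) j \<times> V j) (U (d + 1) j \<times> V j - graph (d + 1) j) (stab_fst d)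
    \<longleftrightarrow> hiso k (U d j) (U d (j - 1)) (U (d + 1) j) (U (d + 1) (j - 1)) (stab d m)"
proof -
  obtain \<phi> where \<phi>: "continuous_on (U d j) \<phi>" "\<And>a. a \<in> stratum d j \<Longrightarrow> \<phi> a = sroot d j a"
    "\<And>a. a \<in> U d j \<Longrightarrow> \<phi> a \<in> V j" by (rule sroot_extension[of d j]) (rule that)
  obtain \<psi> where \<psi>: "continuous_on (U (d + 1) j) \<psi>" "\<And>a. a \<in> stratum (d + 1) j \<Longrightarrow> \<psi> a = sroot (d + 1) j a"
    "\<And>a. a \<in> U (d + 1) j \<Longrightarrow> \<psi> a \<in> V j" by (rule sroot_extension[of "d + 1" j]) (rule that)
  let ?S = "msusp (U d j) (U d (j - 1)) {..<j}" and ?S' = "msusp (U (d + 1) j) (U (d + 1) (j - 1)) {..<j}"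
  let ?X = "U d j \<times> V j" and ?X' = "U (d + 1) j \<times> V j"
  have pm: "pair_map ?X ?S ?X' ?S' (stab_fst d)"
    unfolding stab_fst_def by (rule pair_map_msusp[OF pair_map_stab]) simp
  have hom: "hind k ?X ?S ?X' (?X' - graph (d + 1) j) (stab_fst d \<circ> shear \<phi>) =
    hind k ?X ?S ?X' (?X' - graph (d + 1) j) (shear \<psi> \<circ> stab_fst d)" for k
  proof -
    \<comment> \<open>The straight line between the two extensions is constant on the stratum, where
      both are the root vector; so it meets the graph only where \<open>v\<close> is zero.\<close>
    define h where "h t = (\<lambda>(a,v). (stab d m a, \<lambda>l. v l + ((1 - t) * \<phi> a l + t * \<psi> (stab d m a) l)))" for t :: real
    have "hind k ?X ?S ?X' (?X' - graph (d + 1) j) (h 0) = hind k ?X ?S ?X' (?X' - graph (d + 1) j) (h 1)"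
    proof (rule hind_homotopic)
      have a: "continuous_on ({0..1} \<times> ?X) (\<lambda>p. fst (snd p))" and v: "continuous_on ({0..1} \<times> ?X) (\<lambda>p. snd (snd p))"
        by (intro continuous_on_fst continuous_on_snd continuous_on_id)+
      have f: "continuous_on ({0..1} \<times> ?X) (\<lambda>p. \<phi> (fst (snd p)))"
        by (rule continuous_on_compose2[OF \<phi>(1) a]) auto
      have g: "continuous_on ({0..1} \<times> ?X) (\<lambda>p. \<psi> (stab d m (fst (snd p))))"
        by (rule continuous_on_compose2[OF \<psi>(1) continuous_on_stab[OF a]]) (use stab_in_U in auto)
      show "continuous_on ({0..1} \<times> ?X) (\<lambda>(t,p). h t p)"
        unfolding h_def case_prod_beta
        by (intro continuous_on_Pair continuous_on_stab[OF a] continuous_on_coordinatewise_then_product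
            continuous_on_add continuous_on_mult continuous_on_diff continuous_on_const continuous_on_fst continuous_on_id
            continuous_on_coord[OF v] continuous_on_coord[OF f] continuous_on_coord[OF g])
      show hX: "h t p \<in> ?X'" if t: "t \<in> {0..1}" and pX: "p \<in> ?X" for t p
      proof -
        obtain a v where p: "p = (a,v)" "a \<in> U d j" "v \<in> V j" using pX by auto
        then have "\<phi> a \<in> V j" "\<psi> (stab d m a) \<in> V j" using \<phi>(3) \<psi>(3) stab_in_U by blast+
        then show ?thesis using p stab_in_U by (auto simp: h_def coord_space_def)
      qed
      show "h t p \<in> ?X' - graph (d + 1) j" if t: "t \<in> {0..1}" and p: "p \<in> ?S" for t p
      proof -
        obtain a v where p: "p = (a,v)" "a \<in> U d j" "v \<in> V j" "a \<in> stratum d j \<Longrightarrow> v \<noteq> (\<lambda>_. 0)"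
          using p unfolding msusp_U_eq[OF j] by auto
        have aP: "a \<in> P d" using p(2) U_subset_P by blast
        have "h t p \<notin> graph (d + 1) j"
        proof
          assume "h t p \<in> graph (d + 1) j"
          then have "(a, \<lambda>l. v l + ((1 - t) * \<phi> a l + t * \<psi> (stab d m a) l)) \<in> graph d j"
            by (simp only: h_def p(1) prod.case graph_stab_iff[OF aP])
          then have s: "a \<in> stratum d j" and eq: "(\<lambda>l. v l + ((1 - t) * \<phi> a l + t * \<psi> (stab d m a) l)) = sroot d j a"
            unfolding graph_iff by auto
          have 1: "\<phi> a = sroot d j a" using \<phi>(2)[OF s] .
          have 2: "\<psi> (stab d m a) = sroot d j a"
            using \<psi>(2)[of "stab d m a"] stab_stratum_iff[OF aP, of j] s sroot_stab[of d j a] by metis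
          have "v l = 0" for l
            using fun_cong[OF eq, of l] unfolding 1 2 by (simp add: algebra_simps)
          then show False using p(4)[OF s] by auto
        qed
        moreover have "p \<in> ?X" using p by simp
        ultimately show ?thesis using hX[OF t] by blast
      qed
    qed
    moreover have "h 0 = stab_fst d \<circ> shear \<phi>" "h 1 = shear \<psi> \<circ> stab_fst d"
      by (auto simp: h_def stab_fst_def shear_def)
    ultimately show ?thesis by simp
  qed
  have "hiso (k + int j) ?X (?X - graph d j) ?X' (?X' - graph (d + 1) j) (stab_fst d)
    \<longleftrightarrow> hiso (k + int j) ?X ?S ?X' ?S' (stab_fst d)"
    by (rule hiso_square_hind[OF pair_map_stab_graph pm shear_pair_map[OF j \<phi>] shear_pair_map[OF j \<psi>] hom])
  also have "\<dots> \<longleftrightarrow> hiso k (U d j) (U d (j - 1)) (U (d + 1) j) (U (d + 1) (j - 1)) (stab d m)"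
    using hiso_msusp[OF finite_lessThan pair_map_stab[of "j - 1" j d] openin_U_U openin_U_U, of k j]
    unfolding stab_fst_def by (simp add: card_lessThan)
  finally show ?thesis .
qed

section \<open>A single common root\<close>

text \<open>The coordinates of \<open>chart d 1\<close> other than the root, with
  \<open>e = d - n\<close>. The form \<open>1 * n\<close> is kept to match \<open>j * n\<close> for
  \<open>j = 1\<close>.\<close>

definition fib :: "nat \<Rightarrow> ((nat \<Rightarrow> nat \<Rightarrow> complex) \<times> (nat \<Rightarrow> nat \<Rightarrow> complex)) set" where
  "fib e = U e 0 \<times> P (1 * n)"

definition fib0 :: "nat \<Rightarrow> ((nat \<Rightarrow> nat \<Rightarrow> complex) \<times> (nat \<Rightarrow> nat \<Rightarrow> complex)) set" where
  "fib0 e = {(b,r). b \<in> U e 0 \<and> r \<in> P (1 * n) \<and> r \<noteq> (\<lambda>_ _. 0)}"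

definition quo_rem :: "nat \<Rightarrow> (nat \<Rightarrow> nat \<Rightarrow> complex) \<times> (nat \<Rightarrow> real) \<Rightarrow> (nat \<Rightarrow> nat \<Rightarrow> complex) \<times> (nat \<Rightarrow> nat \<Rightarrow> complex)" where
  "quo_rem d = (\<lambda>(a,x). (quo d 1 x a, rem d 1 x a))"

lemma graph_1_iff:
  assumes "1 * n \<le> d" "(a,x) \<in> chart d 1"
  shows "(a,x) \<in> graph d 1 \<longleftrightarrow> rem d 1 x a = (\<lambda>_ _. 0)"
  using assms(2) unfolding graph_eq_chart[OF assms(1)] by (auto simp: incidence_def chart_def)

lemma quo_rem_pair_map:
  assumes "1 * n \<le> d"
  shows "pair_map (chart d 1) (chart d 1 - graph d 1) (fib (d - 1 * n)) (fib0 (d - 1 * n)) (quo_rem d)"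
  unfolding pair_map_def
proof (intro conjI)
  show "continuous_on (chart d 1) (quo_rem d)" unfolding quo_rem_def case_prod_beta
    by (intro continuous_on_Pair continuous_on_quo continuous_on_rem continuous_on_fst continuous_on_snd continuous_on_id)
  show "quo_rem d ` chart d 1 \<subseteq> fib (d - 1 * n)"
    using rem_in_P by (auto simp: quo_rem_def fib_def chart_def simp del: One_nat_def mult_1)
  show "quo_rem d ` (chart d 1 - graph d 1) \<subseteq> fib0 (d - 1 * n)"
    using graph_1_iff[OF assms] rem_in_P unfolding quo_rem_def fib0_def by (auto simp: chart_def simp del: One_nat_def mult_1)
qed (auto simp: fib_def fib0_def)

text \<open>Forgetting the root is a homotopy equivalence: \<open>?g\<close> reassembles a tuple
  with root zero, and sliding the root to zero connects \<open>?g \<circ> quo_rem d\<close> with the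
  identity. A single root is always sorted, so the graph is given by remainder zero.\<close>

lemma hiso_quo_rem:
  assumes dn: "1 * n \<le> d"
  shows "hiso k (chart d 1) (chart d 1 - graph d 1) (fib (d - 1 * n)) (fib0 (d - 1 * n)) (quo_rem d)"
proof -
  let ?C = "chart d 1" and ?z = "\<lambda>_::nat. 0::real"
  let ?g = "\<lambda>(b,r). (asm d 1 ?z b r, ?z)"
  have z: "?z \<in> V 1" by (simp add: coord_space_def)
  have gch: "(asm d 1 ?z b r, ?z) \<in> ?C" if "b \<in> U (d - 1 * n) 0" "r \<in> P (1 * n)" for b r
  proof -
    have bP: "b \<in> P (d - 1 * n)" using that(1) U_subset_P by blast
    show ?thesis unfolding chart_def
      using asm_in_P[OF bP that(2)] z quo_asm[OF dn bP that(2)] that(1) by (simp only: mem_Collect_eq prod.case)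
  qed
  have qr: "quo_rem d (asm d 1 ?z b r, ?z) = (b,r)" if "b \<in> U (d - 1 * n) 0" "r \<in> P (1 * n)" for b r
  proof -
    have bP: "b \<in> P (d - 1 * n)" using that(1) U_subset_P by blast
    show ?thesis unfolding quo_rem_def
      using quo_asm[OF dn bP that(2)] rem_asm[OF dn bP that(2)] by (simp only: prod.case)
  qed
  have g: "pair_map (fib (d - 1 * n)) (fib0 (d - 1 * n)) ?C (?C - graph d 1) ?g"
    unfolding pair_map_def
  proof (intro conjI)
    show "continuous_on (fib (d - 1 * n)) ?g" unfolding case_prod_beta
      by (intro continuous_on_Pair continuous_on_asm continuous_on_fst continuous_on_snd continuous_on_id continuous_on_const)
    show "?g ` fib (d - 1 * n) \<subseteq> ?C" using gch by (auto simp: fib_def simp del: One_nat_def mult_1)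
    show "?g ` fib0 (d - 1 * n) \<subseteq> ?C - graph d 1"
    proof (rule image_subsetI)
      fix p assume "p \<in> fib0 (d - 1 * n)"
      then obtain b r where p: "p = (b,r)" "b \<in> U (d - 1 * n) 0" "r \<in> P (1 * n)" "r \<noteq> (\<lambda>_ _. 0)"
        unfolding fib0_def by blast
      have "rem d 1 ?z (asm d 1 ?z b r) = r" using qr[OF p(2,3)] by (simp add: quo_rem_def)
      then have "(asm d 1 ?z b r, ?z) \<notin> graph d 1" using graph_1_iff[OF dn gch[OF p(2,3)]] p(4) by metis
      then show "?g p \<in> ?C - graph d 1" using gch[OF p(2,3)] p(1) by simp
    qed
  qed (auto simp: fib_def fib0_def)
  show ?thesis
  proof (rule hiso_inverse[OF quo_rem_pair_map[OF dn] g])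
    have "hind k ?C (?C - graph d 1) ?C (?C - graph d 1) (slide d 1 ?z 0) =
      hind k ?C (?C - graph d 1) ?C (?C - graph d 1) (slide d 1 ?z 1)"
    proof (rule hind_homotopic[where h="slide d 1 ?z"])
      show "continuous_on ({0..1} \<times> ?C) (\<lambda>(t,p). slide d 1 ?z t p)" by (rule continuous_on_slide)
      show "slide d 1 ?z t p \<in> ?C" if "p \<in> ?C" for t p by (rule slide_in_chart(1)[OF dn z that])
      show "slide d 1 ?z t p \<in> ?C - graph d 1" if "p \<in> ?C - graph d 1" for t p
      proof -
        have p: "p \<in> ?C" "p \<notin> graph d 1" using that by auto
        have "(fst p, snd p) \<notin> graph d 1 \<longleftrightarrow> rem d 1 (snd p) (fst p) \<noteq> (\<lambda>_ _. 0)" if "p \<in> ?C" for p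
          using graph_1_iff[OF dn, of "fst p" "snd p"] that by simp
        then have "slide d 1 ?z t p \<notin> graph d 1"
          using p slide_in_chart(1,3)[OF dn z p(1), of t] by (metis prod.collapse)
        then show ?thesis using slide_in_chart(1)[OF dn z p(1)] by blast
      qed
    qed
    moreover have "hind k ?C (?C - graph d 1) ?C (?C - graph d 1) (slide d 1 ?z 0) = hind k ?C (?C - graph d 1) ?C (?C - graph d 1) (\<lambda>p. p)"
      by (rule hind_cong) (rule slide_0[OF dn])
    moreover have "hind k ?C (?C - graph d 1) ?C (?C - graph d 1) (slide d 1 ?z 1) = hind k ?C (?C - graph d 1) ?C (?C - graph d 1) (?g \<circ> quo_rem d)"
      by (rule hind_cong) (auto simp: slide_def quo_rem_def Let_def)
    ultimately show "hind k ?C (?C - graph d 1) ?C (?C - graph d 1) (?g \<circ> quo_rem d) = hind k ?C (?C - graph d 1) ?C (?C - graph d 1) (\<lambda>p. p)"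
      by simp
    show "hind k (fib (d - 1 * n)) (fib0 (d - 1 * n)) (fib (d - 1 * n)) (fib0 (d - 1 * n)) (quo_rem d \<circ> ?g) =
      hind k (fib (d - 1 * n)) (fib0 (d - 1 * n)) (fib (d - 1 * n)) (fib0 (d - 1 * n)) (\<lambda>p. p)"
      by (rule hind_cong) (use qr in \<open>auto simp: fib_def simp del: One_nat_def mult_1\<close>)
  qed
qed

definition shift :: "nat \<Rightarrow> (nat \<Rightarrow> nat \<Rightarrow> complex) \<Rightarrow> nat \<Rightarrow> complex poly" where
  "shift d a i = [:- complex_of_real (root_bound d m a + real i), 1:]"

text \<open>
  Multiplying \<open>f = h\<^sup>n q + r\<close> by \<open>L = z - c\<close> changes the quotient to \<open>L q + (L r) div h\<^sup>n\<close> and the remainder to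
  \<open>(L r) mod h\<^sup>n\<close>. The paths below lead from these (\<open>t = 0\<close>) to the stabilization of \<open>q\<close>, whose new roots
  are determined by \<open>q\<close> and not by \<open>f\<close>, and to \<open>- r\<close> (\<open>t = 1\<close>).
\<close>

definition quo_path :: "nat \<Rightarrow> real \<Rightarrow> (nat \<Rightarrow> nat \<Rightarrow> complex) \<times> (nat \<Rightarrow> real) \<Rightarrow> nat \<Rightarrow> nat \<Rightarrow> complex" where
  "quo_path d t = (\<lambda>(a,x). tup (d - 1 * n + 1) (\<lambda>i.
     monic_poly (d - 1 * n) (quo d 1 x a i) *
       [:- complex_of_real ((1 - t) * root_bound d m a + t * root_bound (d - 1 * n) m (quo d 1 x a) + real i), 1:]
     + smult (complex_of_real (1 - t)) ((low_poly (1 * n) (rem d 1 x a i) * shift d a i) div root_poly 1 x ^ n)))"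

definition rem_path :: "nat \<Rightarrow> real \<Rightarrow> (nat \<Rightarrow> nat \<Rightarrow> complex) \<times> (nat \<Rightarrow> real) \<Rightarrow> nat \<Rightarrow> nat \<Rightarrow> complex" where
  "rem_path d t = (\<lambda>(a,x). tup (1 * n) (\<lambda>i.
     ([:- complex_of_real ((1 - t) * (root_bound d m a + real i) + t), complex_of_real (1 - t):] * low_poly (1 * n) (rem d 1 x a i))
       mod root_poly 1 x ^ n))"

lemma monic_poly_stab:
  assumes "1 * n \<le> d" "i < m"
  shows "monic_poly (d + 1) (stab d m a i) = 
    root_poly 1 x ^ n * (monic_poly (d - 1 * n) (quo d 1 x a i) * shift d a i) + low_poly (1 * n) (rem d 1 x a i) * shift d a i"
proof -
  have "monic_poly d (a i) = root_poly 1 x ^ n * monic_poly (d - 1 * n) (quo d 1 x a i) + low_poly (1 * n) (rem d 1 x a i)"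
    unfolding monic_poly_quo[OF assms] low_poly_rem[OF assms(2)] by (rule mult_div_mod_eq[symmetric])
  then show ?thesis unfolding stab_eq_add_root monic_poly_add_root[OF assms(2)] shift_def
    by (simp only: distrib_right mult.assoc)
qed

lemma quo_path_0:
  assumes "1 * n \<le> d"
  shows "quo_path d 0 (a,x) = quo (d + 1) 1 x (stab d m a)"
proof -
  have "d + 1 - 1 * n = d - 1 * n + 1" using assms by simp
  then show ?thesis
    unfolding quo_path_def quo_def[of "d + 1"] prod.case
    by (simp only:) (rule tup_cong, simp add: monic_poly_stab[OF assms, of _ a x] shift_def del: mult_1 One_nat_def)
qed

lemma quo_path_1:
  "quo_path d 1 (a,x) = stab (d - 1 * n) m (quo d 1 x a)"
  unfolding quo_path_def stab_eq_add_root add_root_def prod.case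
  by (rule tup_cong) simp

lemma rem_path_0:
  assumes "1 * n \<le> d"
  shows "rem_path d 0 (a,x) = rem (d + 1) 1 x (stab d m a)"
  unfolding rem_path_def rem_def[of "d + 1"] prod.case
proof (rule tup_cong)
  fix i assume i: "i < m"
  show "([:- complex_of_real ((1 - 0) * (root_bound d m a + real i) + 0), complex_of_real (1 - 0):] * low_poly (1 * n) (rem d 1 x a i)) mod root_poly 1 x ^ n
    = monic_poly (d + 1) (stab d m a i) mod root_poly 1 x ^ n"
    unfolding monic_poly_stab[OF assms i, of a x] by (simp add: shift_def mult.commute del: mult_1 One_nat_def)
qed

text \<open>At \<open>t = 1\<close> the linear factor has become the constant -1, and the remainder
  is already reduced.\<close>

lemma rem_path_1:
  "rem_path d 1 (a,x) = (\<lambda>i k. - rem d 1 x a i k)"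
proof -
  have "(low_poly (1 * n) (rem d 1 x a i)) mod root_poly 1 x ^ n = low_poly (1 * n) (rem d 1 x a i)" if "i < m" for i
    unfolding low_poly_rem[OF that] by simp
  then have "rem_path d 1 (a,x) = tup (1 * n) (\<lambda>i. - low_poly (1 * n) (rem d 1 x a i))"
    unfolding rem_path_def prod.case by (intro tup_cong) (simp add: poly_mod_minus_left del: mult_1 One_nat_def)
  then show ?thesis by (auto simp: tup_def rem_def fun_eq_iff coeff_low_poly)
qed

lemma quo_path_in_P:
  assumes "a \<in> P d" shows "quo_path d t (a,x) \<in> P (d - 1 * n + 1)"
  unfolding quo_path_def prod.case shift_def
  by (intro tup_in_P kpoly_add kpoly_mult kpoly_smult kpoly_div_root_poly kpoly_linear' kpoly_monic_poly
      kpoly_low_poly quo_in_P rem_in_P assms K_closed)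

lemma rem_path_in_P:
  assumes "a \<in> P d" shows "rem_path d t (a,x) \<in> P (1 * n)"
proof -
  have "kpoly [:- complex_of_real c, complex_of_real e:]" for c e
    using kpoly_linear[of "- c" e] by simp
  then show ?thesis
    unfolding rem_path_def prod.case
    by (intro tup_in_P kpoly_mod_root_poly kpoly_mult kpoly_low_poly rem_in_P assms)
qed

lemma continuous_on_quo_path: "continuous_on A (\<lambda>(p,t). quo_path d t p)"
proof -
  have t: "continuous_on A snd" and a: "continuous_on A (\<lambda>q. fst (fst q))" and x: "continuous_on A (\<lambda>q. snd (fst q))"
    by (intro continuous_on_fst continuous_on_snd continuous_on_id)+
  note q = continuous_on_quo[OF x a] and r = continuous_on_rem[OF x a]
  show ?thesis
    unfolding quo_path_def case_prod_beta shift_def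
    by (intro continuous_on_tup cpoly_intros continuous_on_add continuous_on_mult continuous_on_minus continuous_on_of_real
      continuous_on_diff continuous_on_const continuous_on_root_bound t a x q r)
qed

lemma continuous_on_rem_path: "continuous_on A (\<lambda>(p,t). rem_path d t p)"
proof -
  have t: "continuous_on A snd" and a: "continuous_on A (\<lambda>q. fst (fst q))" and x: "continuous_on A (\<lambda>q. snd (fst q))"
    by (intro continuous_on_fst continuous_on_snd continuous_on_id)+
  note q = continuous_on_quo[OF x a] and r = continuous_on_rem[OF x a]
  show ?thesis
    unfolding rem_path_def case_prod_beta
    by (intro continuous_on_tup cpoly_intros continuous_on_add continuous_on_mult continuous_on_minus continuous_on_of_real
      continuous_on_diff continuous_on_const continuous_on_root_bound t a x q r)
qed

text \<open>The linear factor takes a negative value at the root, so it is a unit modulo a power of the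
  linear polynomial vanishing there.\<close>

lemma rem_path_nonzero:
  assumes x: "x 0 < root_bound d m a" and t: "t \<in> {0..1}" and r: "rem d 1 x a \<noteq> (\<lambda>_ _. 0)"
  shows "rem_path d t (a,x) \<noteq> (\<lambda>_ _. 0)"
proof
  assume z: "rem_path d t (a,x) = (\<lambda>_ _. 0)"
  define L where "L i = [:- complex_of_real ((1 - t) * (root_bound d m a + real i) + t), complex_of_real (1 - t):]" for i
  define s where "s i = low_poly (1 * n) (rem d 1 x a i)" for i
  have h: "root_poly 1 x = [:- complex_of_real (x 0), 1:]" by (simp add: root_poly_def)
  have "s i = 0" if i: "i < m" for i
  proof (rule ccontr)
    assume s0: "s i \<noteq> 0"
    have "low_poly (1 * n) (rem_path d t (a,x) i) = (L i * s i) mod root_poly 1 x ^ n"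
      unfolding rem_path_def prod.case L_def s_def
      by (rule low_poly_tup[OF i]) (rule coeff_mod_root_poly)
    moreover have "low_poly (1 * n) (rem_path d t (a,x) i) = 0" unfolding z by (rule low_poly_eqI) auto
    ultimately have "root_poly 1 x ^ n dvd L i * s i" by (simp add: dvd_eq_mod_eq_0)
    then have dvd: "[:- complex_of_real (x 0), 1:] ^ n dvd L i * s i" by (simp only: h)
    have "(1 - t) * (x 0 - (root_bound d m a + real i)) - t < 0"
    proof (cases "t = 1")
      case False
      then have "(1 - t) * (x 0 - (root_bound d m a + real i)) < 0" using x t by (intro mult_pos_neg) auto
      then show ?thesis using t by auto
    qed simp
    then have neg: "(1 - t) * x 0 - ((1 - t) * (root_bound d m a + real i) + t) \<noteq> 0"
      by (simp add: algebra_simps)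
    have "poly (L i) (complex_of_real (x 0)) = complex_of_real ((1 - t) * x 0 - ((1 - t) * (root_bound d m a + real i) + t))"
      by (simp add: L_def algebra_simps)
    then have pL: "poly (L i) (complex_of_real (x 0)) \<noteq> 0" using neg by (metis of_real_eq_0_iff)
    then have L0: "L i \<noteq> 0" by auto
    have ne: "L i * s i \<noteq> 0" using L0 s0 by simp
    have "n \<le> Polynomial.order (complex_of_real (x 0)) (L i * s i)" using dvd ne by (simp only: order_divides) blast
    also have "\<dots> = Polynomial.order (complex_of_real (x 0)) (s i)"
      using order_mult[OF ne, of "complex_of_real (x 0)"] order_0I[OF pL] by simp
    also have "\<dots> \<le> degree (s i)" by (rule order_degree[OF s0])
    also have "degree (s i) < n"
    proof -
      have "coeff (s i) (degree (s i)) \<noteq> 0" using s0 by simp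
      then show ?thesis unfolding s_def coeff_low_poly by (auto split: if_splits)
    qed
    finally show False by simp
  qed
  then have "rem d 1 x a = (\<lambda>_ _. 0)"
    unfolding rem_def fun_eq_iff
    by (auto simp: tup_def low_poly_rem s_def simp del: mult_1 One_nat_def)
  then show False using r by simp
qed

text \<open>Off the set \<open>graph d 1\<close> the path of quotients may leave the space \<open>Q\<close>, so the comparison is made on a
  neighbourhood.\<close>

definition nbhd :: "nat \<Rightarrow> ((nat \<Rightarrow> nat \<Rightarrow> complex) \<times> (nat \<Rightarrow> real)) set" where
  "nbhd d = {p \<in> chart d 1 \<inter> (U d 1 \<times> V 1). snd p 0 < root_bound d m (fst p) \<and> (\<forall>t\<in>{0..1}. quo_path d t p \<in> U (d - 1 * n + 1) 0)}"

text \<open>The points whose path leaves the required space at some time form the projection of a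
  closed set along the compact interval of times, hence a closed set.\<close>

lemma openin_nbhd: "openin (top_of_set (P d \<times> V 1)) (nbhd d)"
proof -
  let ?X = "P d \<times> V 1"
  have 1: "openin (top_of_set ?X) (chart d 1 \<inter> (U d 1 \<times> V 1))"
    by (intro openin_Int openin_chart openin_U_times_V)
  have "openin (top_of_set ?X) (?X \<inter> (\<lambda>p. root_bound d m (fst p) - snd p 0) -` {0<..})"
    by (intro continuous_openin_preimage_gen continuous_on_diff continuous_on_root_bound continuous_on_fst continuous_on_id
       continuous_on_coord[OF continuous_on_snd[OF continuous_on_id]] open_greaterThan)
  also have "?X \<inter> (\<lambda>p. root_bound d m (fst p) - snd p 0) -` {0<..} = {p \<in> ?X. snd p 0 < root_bound d m (fst p)}" by auto
  finally have 2: "openin (top_of_set ?X) {p \<in> ?X. snd p 0 < root_bound d m (fst p)}" .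
  let ?B = "P (d - 1 * n + 1) - U (d - 1 * n + 1) 0"
  have "closedin (top_of_set (P (d - 1 * n + 1))) ?B" using openin_U by (simp add: closedin_diff)
  then have "closedin (top_of_set (?X \<times> {0..1::real})) ((?X \<times> {0..1}) \<inter> (\<lambda>(p,t). quo_path d t p) -` ?B)"
    by (rule continuous_closedin_preimage_gen[OF continuous_on_quo_path, rotated]) (use quo_path_in_P in auto)
  then have "closedin (top_of_set ?X) (fst ` ((?X \<times> {0..1}) \<inter> (\<lambda>(p,t). quo_path d t p) -` ?B))"
    by (rule closedin_fst_image[OF compact_Icc])
  then have 3: "openin (top_of_set ?X) (?X - fst ` ((?X \<times> {0..1}) \<inter> (\<lambda>(p,t). quo_path d t p) -` ?B))"
    by (simp add: closedin_def)
  have "?X - fst ` ((?X \<times> {0..1}) \<inter> (\<lambda>(p,t). quo_path d t p) -` ?B) = {p \<in> ?X. \<forall>t\<in>{0..1}. quo_path d t p \<in> U (d - 1 * n + 1) 0}"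
    (is "?L = ?R")
  proof (intro equalityI subsetI)
    fix p assume p: "p \<in> ?L"
    have "quo_path d t p \<in> U (d - 1 * n + 1) 0" if t: "t \<in> {0..1}" for t
    proof (rule ccontr)
      assume "quo_path d t p \<notin> U (d - 1 * n + 1) 0"
      moreover have "quo_path d t p \<in> P (d - 1 * n + 1)" using p quo_path_in_P by (cases p) auto
      ultimately have "(p,t) \<in> (?X \<times> {0..1}) \<inter> (\<lambda>(p,t). quo_path d t p) -` ?B" using p t by auto
      then show False using p by (metis DiffD2 fst_conv image_eqI)
    qed
    then show "p \<in> ?R" using p by auto
  next
    fix p assume "p \<in> ?R" then show "p \<in> ?L" by auto
  qed
  then have "openin (top_of_set ?X) {p \<in> ?X. \<forall>t\<in>{0..1}. quo_path d t p \<in> U (d - 1 * n + 1) 0}" using 3 by simp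
  from openin_Int[OF openin_Int[OF 1 2] this]
  have "openin (top_of_set ?X) (chart d 1 \<inter> (U d 1 \<times> V 1) \<inter> {p \<in> ?X. snd p 0 < root_bound d m (fst p)} \<inter>
     {p \<in> ?X. \<forall>t\<in>{0..1}. quo_path d t p \<in> U (d - 1 * n + 1) 0})" .
  also have "(chart d 1 \<inter> (U d 1 \<times> V 1) \<inter> {p \<in> ?X. snd p 0 < root_bound d m (fst p)} \<inter>
     {p \<in> ?X. \<forall>t\<in>{0..1}. quo_path d t p \<in> U (d - 1 * n + 1) 0}) = nbhd d"
    unfolding nbhd_def chart_def by blast
  finally show ?thesis .
qed

text \<open>On the graph the remainder vanishes and the path only adds roots to the quotient, at a
  position between two root bounds. Both bounds exceed the real roots of the quotient, which are
  roots of \<open>a\<close> as well, so no common root arises.\<close>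

lemma graph_subset_nbhd:
  assumes dn: "1 * n \<le> d"
  shows "graph d 1 \<subseteq> nbhd d"
proof
  fix p assume p: "p \<in> graph d 1"
  obtain a x where ax: "p = (a,x)" by (cases p)
  have i: "(a,x) \<in> incidence d 1" and ch: "(a,x) \<in> chart d 1" and u: "(a,x) \<in> U d 1 \<times> V 1"
    using p ax graph_eq_chart[OF dn] by (auto simp: graph_def)
  have aP: "a \<in> P d" using u U_subset_P by blast
  have r0: "rem d 1 x a = (\<lambda>_ _. 0)" using i by (simp add: incidence_def)
  have q: "quo d 1 x a \<in> U (d - 1 * n) 0" using ch by (simp add: chart_def)
  have "\<bar>x 0\<bar> < root_bound d m a" by (rule incidence_bound[OF i])
  then have x: "x 0 < root_bound d m a" by simp
  have l: "low_poly (1 * n) (rem d 1 x a i) = 0" for i unfolding r0 by (rule low_poly_eqI) auto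
  have "quo_path d t (a,x) \<in> U (d - 1 * n + 1) 0" if t: "t \<in> {0..1}" for t
  proof -
    define c where "c = (1 - t) * root_bound d m a + t * root_bound (d - 1 * n) m (quo d 1 x a)"
    have eq: "quo_path d t (a,x) = add_root (d - 1 * n) c (quo d 1 x a)"
      unfolding quo_path_def prod.case l add_root_def c_def by simp
    have "y < c" if i: "i < m" and y: "poly (monic_poly (d - 1 * n) (quo d 1 x a i)) (complex_of_real y) = 0" for i y
    proof -
      have 1: "y < root_bound (d - 1 * n) m (quo d 1 x a)" using i y by (rule real_root_less_root_bound)
      have "monic_poly d (a i) = root_poly 1 x ^ n * monic_poly (d - 1 * n) (quo d 1 x a i) + low_poly (1 * n) (rem d 1 x a i)"
        unfolding monic_poly_quo[OF dn i] low_poly_rem[OF i] by (rule mult_div_mod_eq[symmetric])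
      then have "poly (monic_poly d (a i)) (complex_of_real y) = 0" unfolding l using y by simp
      with i have 2: "y < root_bound d m a" by (rule real_root_less_root_bound)
      \<comment> \<open>Write \<open>y\<close> as the same convex combination as \<open>c\<close>
        and compare term by term; at \<open>t = 0\<close> only the bound for \<open>a\<close> gives
        strictness.\<close>
      have "y = (1 - t) * y + t * y" by (simp add: algebra_simps)
      also have "\<dots> < c"
      proof (cases "t = 0")
        case True then show ?thesis using 2 by (simp add: c_def)
      next
        case False
        have "(1 - t) * y \<le> (1 - t) * root_bound d m a" using 2 t by (intro mult_left_mono) auto
        moreover have "t * y < t * root_bound (d - 1 * n) m (quo d 1 x a)" using 1 t False by (intro mult_strict_left_mono) auto
        ultimately show ?thesis unfolding c_def by linarith
      qed
      finally show ?thesis .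
    qed
    then have "roots (d - 1 * n + 1) (quo_path d t (a,x)) = roots (d - 1 * n) (quo d 1 x a)"
      unfolding eq by (rule roots_add_root)
    then show ?thesis using q quo_path_in_P[OF aP, of t x] by (simp add: U_def)
  qed
  then show "p \<in> nbhd d" using ch u x ax by (simp add: nbhd_def del: mult_1 One_nat_def)
qed

lemma pair_map_stab_fib: "pair_map (fib e) (fib0 e) (fib (e + 1)) (fib0 (e + 1)) (stab_fst e)"
  unfolding pair_map_def
proof (intro conjI continuous_on_stab_fst)
  show "stab_fst e ` fib e \<subseteq> fib (e + 1)" "stab_fst e ` fib0 e \<subseteq> fib0 (e + 1)"
    using stab_in_U[of _ e 0] by (auto simp: stab_fst_def fib_def fib0_def simp del: mult_1 One_nat_def)
qed (auto simp: fib_def fib0_def)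

lemma P_uminus: "r \<in> P d \<Longrightarrow> (\<lambda>i k. - r i k) \<in> P d"
  by (auto simp: P_def K_closed)

text \<open>Absorbs the sign with which \<open>rem_path\<close> ends; being a homeomorphism, it does
  not affect the comparison.\<close>

definition neg_snd :: "'b \<times> (nat \<Rightarrow> nat \<Rightarrow> complex) \<Rightarrow> 'b \<times> (nat \<Rightarrow> nat \<Rightarrow> complex)" where
  "neg_snd = (\<lambda>(b,r). (b, \<lambda>i k. - r i k))"

lemma pair_map_neg_snd: "pair_map (fib e) (fib0 e) (fib e) (fib0 e) neg_snd"
  unfolding pair_map_def
proof (intro conjI)
  show "continuous_on (fib e) neg_snd"
    unfolding neg_snd_def case_prod_beta
    by (intro continuous_on_Pair continuous_on_fst continuous_on_id continuous_on_coordinatewise_then_product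
        continuous_on_minus continuous_on_coord[OF continuous_on_coord[OF continuous_on_snd[OF continuous_on_id]]])
  show "neg_snd ` fib e \<subseteq> fib e" using P_uminus by (auto simp: neg_snd_def fib_def)
  have "r = (\<lambda>_ _. 0)" if "(\<lambda>i k. - r i k) = (\<lambda>_ _. 0)" for r :: "nat \<Rightarrow> nat \<Rightarrow> complex"
    using that by (simp add: fun_eq_iff)
  then show "neg_snd ` fib0 e \<subseteq> fib0 e" using P_uminus by (auto simp: neg_snd_def fib0_def)
qed (auto simp: fib_def fib0_def)

lemma hiso_neg_snd: "hiso k (fib e) (fib0 e) (fib e) (fib0 e) neg_snd"
  by (rule hiso_homeo[OF pair_map_neg_snd pair_map_neg_snd]) (auto simp: neg_snd_def)

text \<open>After excision to \<open>nbhd d\<close>, the map \<open>quo_rem\<close> followed by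
  stabilization of the quotient is compared with stabilization followed by \<open>quo_rem\<close>.
  They agree up to the paths of quotients and remainders and the sign of the remainder.\<close>

lemma hiso_graph_fib:
  assumes dn: "1 * n \<le> d"
  shows "hiso k (U d 1 \<times> V 1) (U d 1 \<times> V 1 - graph d 1) (U (d + 1) 1 \<times> V 1) (U (d + 1) 1 \<times> V 1 - graph (d + 1) 1) (stab_fst d)
    \<longleftrightarrow> hiso k (fib (d - 1 * n)) (fib0 (d - 1 * n)) (fib (d - 1 * n + 1)) (fib0 (d - 1 * n + 1)) (stab_fst (d - 1 * n))"
proof -
  let ?X = "U d 1 \<times> V 1" and ?g = "graph d 1" and ?X' = "U (d + 1) 1 \<times> V 1" and ?g' = "graph (d + 1) 1"
  let ?N = "nbhd d" and ?C = "chart d 1" and ?C' = "chart (d + 1) 1" and ?N' = "chart (d + 1) 1 \<inter> (U (d + 1) 1 \<times> V 1)"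
  let ?e = "d - 1 * n"
  have dn': "1 * n \<le> d + 1" and e': "d + 1 - 1 * n = ?e + 1" using dn by auto
  have NC: "?N \<subseteq> ?C" "?N \<subseteq> ?X" by (auto simp: nbhd_def)
  have N': "openin (top_of_set (P (d + 1) \<times> V 1)) ?N'" by (intro openin_Int openin_chart openin_U_times_V)
  have gN': "?g' \<subseteq> ?N'" using graph_eq_chart[OF dn'] by (auto simp: graph_def)
  note N = openin_nbhd[of d] graph_subset_nbhd[OF dn]
  have pi: "pair_map A (A - g) B (B - g) (\<lambda>p. p)" if "A \<subseteq> B" for A B g :: "((nat \<Rightarrow> nat \<Rightarrow> complex) \<times> (nat \<Rightarrow> real)) set"
    using that by (auto simp: pair_map_def)
  have G: "pair_map ?X (?X - ?g) ?X' (?X' - ?g') (stab_fst d)" by (rule pair_map_stab_graph)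
  have GC: "stab_fst d p \<in> ?C'" if p: "p \<in> ?N" for p
  proof -
    obtain a x where ax: "p = (a,x)" by (cases p)
    have aP: "a \<in> P d" "x \<in> V 1" using p ax by (auto simp: nbhd_def chart_def)
    \<comment> \<open>By \<open>quo_path_0\<close> the condition of \<open>nbhd d\<close> at time
      zero says that the stabilized point lies in the chart.\<close>
    have "quo_path d 0 p \<in> U (?e + 1) 0" using p unfolding nbhd_def by auto
    then have "quo (d + 1) 1 x (stab d m a) \<in> U (d + 1 - 1 * n) 0" unfolding ax quo_path_0[OF dn] e' .
    then show ?thesis using aP stab_in_P[OF aP(1)] unfolding chart_def ax stab_fst_def by auto
  qed
  have GN: "pair_map ?N (?N - ?g) ?N' (?N' - ?g') (stab_fst d)"
    unfolding pair_map_def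
  proof (intro conjI continuous_on_stab_fst)
    show "stab_fst d ` ?N \<subseteq> ?N'" using GC G NC unfolding pair_map_def by blast
    then show "stab_fst d ` (?N - ?g) \<subseteq> ?N' - ?g'" using G NC(2) unfolding pair_map_def by blast
  qed auto
  have Q: "pair_map ?C (?C - ?g) (fib ?e) (fib0 ?e) (quo_rem d)" "hiso k ?C (?C - ?g) (fib ?e) (fib0 ?e) (quo_rem d)"
    by (rule quo_rem_pair_map[OF dn] hiso_quo_rem[OF dn])+
  have Q': "pair_map ?C' (?C' - ?g') (fib (?e + 1)) (fib0 (?e + 1)) (quo_rem (d + 1))"
    "hiso k ?C' (?C' - ?g') (fib (?e + 1)) (fib0 (?e + 1)) (quo_rem (d + 1))"
    using quo_rem_pair_map[OF dn'] hiso_quo_rem[OF dn'] unfolding e' by auto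
  have "hiso k ?X (?X - ?g) ?X' (?X' - ?g') (stab_fst d) \<longleftrightarrow> hiso k ?N (?N - ?g) ?N' (?N' - ?g') (stab_fst d)"
    by (rule hiso_square[OF G GN pi[OF NC(2)] hiso_graph_chart(2)[OF dn N NC(2)] pi hiso_graph_chart(2)[OF dn' N' gN']]) auto
  also have "\<dots> \<longleftrightarrow> hiso k ?N (?N - ?g) ?C' (?C' - ?g') ((\<lambda>p. p) \<circ> stab_fst d)"
    by (rule hiso_comp_left[OF GN pi hiso_graph_chart(1)[OF dn' N' gN'], symmetric]) auto
  also have "\<dots> \<longleftrightarrow> hiso k ?N (?N - ?g) (fib (?e + 1)) (fib0 (?e + 1)) (quo_rem (d + 1) \<circ> ((\<lambda>p. p) \<circ> stab_fst d))"
    by (rule hiso_comp_left[OF pair_map_compose[OF GN pi] Q', symmetric]) auto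
  also have "\<dots> \<longleftrightarrow> hiso k ?N (?N - ?g) (fib (?e + 1)) (fib0 (?e + 1)) ((neg_snd \<circ> stab_fst ?e) \<circ> (quo_rem d \<circ> (\<lambda>p. p)))"
  proof -
    \<comment> \<open>The neighbourhood keeps the first component in \<open>U (?e + 1) 0\<close>,
      and \<open>rem_path_nonzero\<close> keeps the second nonzero off the graph.\<close>
    define h where "h t p = (quo_path d t p, rem_path d t p)" for t p
    have "hiso k ?N (?N - ?g) (fib (?e + 1)) (fib0 (?e + 1)) (h 0) \<longleftrightarrow> hiso k ?N (?N - ?g) (fib (?e + 1)) (fib0 (?e + 1)) (h 1)"
    proof (rule hiso_homotopic)
      have sw: "continuous_on ({0..1} \<times> ?N) (\<lambda>q. (snd q, fst q))"
        by (intro continuous_on_Pair continuous_on_fst continuous_on_snd continuous_on_id)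
      show "continuous_on ({0..1} \<times> ?N) (\<lambda>(t,p). h t p)"
        unfolding h_def case_prod_beta
        using continuous_on_compose[OF sw continuous_on_quo_path] continuous_on_compose[OF sw continuous_on_rem_path]
        by (intro continuous_on_Pair) (simp_all add: o_def case_prod_beta)
      show 1: "h t p \<in> fib (?e + 1)" if "t \<in> {0..1}" "p \<in> ?N" for t p
      proof -
        have "fst p \<in> P d" using that by (auto simp: nbhd_def chart_def)
        then show ?thesis using that rem_path_in_P[of "fst p" d t "snd p"] unfolding h_def fib_def nbhd_def by auto
      qed
      show "h t p \<in> fib0 (?e + 1)" if t: "t \<in> {0..1}" and p: "p \<in> ?N - ?g" for t p
      proof -
        obtain a x where ax: "p = (a,x)" by (cases p)
        have c: "(a,x) \<in> ?C" "(a,x) \<notin> ?g" and x: "x 0 < root_bound d m a" using p NC(1) ax by (auto simp: nbhd_def)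
        have "rem d 1 x a \<noteq> (\<lambda>_ _. 0)" using graph_1_iff[OF dn c(1)] c(2) by blast
        then have "rem_path d t (a,x) \<noteq> (\<lambda>_ _. 0)" by (rule rem_path_nonzero[where x = x and a = a and d = d, OF x t])
        then show ?thesis using 1[OF t, of p] p unfolding ax by (auto simp: h_def fib_def fib0_def)
      qed
    qed
    moreover have "h 0 = quo_rem (d + 1) \<circ> ((\<lambda>p. p) \<circ> stab_fst d)"
      unfolding h_def fun_eq_iff o_def quo_rem_def stab_fst_def
      using quo_path_0[OF dn] rem_path_0[OF dn] by auto
    moreover have "h 1 = (neg_snd \<circ> stab_fst ?e) \<circ> (quo_rem d \<circ> (\<lambda>p. p))"
      unfolding h_def fun_eq_iff o_def quo_rem_def stab_fst_def neg_snd_def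
      using quo_path_1 rem_path_1 by auto
    ultimately show ?thesis by simp
  qed
  also have "\<dots> \<longleftrightarrow> hiso k (fib ?e) (fib0 ?e) (fib (?e + 1)) (fib0 (?e + 1)) (neg_snd \<circ> stab_fst ?e)"
  proof (rule hiso_comp_right)
    show "pair_map ?N (?N - ?g) (fib ?e) (fib0 ?e) (quo_rem d \<circ> (\<lambda>p. p))"
      by (rule pair_map_compose[OF pi[OF NC(1)] Q(1)])
    show "pair_map (fib ?e) (fib0 ?e) (fib (?e + 1)) (fib0 (?e + 1)) (neg_snd \<circ> stab_fst ?e)"
      by (rule pair_map_compose[OF pair_map_stab_fib pair_map_neg_snd])
    show "hiso k ?N (?N - ?g) (fib ?e) (fib0 ?e) (quo_rem d \<circ> (\<lambda>p. p))"
      using hiso_comp_right[OF pi[OF NC(1)] Q(1) hiso_graph_chart(1)[OF dn N NC(1)]] Q(2) by blast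
  qed
  also have "\<dots> \<longleftrightarrow> hiso k (fib ?e) (fib0 ?e) (fib (?e + 1)) (fib0 (?e + 1)) (stab_fst ?e)"
    by (rule hiso_comp_left[OF pair_map_stab_fib pair_map_neg_snd hiso_neg_snd])
  finally show ?thesis .
qed

section \<open>Remainders as vectors of real coordinates\<close>

text \<open>The boolean selects the real part (\<open>False\<close>) or the imaginary part
  (\<open>True\<close>) of a coefficient; over the reals only the former occurs.\<close>

definition real_index :: "(nat \<times> nat \<times> bool) set" where
  "real_index = {..<m} \<times> {..<n} \<times> (if K = \<real> then {False} else UNIV)"

lemma finite_real_index: "finite real_index"
  by (simp add: real_index_def)

lemma card_real_index: "card real_index = dimK K * m * n"
  by (simp add: real_index_def card_cartesian_product dimK_def UNIV_bool)

definition to_complex :: "(nat \<times> nat \<times> bool \<Rightarrow> real) \<Rightarrow> nat \<Rightarrow> nat \<Rightarrow> complex" where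
  "to_complex v = (\<lambda>i k. Complex (v (i,k,False)) (v (i,k,True)))"

definition to_real :: "(nat \<Rightarrow> nat \<Rightarrow> complex) \<Rightarrow> nat \<times> nat \<times> bool \<Rightarrow> real" where
  "to_real r = (\<lambda>(i,k,b). if b then Im (r i k) else Re (r i k))"

lemma to_complex_in_P: "v \<in> coord_space real_index \<Longrightarrow> to_complex v \<in> P (1 * n)"
  using K by (auto simp: to_complex_def P_def coord_space_def real_index_def complex_is_Real_iff complex_eq_iff)

lemma to_real_in_coord_space: "r \<in> P (1 * n) \<Longrightarrow> to_real r \<in> coord_space real_index"
  using K by (auto simp: to_real_def P_def coord_space_def real_index_def complex_is_Real_iff not_less split: if_splits)
    (metis linorder_not_less zero_complex.sel)+

lemma to_complex_real: "to_complex (to_real r) = r" "to_real (to_complex v) = v"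
  by (auto simp: to_complex_def to_real_def fun_eq_iff)

text \<open>A remainder vanishes exactly when its real coordinates do, so the pair is the iterated
  suspension of \<open>U e 0\<close> relative to the empty set.\<close>

lemma fib_coord:
  "pair_map (U e 0 \<times> coord_space real_index) (msusp (U e 0) {} real_index) (fib e) (fib0 e) (\<lambda>(b,v). (b, to_complex v))"
  "hiso k (U e 0 \<times> coord_space real_index) (msusp (U e 0) {} real_index) (fib e) (fib0 e) (\<lambda>(b,v). (b, to_complex v))"
proof -
  let ?X = "U e 0 \<times> coord_space real_index"
  have z: "to_complex (\<lambda>_. 0) = (\<lambda>_ _. 0)" by (simp add: to_complex_def fun_eq_iff complex_eq_iff)
  then have z1: "to_complex v = (\<lambda>_ _. 0) \<longleftrightarrow> v = (\<lambda>_. 0)" for v by (metis to_complex_real(2))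
  have z2: "to_real r = (\<lambda>_. 0) \<longleftrightarrow> r = (\<lambda>_ _. 0)" for r using z1 by (metis to_complex_real)
  show p: "pair_map ?X (msusp (U e 0) {} real_index) (fib e) (fib0 e) (\<lambda>(b,v). (b, to_complex v))"
    unfolding pair_map_def
  proof (intro conjI)
    have s: "continuous_on ?X (\<lambda>p. snd p)" by (intro continuous_on_snd continuous_on_id)
    show "continuous_on ?X (\<lambda>(b,v). (b, to_complex v))"
      unfolding case_prod_beta to_complex_def Complex_eq
      by (intro continuous_on_Pair continuous_on_fst continuous_on_id continuous_on_coordinatewise_then_product
         continuous_on_add continuous_on_mult continuous_on_const continuous_on_of_real continuous_on_coord[OF s])
  qed (use to_complex_in_P z1 in \<open>auto simp: msusp_def fib_def fib0_def simp del: mult_1\<close>)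
  have p': "pair_map (fib e) (fib0 e) ?X (msusp (U e 0) {} real_index) (\<lambda>(b,r). (b, to_real r))"
    unfolding pair_map_def
  proof (intro conjI)
    have s: "continuous_on (fib e) (\<lambda>p. snd p)" by (intro continuous_on_snd continuous_on_id)
    have "continuous_on (fib e) (\<lambda>p. to_real (snd p))"
    proof (rule continuous_on_coordinatewise_then_product)
      fix q :: "nat \<times> nat \<times> bool"
      obtain i k b where q: "q = (i,k,b)" by (cases q)
      show "continuous_on (fib e) (\<lambda>p. to_real (snd p) q)"
        by (cases b) (auto simp: to_real_def q intro!: continuous_on_Re continuous_on_Im continuous_on_coord[OF continuous_on_coord[OF s]])
    qed
    then show "continuous_on (fib e) (\<lambda>(b,r). (b, to_real r))"
      unfolding case_prod_beta by (intro continuous_on_Pair continuous_on_fst continuous_on_id)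
  qed (use to_real_in_coord_space z2 in \<open>auto simp: msusp_def fib_def fib0_def simp del: mult_1\<close>)
  show "hiso k ?X (msusp (U e 0) {} real_index) (fib e) (fib0 e) (\<lambda>(b,v). (b, to_complex v))"
    by (rule hiso_homeo[OF p p']) (auto simp: to_complex_real)
qed

lemma openin_empty_top: "openin (top_of_set A) {}" by simp

lemma pair_map_stab_Q: "pair_map (U e 0) {} (U (e + 1) 0) {} (stab e m)"
  using pair_map_stab[of 0 0 e] by (auto simp: pair_map_def)

lemma hiso_fib:
  "hiso (k + int (dimK K * m * n)) (fib e) (fib0 e) (fib (e + 1)) (fib0 (e + 1)) (stab_fst e)
    \<longleftrightarrow> hiso k (U e 0) {} (U (e + 1) 0) {} (stab e m)"
proof -
  have pm: "pair_map (U e 0 \<times> coord_space real_index) (msusp (U e 0) {} real_index)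
    (U (e + 1) 0 \<times> coord_space real_index) (msusp (U (e + 1) 0) {} real_index) (\<lambda>(y,v). (stab e m y, v))"
    by (rule pair_map_msusp[OF pair_map_stab_Q])
  have "hiso (k + int (dimK K * m * n)) (fib e) (fib0 e) (fib (e + 1)) (fib0 (e + 1)) (stab_fst e)
    \<longleftrightarrow> hiso (k + int (dimK K * m * n)) (U e 0 \<times> coord_space real_index) (msusp (U e 0) {} real_index)
    (U (e + 1) 0 \<times> coord_space real_index) (msusp (U (e + 1) 0) {} real_index) (\<lambda>(y,v). (stab e m y, v))"
    by (rule hiso_square[OF pair_map_stab_fib pm fib_coord fib_coord]) (auto simp: stab_fst_def)
  also have "\<dots> \<longleftrightarrow> hiso k (U e 0) {} (U (e + 1) 0) {} (stab e m)"
    using hiso_msusp[OF finite_real_index pair_map_stab_Q openin_empty_top openin_empty_top, of k e]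
    unfolding card_real_index .
  finally show ?thesis .
qed

text \<open>By the suspension shift the group is one of \<open>U e 0\<close> in negative
  degree.\<close>

lemma hzero_fib: "k < int (dimK K * m * n) \<Longrightarrow> hzero k (fib e) (fib0 e)"
proof -
  assume k: "k < int (dimK K * m * n)"
  have "hzero (k - int (dimK K * m * n)) (U e 0) {}" using k by (intro hzero_negative) simp
  then have "hzero (k - int (dimK K * m * n) + int (card real_index)) (U e 0 \<times> coord_space real_index) (msusp (U e 0) {} real_index)"
    using hzero_msusp[OF finite_real_index openin_empty_top] by blast
  then have "hzero k (U e 0 \<times> coord_space real_index) (msusp (U e 0) {} real_index)" by (simp add: card_real_index)
  then show ?thesis using hiso_hzero[OF fib_coord(2)] by blast
qed

section \<open>Contractibility of the space of all tuples, and the induction on the degree\<close>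

text \<open>Scaling the lower coefficients contracts each space to the tuple of pure powers.
  Stabilization followed by the constant map is constant, so two out of three applies.\<close>

lemma hiso_P: "hiso k (P d) {} (P (d + 1)) {} (stab d m)"
proof -
  let ?z = "(\<lambda>_ _. 0) :: nat \<Rightarrow> nat \<Rightarrow> complex"
  have c: "pair_map (P d) {} {?z} {} (\<lambda>_. ?z)" for d by (auto simp: pair_map_def)
  have i: "pair_map {?z} {} (P d) {} (\<lambda>_. ?z)" for d using zero_in_P by (auto simp: pair_map_def)
  have h: "hiso k (P d) {} {?z} {} (\<lambda>_. ?z)" for d
  proof (rule hiso_inverse[OF c i])
    define h where "h t a = (\<lambda>i k. complex_of_real (1 - t) * a i k)" for t :: real and a :: "nat \<Rightarrow> nat \<Rightarrow> complex"
    have "hind k (P d) {} (P d) {} (h 0) = hind k (P d) {} (P d) {} (h 1)"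
    proof (rule hind_homotopic)
      have s: "continuous_on ({0..1} \<times> P d) (\<lambda>p. snd p)" by (intro continuous_on_snd continuous_on_id)
      show "continuous_on ({0..1} \<times> P d) (\<lambda>(t,a). h t a)"
        unfolding h_def case_prod_beta
        by (intro continuous_on_coordinatewise_then_product continuous_on_mult continuous_on_of_real continuous_on_diff
          continuous_on_const continuous_on_fst continuous_on_id continuous_on_coord[OF continuous_on_coord[OF s]])
      show "h t a \<in> P d" if "t \<in> {0..1}" "a \<in> P d" for t a
        using that unfolding h_def P_def by (auto intro!: K_closed(5) simp del: of_real_diff) (simp_all add: K_closed del: of_real_diff)
    qed auto
    moreover have "h 0 = (\<lambda>a. a)" "h 1 = (\<lambda>_. ?z) \<circ> (\<lambda>_. ?z)" by (auto simp: h_def)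
    ultimately show "hind k (P d) {} (P d) {} ((\<lambda>_. ?z) \<circ> (\<lambda>_. ?z)) = hind k (P d) {} (P d) {} (\<lambda>a. a)" by simp
    show "hind k {?z} {} {?z} {} ((\<lambda>_. ?z) \<circ> (\<lambda>_. ?z)) = hind k {?z} {} {?z} {} (\<lambda>a. a)"
      by (rule hind_cong) simp
  qed
  have s: "pair_map (P d) {} (P (d + 1)) {} (stab d m)"
    using stab_in_P continuous_on_stab[OF continuous_on_id] by (auto simp: pair_map_def)
  have "(\<lambda>_. ?z) \<circ> stab d m = (\<lambda>_. ?z)" by auto
  then show ?thesis using hiso_comp_left[OF s c h] h by metis
qed

lemma pair_map_stab_P: "pair_map (P d) (U d 0) (P (d + 1)) (U (d + 1) 0) (stab d m)"
  using stab_in_P stab_in_U continuous_on_stab[OF continuous_on_id] U_subset_P by (auto simp: pair_map_def)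

lemma hiso_U1_P: "hiso k (U d 1) (U d 0) (P d) (U d 0) (\<lambda>a. a)"
  by (rule hiso_inclusion_of_hzero[OF U_mono U_subset_P hzero_P_U1 hzero_P_U1]) simp

text \<open>Restricting to \<open>U d 1\<close> leaves the degree \<open>k\<close>. The coordinate
  of the single root raises it by one, and removing the coordinates of the remainder lowers it by
  \<open>dimK K * m * n\<close>.\<close>

lemma hiso_PU_iff:
  assumes dn: "n \<le> d"
  shows "hiso k (P d) (U d 0) (P (d + 1)) (U (d + 1) 0) (stab d m) \<longleftrightarrow>
    hiso (k + 1 - int (dimK K * m * n)) (U (d - n) 0) {} (U (d - n + 1) 0) {} (stab (d - n) m)"
proof -
  have dn': "1 * n \<le> d" using dn by simp
  have i: "pair_map (U d 1) (U d 0) (P d) (U d 0) (\<lambda>a. a)" for d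
    using U_mono[of 0 1 d] U_subset_P by (auto simp: pair_map_def)
  have "hiso k (P d) (U d 0) (P (d + 1)) (U (d + 1) 0) (stab d m)
    \<longleftrightarrow> hiso k (U d 1) (U d 0) (U (d + 1) 1) (U (d + 1) 0) (stab d m)"
    by (rule hiso_square[OF pair_map_stab_P pair_map_stab i hiso_U1_P i hiso_U1_P]) auto
  also have "\<dots> \<longleftrightarrow> hiso (k + 1) (fib (d - 1 * n)) (fib0 (d - 1 * n)) (fib (d - 1 * n + 1)) (fib0 (d - 1 * n + 1)) (stab_fst (d - 1 * n))"
    using hiso_stab_graph[of 1 k d] hiso_graph_fib[OF dn', of "k + 1"] by simp
  also have "\<dots> \<longleftrightarrow> hiso (k + 1 - int (dimK K * m * n)) (U (d - n) 0) {} (U (d - n + 1) 0) {} (stab (d - n) m)"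
    using hiso_fib[of "k + 1 - int (dimK K * m * n)" "d - n"] by simp
  finally show ?thesis .
qed

lemma hzero_PU:
  assumes "k + 1 < int (dimK K * m * n)" "n \<le> d"
  shows "hzero k (P d) (U d 0)"
proof -
  have dn: "1 * n \<le> d" using assms by simp
  have "hzero (k + 1) (fib (d - 1 * n)) (fib0 (d - 1 * n))" by (rule hzero_fib[OF assms(1)])
  then have "hzero (k + int 1) (chart d 1) (chart d 1 - graph d 1)" using hiso_hzero[OF hiso_quo_rem[OF dn]] by simp
  then have "hzero k (U d 1) (U d 0)" using hzero_U_iff_chart[OF order_refl dn] by simp
  then show ?thesis using hiso_hzero[OF hiso_U1_P] by blast
qed

text \<open>Strong induction in steps of \<open>n\<close>. The five lemma reduces the claim to the
  pairs of \<open>P\<close> and \<open>U\<close> with index 0, and \<open>hiso_PU_iff\<close>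
  reduces these to degree \<open>d - n\<close>.\<close>

theorem hiso_stab:
  assumes "d div n = (d + 1) div n \<or> k \<le> (int (dimK K * m * n) - 2) * (int (d div n) + 1) - 1"
  shows "hiso k (U d 0) {} (U (d + 1) 0) {} (stab d m)"
  using assms
proof (induction d arbitrary: k rule: less_induct)
  case (less d)
  let ?D = "int (dimK K * m * n)"
  \<comment> \<open>For pairs the bound is larger by one, because the five lemma uses them in
    degrees \<open>k\<close> and \<open>k + 1\<close>.\<close>
  have R: "hiso k (P d) (U d 0) (P (d + 1)) (U (d + 1) 0) (stab d m)"
    if k: "d div n = (d + 1) div n \<or> k \<le> (?D - 2) * (int (d div n) + 1)" for k
  proof (cases "n \<le> d")
    case True
    have e: "d div n = (d - n) div n + 1" "(d + 1) div n = (d - n + 1) div n + 1"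
      using True n by (auto simp: le_div_geq Suc_diff_le)
    have "hiso (k + 1 - ?D) (U (d - n) 0) {} (U (d - n + 1) 0) {} (stab (d - n) m)"
    proof (rule less.IH)
      show "d - n < d" using True n by simp
      \<comment> \<open>The homological degree drops by \<open>?D - 1\<close> and the bound on
        \<open>k\<close> only by \<open>?D - 2\<close>; the difference is the \<open>- 1\<close> in
        the induction hypothesis.\<close>
      show "(d - n) div n = (d - n + 1) div n \<or> k + 1 - ?D \<le> (?D - 2) * (int ((d - n) div n) + 1) - 1"
        using k unfolding e by (auto simp: algebra_simps)
    qed
    then show ?thesis using hiso_PU_iff[OF True] by blast
  next
    case False
    then have "U d 0 = P d" by (intro U_eq_P) simp
    then have 1: "hzero k (P d) (U d 0)" by (simp add: hzero_same)
    have 2: "hzero k (P (d + 1)) (U (d + 1) 0)"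
    proof (cases "d + 1 = n")
      case True
      \<comment> \<open>Common roots first become possible in degree \<open>d + 1\<close>. Now the
        bound reads \<open>k \<le> ?D - 2\<close>, which is exactly the range of
        \<open>hzero_PU\<close>.\<close>
      have "(d + 1) div n = 1" "d div n = 0" using True n by auto
      then show ?thesis using k True by (intro hzero_PU) auto
    next
      case False
      then have "U (d + 1) 0 = P (d + 1)" using \<open>\<not> n \<le> d\<close> by (intro U_eq_P) simp
      then show ?thesis by (simp add: hzero_same)
    qed
    from 1 2 show ?thesis by (rule hiso_of_hzero)
  qed
  show ?case
    by (rule hiso_five[OF pair_map_stab_P _ _ hiso_P hiso_P]) (rule R; use less.prems in auto)+
qed

end

theorem theorem4p3:
  fixes K :: "complex set" and d m n :: nat
  assumes "K = \<real> \<or> K = UNIV"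
    and "1 \<le> d" and "1 \<le> m" and "1 \<le> n"
    and "(m, n) \<noteq> (1, 1)"
    and "3 \<le> dimK K * m * n"
  shows "(d div n = (d + 1) div n \<longrightarrow>
            homology_equivalence (Qtop K d m n) (Qtop K (d + 1) m n) (stab d m))
       \<and> (d div n < (d + 1) div n \<longrightarrow>
            homology_equivalence_through
              ((int (dimK K * m * n) - 2) * (int (d div n) + 1) - 1)
              (Qtop K d m n) (Qtop K (d + 1) m n) (stab d m))"
proof -
  interpret tuples K m n using assms by unfold_locales auto
  have Q: "Qtop K e m n = top_of_set (U e 0)" for e by (simp add: Qtop_def Qspace_eq)
  have cont: "continuous_map (Qtop K d m n) (Qtop K (d + 1) m n) (stab d m)"
    using pair_map_stab_Q[of d] unfolding Q by (auto simp: pair_map_def)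
  \<comment> \<open>The given notion of isomorphism on homology is translated into
    \<open>hiso\<close> on the open members \<open>U d 0\<close> and \<open>U (d + 1) 0\<close> of
    the filtrations.\<close>
  have "Defs.hom_induced p (Qtop K d m n) (Qtop K (d + 1) m n) (stab d m)
     \<in> iso (Defs.homology_group p (Qtop K d m n)) (Defs.homology_group p (Qtop K (d + 1) m n))
    \<longleftrightarrow> hiso (int p) (U d 0) {} (U (d + 1) 0) {} (stab d m)" for p
    using Defs_hom_induced_iso_iff[OF cont, of p] by (simp only: hiso_def Q)
  then show ?thesis
    unfolding homology_equivalence_def homology_equivalence_through_def
    using cont hiso_stab[of d] by auto
qed

end
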